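(* Let $d>2$ be an integer and $\beta>0$. For every $0<\delta<R<\infty$ and every bounded continuous function $\Phi:\mathsf M_D\to\mathbb R$, $$\sup_{j\in\mathbb N:\ \delta\le j/V_L\le R}\Big|\int_{\mathsf M_D}\Phi(m)\,\mathsf J^D_{L,j}(dm)-\Phi\big(\mathbb Q^{\mathrm{tab}}_{D,\mathrm{two}}\big)\Big|\longrightarrow0\qquad(L\to\infty).$$
   Context: $\Lambda_L=(0,L)^d$, $V_L=L^d$, $Q=(0,1)^d$. $q^{\Lambda_L,D}_t$ is the Dirichlet heat kernel of $e^{t\Delta}$ on $\Lambda_L$. Dirichlet one-loop law of duration $\beta j$: choose the root $A\in\Lambda_L$ with density $q^{\Lambda_L,D}_{\beta j}(A,A)/\int_{\Lambda_L}q^{\Lambda_L,D}_{\beta j}(z,z)\,dz$, and given $A$ let $\omega:[0,\beta j]\to\overline{\Lambda_L}$ be the bridge from $A$ to $A$ of Brownian motion with generator $\Delta$ killed on $\partial\Lambda_L$ (conditioned to survive and to end at $A$). Mark. $S_{L,j}=\beta j/L^2$; $Y_{L,j}(s)=L^{-1}\omega(L^2s)$, $0\le s\le S_{L,j}$, extended $S_{L,j}$-periodically to $\mathbb R$; $(\theta_u\gamma)(t)=\gamma(u+t)$. $\mathcal X_D=C_{\mathrm{loc}}(\mathbb R,\overline Q)$ is the space of continuous paths $\mathbb R\to\overline Q$ with uniform convergence on compact time intervals; $\mathsf M_D=\mathcal P(\mathcal X_D)$ with the weak topology. The mark is $\mathcal M^D_{L,j}=\frac1{S_{L,j}}\int_0^{S_{L,j}}\delta_{\theta_uY_{L,j}}\,du\in\mathsf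 M_D$, and $\mathsf J^D_{L,j}$ is its law under the Dirichlet one-loop law of duration $\beta j$. Limit. $p^{Q,D}_t$ is the Dirichlet heat kernel of $e^{t\Delta}$ on $Q$, $h_D(r)=2^{d/2}\prod_{\ell=1}^d\sin(\pi r_\ell)$, $\varepsilon_D=\pi^2d$, and $p^{\mathrm{tab}}_t(r,s)=e^{\varepsilon_Dt}\frac{h_D(s)}{h_D(r)}p^{Q,D}_t(r,s)$. $\mathbb Q^{\mathrm{tab}}_{D,\mathrm{two}}\in\mathcal P(\mathcal X_D)$ is the law of the two-sided stationary process with finite-dimensional distributions, for $t_1<\dots<t_k$, $h_D(r_1)^2dr_1\,p^{\mathrm{tab}}_{t_2-t_1}(r_1,r_2)\cdots p^{\mathrm{tab}}_{t_k-t_{k-1}}(r_{k-1},r_k)\,dr_2\cdots dr_k$. *)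

theory Defs
  imports "HOL-Probability.Probability"
begin

section \<open>Path spaces and spaces of probability measures\<close>

text \<open>
  A path with time set \<open>I\<close> is represented by a function on \<open>\<real>\<close> that is
  \<^const>\<open>extensional\<close> on \<open>I\<close>, so that a path is determined by its values on \<open>I\<close>
  (for \<open>I = UNIV\<close> this is no restriction).
\<close>

definition paths :: "real set \<Rightarrow> 'a::metric_space set \<Rightarrow> (real \<Rightarrow> 'a) set" where
  "paths I S = {\<omega> \<in> extensional I. continuous_on I \<omega> \<and> \<omega> ` I \<subseteq> S}"

definition cloc_open :: "real set \<Rightarrow> 'a::metric_space set \<Rightarrow> (real \<Rightarrow> 'a) set \<Rightarrow> bool" where
  "cloc_open I S U \<longleftrightarrow> U \<subseteq> paths I S \<and>
     (\<forall>\<omega>\<in>U. \<exists>K e. compact K \<and> K \<subseteq> I \<and> e > 0 \<and>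
        {\<eta> \<in> paths I S. \<forall>t\<in>K. dist (\<eta> t) (\<omega> t) < e} \<subseteq> U)"

text \<open>The topology of uniform convergence on compact subsets of the time set.\<close>

definition cloc :: "real set \<Rightarrow> 'a::metric_space set \<Rightarrow> (real \<Rightarrow> 'a) topology" where
  "cloc I S = topology (cloc_open I S)"

lemma istopology_cloc_open: "istopology (cloc_open I S)"
  unfolding istopology_def
proof (intro conjI allI impI)
  fix U V assume U: "cloc_open I S U" and V: "cloc_open I S V"
  show "cloc_open I S (U \<inter> V)"
    unfolding cloc_open_def
  proof (intro conjI ballI)
    show "U \<inter> V \<subseteq> paths I S" using U by (auto simp: cloc_open_def)
  next
    fix \<omega> assume w: "\<omega> \<in> U \<inter> V"
    obtain K e where K: "compact K" "K \<subseteq> I" "e > 0"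
      "{\<eta> \<in> paths I S. \<forall>t\<in>K. dist (\<eta> t) (\<omega> t) < e} \<subseteq> U"
      using U w unfolding cloc_open_def by blast
    obtain K' e' where K': "compact K'" "K' \<subseteq> I" "e' > 0"
      "{\<eta> \<in> paths I S. \<forall>t\<in>K'. dist (\<eta> t) (\<omega> t) < e'} \<subseteq> V"
      using V w unfolding cloc_open_def by blast
    have "{\<eta> \<in> paths I S. \<forall>t\<in>K \<union> K'. dist (\<eta> t) (\<omega> t) < min e e'} \<subseteq> U \<inter> V"
      using K(4) K'(4) by auto
    then show "\<exists>K e. compact K \<and> K \<subseteq> I \<and> e > 0 \<and>
        {\<eta> \<in> paths I S. \<forall>t\<in>K. dist (\<eta> t) (\<omega> t) < e} \<subseteq> U \<inter> V"
      using K K' by (intro exI[of _ "K \<union> K'"] exI[of _ "min e e'"]) auto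
  qed
next
  fix \<K> assume A: "\<forall>U\<in>\<K>. cloc_open I S U"
  show "cloc_open I S (\<Union>\<K>)"
    unfolding cloc_open_def
  proof (intro conjI ballI)
    show "\<Union>\<K> \<subseteq> paths I S" using A by (auto simp: cloc_open_def)
  next
    fix \<omega> assume "\<omega> \<in> \<Union>\<K>"
    then obtain U where U: "U \<in> \<K>" "\<omega> \<in> U" by (rule UnionE)
    have "cloc_open I S U" using A U(1) by blast
    then obtain K e where K: "compact K" "K \<subseteq> I" "e > 0"
      and sub: "{\<eta> \<in> paths I S. \<forall>t\<in>K. dist (\<eta> t) (\<omega> t) < e} \<subseteq> U"
      using U(2) unfolding cloc_open_def by meson
    have "{\<eta> \<in> paths I S. \<forall>t\<in>K. dist (\<eta> t) (\<omega> t) < e} \<subseteq> \<Union>\<K>"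
      using sub Union_upper[OF U(1)] by (rule subset_trans)
    with K show "\<exists>K e. compact K \<and> K \<subseteq> I \<and> e > 0 \<and>
        {\<eta> \<in> paths I S. \<forall>t\<in>K. dist (\<eta> t) (\<omega> t) < e} \<subseteq> \<Union>\<K>"
      by (intro exI conjI)
  qed
qed

lemma openin_cloc: "openin (cloc I S) U \<longleftrightarrow> cloc_open I S U"
  unfolding cloc_def by (simp add: istopology_cloc_open)

lemma topspace_cloc: "topspace (cloc I S) = paths I S"
proof
  show "topspace (cloc I S) \<subseteq> paths I S"
    using openin_cloc[of I S "topspace (cloc I S)"] by (auto simp: cloc_open_def)
  have "cloc_open I S (paths I S)"
    unfolding cloc_open_def
    by (intro conjI ballI exI[of _ "{}"] exI[of _ "1::real"]) auto
  then have "openin (cloc I S) (paths I S)"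
    by (simp only: openin_cloc)
  then show "paths I S \<subseteq> topspace (cloc I S)"
    by (rule openin_subset)
qed

definition borel_of :: "'a topology \<Rightarrow> 'a measure" where
  "borel_of X = sigma (topspace X) {U. openin X U}"

definition prob_measures :: "'a topology \<Rightarrow> 'a measure set" where
  "prob_measures X = {P. prob_space P \<and> sets P = sets (borel_of X)}"

text \<open>
  The weak topology on the Borel probability measures on \<open>X\<close>: the coarsest topology for
  which \<open>P \<mapsto> \<integral> f dP\<close> is continuous for every bounded continuous \<open>f\<close>.
\<close>

definition weak_topology :: "'a topology \<Rightarrow> 'a measure topology" where
  "weak_topology X = topology_generated_by
     {{P \<in> prob_measures X. (\<integral>x. f x \<partial>P) \<in> U} | f (U :: real set).
        continuous_map X euclideanreal f \<and> bounded (f ` topspace X) \<and> open U}"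

lemma topspace_weak_topology: "topspace (weak_topology X) = prob_measures X"
proof -
  have "prob_measures X \<in> {{P \<in> prob_measures X. (\<integral>x. f x \<partial>P) \<in> U} | f (U :: real set).
        continuous_map X euclideanreal f \<and> bounded (f ` topspace X) \<and> open U}"
    by (rule CollectI, rule exI[of _ "\<lambda>_. 0"], rule exI[of _ UNIV])
      (auto simp: bounded_iff)
  then have "prob_measures X \<subseteq> topspace (weak_topology X)"
    unfolding weak_topology_def topology_generated_by_topspace by (rule Union_upper)
  moreover have "topspace (weak_topology X) \<subseteq> prob_measures X"
    unfolding weak_topology_def topology_generated_by_topspace by (rule Union_least) auto
  ultimately show ?thesis by (rule antisym[rotated])
qed

section \<open>The Dirichlet heat kernel\<close>

text \<open>\<open>D = \<Sum>\<^sub>b \<partial>\<^sub>b\<^sup>2 g (x)\<close>, with all these second partial derivatives existing.\<close>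

definition has_laplacian :: "('a::euclidean_space \<Rightarrow> real) \<Rightarrow> real \<Rightarrow> 'a \<Rightarrow> bool" where
  "has_laplacian g D x \<longleftrightarrow> (\<exists>g1 g2.
     (\<forall>b\<in>Basis.
        (\<forall>\<^sub>F s in nhds 0. ((\<lambda>s. g (x + s *\<^sub>R b)) has_real_derivative g1 b s) (at s)) \<and>
        (g1 b has_real_derivative g2 b) (at 0)) \<and>
     D = (\<Sum>b\<in>Basis. g2 b))"

text \<open>\<open>u(t) = e\<^bsup>t\<Delta>\<^esup> f\<close>, where \<open>\<Delta>\<close> is the Dirichlet Laplacian on \<open>\<Omega>\<close>.\<close>

definition dirichlet_heat_flow ::
    "'a::euclidean_space set \<Rightarrow> ('a \<Rightarrow> real) \<Rightarrow> (real \<Rightarrow> 'a \<Rightarrow> real) \<Rightarrow> bool" where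
  "dirichlet_heat_flow \<Omega> f u \<longleftrightarrow>
     continuous_on ({0..} \<times> closure \<Omega>) (\<lambda>(t, x). u t x) \<and>
     (\<forall>x\<in>closure \<Omega>. u 0 x = f x) \<and>
     (\<forall>t\<ge>0. \<forall>x\<in>frontier \<Omega>. u t x = 0) \<and>
     (\<forall>t>0. \<forall>x\<in>\<Omega>. \<exists>D. has_laplacian (u t) D x \<and> ((\<lambda>s. u s x) has_real_derivative D) (at t))"

text \<open>
  \<open>q\<close> is the continuous integral kernel of \<open>e\<^bsup>t\<Delta>\<^esup>\<close>, acting on \<open>C\<^sub>0(\<Omega>)\<close>, for a bounded open
  \<open>\<Omega>\<close> with regular boundary. By the parabolic maximum principle this determines
  \<open>q t x y\<close> for \<open>t > 0\<close> and \<open>x, y \<in> closure \<Omega>\<close>; all other values of \<open>q\<close> are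
  unspecified and are never used below.
\<close>

definition dirichlet_heat_kernel ::
    "'a::euclidean_space set \<Rightarrow> (real \<Rightarrow> 'a \<Rightarrow> 'a \<Rightarrow> real) \<Rightarrow> bool" where
  "dirichlet_heat_kernel \<Omega> q \<longleftrightarrow>
     (\<forall>t>0. continuous_on (closure \<Omega> \<times> closure \<Omega>) (\<lambda>(x, y). q t x y)) \<and>
     (\<forall>f. continuous_on (closure \<Omega>) f \<and> (\<forall>x\<in>frontier \<Omega>. f x = 0) \<longrightarrow>
        dirichlet_heat_flow \<Omega> f
          (\<lambda>t x. if t = 0 then f x else (LINT y:\<Omega>|lborel. q t x y * f y)))"

section \<open>The Dirichlet one-loop law\<close>

definition cube :: "real \<Rightarrow> (real ^ 'd) set" where
  "cube L = {x. \<forall>i. 0 < x $ i \<and> x $ i < L}"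

text \<open>The joint law of \<open>\<omega>(t\<^sub>0), \<dots>, \<omega>(t\<^sub>n)\<close>.\<close>

definition fdd ::
    "(real \<Rightarrow> 'a::euclidean_space) measure \<Rightarrow> nat \<Rightarrow> (nat \<Rightarrow> real) \<Rightarrow> (nat \<Rightarrow> 'a) measure" where
  "fdd P n t = distr P (\<Pi>\<^sub>M i\<in>{..n}. lborel) (\<lambda>\<omega>. \<lambda>i\<in>{..n}. \<omega> (t i))"

definition loops :: "'a::euclidean_space set \<Rightarrow> real \<Rightarrow> (real \<Rightarrow> 'a) topology" where
  "loops S T = subtopology (cloc {0..T} S) {\<omega>. \<omega> 0 = \<omega> T}"

text \<open>
  The law of the bridge of duration \<open>T\<close> from \<open>a\<close> to \<open>a\<close> of the process with transition
  density \<open>q\<close> killed on leaving \<open>\<Omega>\<close>. The end point condition \<open>\<omega>(T) = a\<close> is part of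
  the choice of the path space.
\<close>

definition killed_bridge_law ::
    "'a::euclidean_space set \<Rightarrow> (real \<Rightarrow> 'a \<Rightarrow> 'a \<Rightarrow> real) \<Rightarrow> real \<Rightarrow> 'a \<Rightarrow>
      (real \<Rightarrow> 'a) measure \<Rightarrow> bool" where
  "killed_bridge_law \<Omega> q T a P \<longleftrightarrow>
     P \<in> prob_measures (loops (closure \<Omega>) T) \<and>
     (AE \<omega> in P. \<omega> 0 = a) \<and>
     (\<forall>n t. strict_mono_on {..n} t \<and> 0 < t 0 \<and> t n < T \<longrightarrow>
        fdd P n t = density (\<Pi>\<^sub>M i\<in>{..n}. lborel)
          (\<lambda>x. ennreal (if \<forall>i\<le>n. x i \<in> \<Omega>
             then q (t 0) a (x 0)
                  * (\<Prod>i<n. q (t (Suc i) - t i) (x i) (x (Suc i)))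
                  * q (T - t n) (x n) a / q T a a
             else 0)))"

definition root_law ::
    "'a::euclidean_space set \<Rightarrow> (real \<Rightarrow> 'a \<Rightarrow> 'a \<Rightarrow> real) \<Rightarrow> real \<Rightarrow> 'a measure" where
  "root_law \<Omega> q T = density (restrict_space lborel \<Omega>)
     (\<lambda>a. ennreal (q T a a / (LINT z:\<Omega>|lborel. q T z z)))"

text \<open>The argument \<open>B\<close> is the family of bridge laws, indexed by the root.\<close>

definition one_loop_law ::
    "'a::euclidean_space set \<Rightarrow> (real \<Rightarrow> 'a \<Rightarrow> 'a \<Rightarrow> real) \<Rightarrow> real \<Rightarrow>
      ('a \<Rightarrow> (real \<Rightarrow> 'a) measure) \<Rightarrow> (real \<Rightarrow> 'a) measure" where
  "one_loop_law \<Omega> q T B = root_law \<Omega> q T \<bind> B"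

section \<open>The mark\<close>

definition XD :: "(real \<Rightarrow> real ^ 'd) topology" where
  "XD = cloc UNIV (closure (cube 1))"

definition MD :: "(real \<Rightarrow> real ^ 'd) measure topology" where
  "MD = weak_topology XD"

definition shift :: "real \<Rightarrow> (real \<Rightarrow> 'a) \<Rightarrow> (real \<Rightarrow> 'a)" where
  "shift u \<gamma> = (\<lambda>t. \<gamma> (u + t))"

definition periodic_ext :: "real \<Rightarrow> (real \<Rightarrow> 'a) \<Rightarrow> (real \<Rightarrow> 'a)" where
  "periodic_ext S y = (\<lambda>s. y (s - S * of_int \<lfloor>s / S\<rfloor>))"

definition rescaled_loop :: "real \<Rightarrow> real \<Rightarrow> (real \<Rightarrow> real ^ 'd) \<Rightarrow> (real \<Rightarrow> real ^ 'd)" where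
  "rescaled_loop L T \<omega> = periodic_ext (T / L\<^sup>2) (\<lambda>s. (1 / L) *\<^sub>R \<omega> (L\<^sup>2 * s))"

text \<open>
  The mixture \<open>1/S \<integral>\<^sub>0\<^sup>S \<delta>(\<theta>\<^sub>u Y) du\<close> with \<open>S = T / L\<^sup>2\<close>, for a loop \<open>\<omega>\<close> of duration \<open>T\<close>.
\<close>

definition mark :: "real \<Rightarrow> real \<Rightarrow> (real \<Rightarrow> real ^ 'd) \<Rightarrow> (real \<Rightarrow> real ^ 'd) measure" where
  "mark L T \<omega> = uniform_measure lborel {0..T / L\<^sup>2} \<bind>
     (\<lambda>u. return (borel_of XD) (shift u (rescaled_loop L T \<omega>)))"

definition mark_law ::
    "(real \<Rightarrow> real ^ 'd \<Rightarrow> real ^ 'd \<Rightarrow> real) \<Rightarrow> (real ^ 'd \<Rightarrow> (real \<Rightarrow> real ^ 'd) measure) \<Rightarrow>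
      real \<Rightarrow> real \<Rightarrow> (real \<Rightarrow> real ^ 'd) measure measure" where
  "mark_law q B L T = distr (one_loop_law (cube L) q T B) (borel_of MD) (mark L T)"

section \<open>The limit process\<close>

definition hD :: "real ^ 'd \<Rightarrow> real" where
  "hD r = 2 powr (real CARD('d) / 2) * (\<Prod>l\<in>UNIV. sin (pi * r $ l))"

definition ptab ::
    "(real \<Rightarrow> real ^ 'd \<Rightarrow> real ^ 'd \<Rightarrow> real) \<Rightarrow> real \<Rightarrow> real ^ 'd \<Rightarrow> real ^ 'd \<Rightarrow> real" where
  "ptab p t r s = exp (pi\<^sup>2 * real CARD('d) * t) * (hD s / hD r) * p t r s"

definition tab_two_sided_law ::
    "(real \<Rightarrow> real ^ 'd \<Rightarrow> real ^ 'd \<Rightarrow> real) \<Rightarrow> (real \<Rightarrow> real ^ 'd) measure \<Rightarrow> bool" where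
  "tab_two_sided_law p P \<longleftrightarrow>
     P \<in> prob_measures XD \<and>
     (\<forall>n t. strict_mono_on {..n} t \<longrightarrow>
        fdd P n t = density (\<Pi>\<^sub>M i\<in>{..n}. lborel)
          (\<lambda>x. ennreal (if \<forall>i\<le>n. x i \<in> cube 1
             then (hD (x 0))\<^sup>2 * (\<Prod>i<n. ptab p (t (Suc i) - t i) (x i) (x (Suc i)))
             else 0)))"

end

theory Submission
  imports Defs
begin

text \<open>
  The eigenfunctions \<open>\<Prod>\<^sub>i sin (n\<^sub>i \<pi> x\<^sub>i / L)\<close> evolve explicitly under the heat flow, so by the parabolic maximum
  principle and the completeness of the sines the Dirichlet kernel of \<open>(0, L)\<^sup>d\<close> is a rescaled product of
  sine series. Hence \<open>p\<^sub>t(x, y) = e\<^bsup>-\<epsilon>t\<^esup> h(x) h(y) (1 + o(1))\<close> uniformly in \<open>x\<close> and \<open>y\<close> as \<open>t \<rightarrow> \<infinity>\<close>.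

  Let \<open>Y\<close> be the rescaled loop, of duration \<open>S = \<beta> j / L\<^sup>2 \<ge> \<beta> \<delta> L\<^bsup>d-2\<^esup> \<rightarrow> \<infinity>\<close>. The joint law of two windows of \<open>Y\<close> has
  a density with respect to two independent windows of the tab process \<open>Q\<close>; it depends only on the four end
  points and is at most \<open>1 + \<eta>\<close> once both gaps are long. So for \<open>g\<close> depending on a window only,
  the time average of \<open>g\<close> along \<open>Y\<close> converges to \<open>\<integral> g dQ\<close> in \<open>L\<^sup>2\<close>. A bounded continuous \<open>f\<close> is the decreasing
  limit of the window functionals \<open>sup {f(\<eta>). \<eta> = \<gamma> on [-m, m]}\<close>, which gives the law of large numbers for \<open>f\<close> without
  any tightness estimate; and \<open>\<Phi>\<close> is controlled near \<open>Q\<close> by finitely many such \<open>f\<close>.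
\<close>

section \<open>The parabolic maximum principle\<close>

text \<open>The kernel estimate has to be relative. The density of two loop windows contains 1/h at
  the four window ends, so an additive error would be useless near the faces of the cube; the bound
  |sin(n x)| \<le> n |sin x| makes the error a small multiple of h(x) h(y) up to the boundary. The
  root is removed before any estimate: averaging the bridge over its root cancels the normalization
  1/q(a,a), and the semigroup law merges the last and the first arc into one kernel, so the
  resulting formula contains time differences only. What remains, \<open>loop_path_law S P\<close>,
  mentions no L and no j except through S, and every threshold S0 is chosen for all such P at once;
  this gives the uniformity in j. Bridge marginals are given only at times strictly inside the
  duration, so windows are kept away from the ends of the period, at a cost of order 1/S. The
  suprema over a window approximate f from above and hence control upper deviations; lower
  deviations are upper deviations of -f.\<close>

lemma has_laplacian_diff:
  assumes "has_laplacian g D x" "has_laplacian h E x"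
  shows "has_laplacian (\<lambda>y. g y - h y) (D - E) x"
proof -
  obtain g1 g2 where g: "\<And>b. b \<in> Basis \<Longrightarrow> \<forall>\<^sub>F s in nhds 0. ((\<lambda>s. g (x + s *\<^sub>R b)) has_real_derivative g1 b s) (at s)"
    "\<And>b. b \<in> Basis \<Longrightarrow> (g1 b has_real_derivative g2 b) (at 0)" "D = (\<Sum>b\<in>Basis. g2 b)"
    using assms(1) unfolding has_laplacian_def by blast
  obtain h1 h2 where h: "\<And>b. b \<in> Basis \<Longrightarrow> \<forall>\<^sub>F s in nhds 0. ((\<lambda>s. h (x + s *\<^sub>R b)) has_real_derivative h1 b s) (at s)"
    "\<And>b. b \<in> Basis \<Longrightarrow> (h1 b has_real_derivative h2 b) (at 0)" "E = (\<Sum>b\<in>Basis. h2 b)"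
    using assms(2) unfolding has_laplacian_def by blast
  show ?thesis
    unfolding has_laplacian_def
  proof (intro exI[of _ "\<lambda>b s. g1 b s - h1 b s"] exI[of _ "\<lambda>b. g2 b - h2 b"] conjI ballI)
    fix b :: 'a assume b: "b \<in> Basis"
    show "\<forall>\<^sub>F s in nhds 0. ((\<lambda>s. g (x + s *\<^sub>R b) - h (x + s *\<^sub>R b)) has_real_derivative g1 b s - h1 b s) (at s)"
      using g(1)[OF b] h(1)[OF b] by eventually_elim (rule DERIV_diff)
    show "((\<lambda>s. g1 b s - h1 b s) has_real_derivative g2 b - h2 b) (at 0)"
      by (intro DERIV_diff g h b)
  qed (simp add: g h sum_subtractf)
qed

text \<open>The second derivative is available at 0 only, so no Taylor formula is used: if D were
  positive, \<open>g1\<close> would be positive just to the right of its zero at 0, and the mean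
  value theorem would push g above its maximum.\<close>

lemma second_derivative_local_max:
  fixes g :: "real \<Rightarrow> real"
  assumes g1: "\<forall>\<^sub>F s in nhds 0. (g has_real_derivative g1 s) (at s)"
    and g2: "(g1 has_real_derivative D) (at 0)"
    and mx: "\<forall>\<^sub>F s in nhds 0. g s \<le> g 0"
  shows "D \<le> 0"
proof (rule ccontr)
  assume "\<not> D \<le> 0"
  then have D: "D > 0" by simp
  obtain e where e: "e > 0" "\<And>s. dist s 0 < e \<Longrightarrow> (g has_real_derivative g1 s) (at s)"
    "\<And>s. dist s 0 < e \<Longrightarrow> g s \<le> g 0"
    using eventually_conj[OF g1 mx] unfolding eventually_nhds_metric by blast
  have g10: "g1 0 = 0"
    by (rule DERIV_local_max[OF e(2) e(1)]) (use e in \<open>auto simp: dist_real_def\<close>)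
  obtain d where d: "d > 0" "\<And>h. 0 < h \<Longrightarrow> h < d \<Longrightarrow> g1 0 < g1 (0 + h)"
    using DERIV_pos_inc_right[OF g2 D] by blast
  define h where "h = min d e / 2"
  have h: "0 < h" "h < d" "h < e" using d(1) e(1) by (auto simp: h_def min_def field_simps)
  have "\<exists>z. 0 < z \<and> z < h \<and> g h - g 0 = (h - 0) * g1 z"
    using h e(2) by (intro MVT2) (auto simp: dist_real_def)
  then obtain z where z: "0 < z" "z < h" "g h - g 0 = h * g1 z" by auto
  have "g1 z > 0" using d(2)[of z] z h g10 by simp
  then have "g h > g 0" using z h by (smt (verit) mult_pos_pos)
  then show False using e(3)[of h] h by (simp add: dist_real_def)
qed

lemma laplacian_local_max:
  assumes "has_laplacian g D x" and mx: "\<forall>\<^sub>F y in nhds x. g y \<le> g x"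
  shows "D \<le> 0"
proof -
  obtain g1 g2 where g: "\<And>b. b \<in> Basis \<Longrightarrow> \<forall>\<^sub>F s in nhds 0. ((\<lambda>s. g (x + s *\<^sub>R b)) has_real_derivative g1 b s) (at s)"
    "\<And>b. b \<in> Basis \<Longrightarrow> (g1 b has_real_derivative g2 b) (at 0)" "D = (\<Sum>b\<in>Basis. g2 b)"
    using assms(1) unfolding has_laplacian_def by blast
  have "g2 b \<le> 0" if b: "b \<in> Basis" for b
  proof (rule second_derivative_local_max[OF g(1)[OF b] g(2)[OF b]])
    have "((\<lambda>s. x + s *\<^sub>R b) \<longlongrightarrow> x + 0 *\<^sub>R b) (nhds 0)"
      by (intro tendsto_intros filterlim_ident)
    then have "filterlim (\<lambda>s::real. x + s *\<^sub>R b) (nhds x) (nhds 0)" by simp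
    then show "\<forall>\<^sub>F s in nhds 0. g (x + s *\<^sub>R b) \<le> g (x + 0 *\<^sub>R b)"
      using eventually_compose_filterlim[OF mx] by simp
  qed
  then show ?thesis unfolding g(3) by (intro sum_nonpos)
qed

text \<open>Weak maximum principle. At a positive maximum of u - e t, which cannot lie on the
  parabolic boundary, the Laplacian is at most 0 while the time derivative is at least e > 0, and
  the heat equation equates the two.\<close>

lemma dirichlet_heat_flow_nonpos:
  fixes \<Omega> :: "'a::euclidean_space set"
  assumes u: "dirichlet_heat_flow \<Omega> f u" and \<Omega>: "open \<Omega>" "bounded \<Omega>"
    and f: "\<And>x. x \<in> closure \<Omega> \<Longrightarrow> f x \<le> 0" and t: "t \<ge> 0" and x: "x \<in> closure \<Omega>"
  shows "u t x \<le> 0"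
proof (rule field_le_epsilon)
  fix e' :: real assume "e' > 0"
  \<comment> \<open>The denominator makes the penalty at time t satisfy e t \<le> e'; the summand 1
    covers t = 0.\<close>
  define e where "e = e' / (t + 1)"
  have e: "e > 0" using t \<open>e' > 0\<close> by (simp add: e_def)
  define w where "w = (\<lambda>z::real \<times> 'a. u (fst z) (snd z) - e * fst z)"
  define K where "K = {0..t} \<times> closure \<Omega>"
  have cK: "compact K" unfolding K_def using \<Omega> by (intro compact_Times) (auto simp: compact_closure)
  have cont: "continuous_on ({0..} \<times> closure \<Omega>) (\<lambda>(t, x). u t x)"
    using u unfolding dirichlet_heat_flow_def by blast
  have "continuous_on K w" unfolding w_def
    by (intro continuous_intros continuous_on_subset[OF cont[unfolded case_prod_beta]]) (auto simp: K_def)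
  moreover have "K \<noteq> {}" using x t by (auto simp: K_def)
  ultimately obtain z where z: "z \<in> K" "\<And>y. y \<in> K \<Longrightarrow> w y \<le> w z"
    using continuous_attains_sup[OF cK] by blast
  obtain s y where zs: "z = (s, y)" by (cases z)
  have s: "0 \<le> s" "s \<le> t" "y \<in> closure \<Omega>" using z(1) by (auto simp: zs K_def)
  have "w z \<le> 0"
  proof (rule ccontr)
    assume "\<not> w z \<le> 0"
    then have pos: "u s y > e * s" by (simp add: w_def zs)
    then have pos': "u s y > 0" using s e by (smt (verit) mult_nonneg_nonneg)
    have "s \<noteq> 0" using u f[OF s(3)] pos' s(3) unfolding dirichlet_heat_flow_def by force
    with s have s0: "s > 0" by simp
    have "y \<notin> frontier \<Omega>" using u pos' s(1) unfolding dirichlet_heat_flow_def by force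
    then have y: "y \<in> \<Omega>" using s(3) \<Omega> by (simp add: frontier_def interior_open)
    obtain D where D: "has_laplacian (u s) D y" "((\<lambda>s. u s y) has_real_derivative D) (at s)"
      using u s0 y unfolding dirichlet_heat_flow_def by blast
    have "D \<le> 0"
    proof (rule laplacian_local_max[OF D(1)])
      have "\<forall>\<^sub>F y' in nhds y. y' \<in> \<Omega>" using \<Omega>(1) y by (rule eventually_nhds_in_open)
      then show "\<forall>\<^sub>F y' in nhds y. u s y' \<le> u s y"
      proof eventually_elim
        case (elim y')
        then have "(s, y') \<in> K" using s closure_subset[of \<Omega>] by (auto simp: K_def)
        from z(2)[OF this] show ?case by (simp add: w_def zs)
      qed
    qed
    moreover have "((\<lambda>s. u s y - e * s) has_real_derivative D - e) (at s)"
      by (intro DERIV_diff D(2)) (auto intro!: derivative_eq_intros)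
    \<comment> \<open>The maximum may be attained at the final time t, so it is compared with
      earlier times only.\<close>
    moreover have "D - e \<ge> 0"
    proof (rule ccontr)
      assume "\<not> 0 \<le> D - e"
      then have "D - e < 0" by simp
      from DERIV_neg_dec_left[OF calculation(2) this] obtain d where d: "d > 0"
        "\<And>h. 0 < h \<Longrightarrow> h < d \<Longrightarrow> u s y - e * s < u (s - h) y - e * (s - h)" by blast
      define h where "h = min d s / 2"
      have h: "0 < h" "h < d" "h \<le> s" using d(1) s0 by (auto simp: h_def min_def field_simps)
      have "(s - h, y) \<in> K" using h s by (auto simp: K_def)
      from z(2)[OF this] d(2)[OF h(1,2)] show False by (simp add: w_def zs)
    qed
    ultimately show False using e by linarith
  qed
  then have "w (t, x) \<le> 0" using z(2)[of "(t, x)"] x t by (force simp: K_def)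
  then have "u t x \<le> e * t" by (simp add: w_def)
  also have "\<dots> \<le> e'" using t \<open>e' > 0\<close> by (simp add: e_def field_simps)
  finally show "u t x \<le> 0 + e'" by simp
qed

lemma dirichlet_heat_flow_diff:
  assumes "dirichlet_heat_flow \<Omega> f u" "dirichlet_heat_flow \<Omega> g v"
  shows "dirichlet_heat_flow \<Omega> (\<lambda>x. f x - g x) (\<lambda>t x. u t x - v t x)"
  unfolding dirichlet_heat_flow_def
proof (intro conjI ballI allI impI)
  show "continuous_on ({0..} \<times> closure \<Omega>) (\<lambda>(t, x). u t x - v t x)"
    using assms unfolding dirichlet_heat_flow_def case_prod_beta by (intro continuous_on_diff) auto
next
  fix t :: real and x assume "t > 0" "x \<in> \<Omega>"
  obtain D where D: "has_laplacian (u t) D x" "((\<lambda>s. u s x) has_real_derivative D) (at t)"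
    using assms(1) \<open>t > 0\<close> \<open>x \<in> \<Omega>\<close> unfolding dirichlet_heat_flow_def by blast
  obtain E where E: "has_laplacian (v t) E x" "((\<lambda>s. v s x) has_real_derivative E) (at t)"
    using assms(2) \<open>t > 0\<close> \<open>x \<in> \<Omega>\<close> unfolding dirichlet_heat_flow_def by blast
  show "\<exists>D. has_laplacian (\<lambda>x. u t x - v t x) D x \<and> ((\<lambda>s. u s x - v s x) has_real_derivative D) (at t)"
    by (intro exI[of _ "D - E"] conjI has_laplacian_diff DERIV_diff D E)
qed (use assms in \<open>auto simp: dirichlet_heat_flow_def\<close>)

lemma dirichlet_heat_flow_zero: "dirichlet_heat_flow \<Omega> (\<lambda>_. 0) (\<lambda>_ _. 0)"
  unfolding dirichlet_heat_flow_def
proof (intro conjI ballI allI impI)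
  fix t :: real and x :: 'a
  have "has_laplacian (\<lambda>_::'a. 0) 0 x"
    unfolding has_laplacian_def by (intro exI[of _ "\<lambda>_ _. 0"] exI[of _ "\<lambda>_. 0"]) auto
  then show "\<exists>D. has_laplacian (\<lambda>_. 0) D x \<and> ((\<lambda>_. 0) has_real_derivative D) (at t)"
    by (intro exI[of _ 0]) auto
qed (auto simp: case_prod_beta)

lemma dirichlet_heat_flow_nonneg:
  fixes \<Omega> :: "'a::euclidean_space set"
  assumes "dirichlet_heat_flow \<Omega> f u" "open \<Omega>" "bounded \<Omega>"
    and "\<And>x. x \<in> closure \<Omega> \<Longrightarrow> f x \<ge> 0" "t \<ge> 0" "x \<in> closure \<Omega>"
  shows "u t x \<ge> 0"
  using dirichlet_heat_flow_nonpos[OF dirichlet_heat_flow_diff[OF dirichlet_heat_flow_zero assms(1)]] assms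
  by auto

lemma dirichlet_heat_flow_unique:
  fixes \<Omega> :: "'a::euclidean_space set"
  assumes "dirichlet_heat_flow \<Omega> f u" "dirichlet_heat_flow \<Omega> f v" "open \<Omega>" "bounded \<Omega>"
    and "t \<ge> 0" "x \<in> closure \<Omega>"
  shows "u t x = v t x"
  using dirichlet_heat_flow_nonpos[OF dirichlet_heat_flow_diff[OF assms(1,2)] assms(3,4)]
    dirichlet_heat_flow_nonpos[OF dirichlet_heat_flow_diff[OF assms(2,1)] assms(3,4)] assms(5,6)
  by (auto intro: antisym)

lemma cube_eq_box: "cube L = (box 0 (\<chi> i. L) :: (real ^ 'd) set)"
  by (auto simp: cube_def mem_box_cart)

lemma open_cube: "open (cube L)"
  unfolding cube_eq_box by (rule open_box)

lemma closure_cube: "L > 0 \<Longrightarrow> closure (cube L) = (cbox 0 (\<chi> i. L) :: (real ^ 'd) set)"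
  unfolding cube_eq_box by (rule closure_box) (simp add: interval_ne_empty_cart)

lemma mem_closure_cube: "L > 0 \<Longrightarrow> x \<in> closure (cube L) \<longleftrightarrow> (\<forall>i. 0 \<le> x $ i \<and> x $ i \<le> L)"
  by (auto simp: closure_cube mem_box_cart)

lemma bounded_cube: "bounded (cube L)"
  unfolding cube_eq_box by (rule bounded_box)

lemma compact_closure_cube: "compact (closure (cube L))"
  by (simp add: bounded_cube)

lemma frontier_cube: "L > 0 \<Longrightarrow> x \<in> frontier (cube L) \<Longrightarrow> \<exists>i. x $ i = 0 \<or> x $ i = L"
  unfolding frontier_def interior_open[OF open_cube]
  by (simp add: mem_closure_cube) (auto simp: cube_def not_less intro: antisym)

text \<open>Turns information on integrals into pointwise information: it serves the sign of the
  kernel, the completeness of the sines and the positivity of the normalizing constant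
  \<open>Z\<close>.\<close>

lemma set_integral_nonpos_imp_zero:
  fixes f :: "'a::euclidean_space \<Rightarrow> real"
  assumes \<Omega>: "open \<Omega>" and c: "continuous_on \<Omega> f" and nn: "\<And>x. x \<in> \<Omega> \<Longrightarrow> f x \<ge> 0"
    and int: "set_integrable lborel \<Omega> f" and le: "(LINT x:\<Omega>|lborel. f x) \<le> 0" and y: "y \<in> \<Omega>"
  shows "f y = 0"
proof (rule ccontr)
  assume "f y \<noteq> 0"
  define g where "g = (\<lambda>z. indicator \<Omega> z *\<^sub>R f z)"
  have gi: "integrable lborel g" using int by (simp add: set_integrable_def g_def)
  have gnn: "g z \<ge> 0" for z using nn by (auto simp: g_def indicator_def)
  have "integral\<^sup>L lborel g \<le> 0" using le by (simp add: g_def set_lebesgue_integral_def)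
  with gnn have "integral\<^sup>L lborel g = 0" by (intro antisym integral_nonneg) auto
  then have "AE z in lborel. g z = 0"
    using integral_nonneg_eq_0_iff_AE[OF gi] gnn by auto
  then have null: "emeasure lborel {z. g z \<noteq> 0} = 0"
    by (subst (asm) AE_iff_measurable[OF _ refl]) (use gi in auto)
  have "isCont f y" using c \<Omega> y by (simp add: continuous_on_eq_continuous_at)
  then have "(f \<longlongrightarrow> f y) (nhds y)" by (simp add: continuous_within tendsto_at_iff_tendsto_nhds)
  then have "\<forall>\<^sub>F z in nhds y. f z \<noteq> 0" using \<open>f y \<noteq> 0\<close> by (rule tendsto_imp_eventually_ne)
  from eventually_conj[OF this eventually_nhds_in_open[OF \<Omega> y]]
  obtain r where r: "r > 0" "\<And>z. dist z y < r \<Longrightarrow> f z \<noteq> 0 \<and> z \<in> \<Omega>"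
    unfolding eventually_nhds_metric by blast
  have "emeasure lborel (ball y r) \<le> emeasure lborel {z. g z \<noteq> 0}"
  proof (rule emeasure_mono)
    show "ball y r \<subseteq> {z. g z \<noteq> 0}" using r(2) by (force simp: g_def dist_commute)
    show "{z. g z \<noteq> 0} \<in> sets lborel" using gi by measurable
  qed
  moreover have "emeasure lborel (ball y r) > 0"
    using r(1) by (simp add: emeasure_ball unit_ball_vol_pos)
  ultimately show False using null by simp
qed

lemma set_integrable_continuous_closure:
  fixes f :: "'a::euclidean_space \<Rightarrow> real"
  assumes "open \<Omega>" "bounded \<Omega>" "continuous_on (closure \<Omega>) f"
  shows "set_integrable lborel \<Omega> f"
proof (rule set_integrable_subset)
  show "set_integrable lborel (closure \<Omega>) f"
    unfolding set_integrable_def using assms by (intro borel_integrable_compact) auto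
qed (use assms closure_subset in auto)

lemma continuous_on_section:
  assumes "continuous_on (A \<times> B) (\<lambda>(x, y). f x y)" "x \<in> A"
  shows "continuous_on B (f x)"
  using continuous_on_compose2[OF assms(1) continuous_on_Pair[OF continuous_on_const[of _ x] continuous_on_id], of B]
    assms(2) by auto

text \<open>If the kernel were negative at y, it would be negative on a ball around y. The hat
  function of that ball is nonnegative initial data, so its flow is nonnegative by the maximum
  principle, while the kernel formula makes it negative.\<close>

lemma dirichlet_heat_kernel_nonneg:
  fixes q :: "real \<Rightarrow> 'a::euclidean_space \<Rightarrow> 'a \<Rightarrow> real"
  assumes q: "dirichlet_heat_kernel \<Omega> q" and \<Omega>: "open \<Omega>" "bounded \<Omega>"
    and t: "t > 0" and x: "x \<in> closure \<Omega>" and y: "y \<in> \<Omega>"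
  shows "q t x y \<ge> 0"
proof (rule ccontr)
  assume neg: "\<not> 0 \<le> q t x y"
  have ccl: "continuous_on (closure \<Omega>) (q t x)"
    using q t x unfolding dirichlet_heat_kernel_def by (blast intro: continuous_on_section)
  then have cy: "continuous_on \<Omega> (q t x)" by (rule continuous_on_subset) (rule closure_subset)
  then have "isCont (q t x) y" using \<Omega>(1) y by (simp add: continuous_on_eq_continuous_at)
  then have "((q t x) \<longlongrightarrow> q t x y) (nhds y)" by (simp add: continuous_within tendsto_at_iff_tendsto_nhds)
  then have "\<forall>\<^sub>F z in nhds y. q t x z < 0"
    using neg by (intro order_tendstoD) auto
  from eventually_conj[OF this eventually_nhds_in_open[OF \<Omega>(1) y]]
  obtain r where r: "r > 0" "\<And>z. dist z y < r \<Longrightarrow> q t x z < 0" "\<And>z. dist z y < r \<Longrightarrow> z \<in> \<Omega>"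
    unfolding eventually_nhds_metric by blast
  define f where "f = (\<lambda>z. max 0 (r - dist z y))"
  have fc: "continuous_on A f" for A unfolding f_def by (intro continuous_intros)
  have f0: "f z = 0" if "z \<in> frontier \<Omega>" for z
    using that r(3)[of z] \<Omega>(1) by (cases "dist z y < r") (auto simp: f_def frontier_def interior_open)
  have "dirichlet_heat_flow \<Omega> f (\<lambda>t x. if t = 0 then f x else (LINT y:\<Omega>|lborel. q t x y * f y))"
    using q fc f0 unfolding dirichlet_heat_kernel_def by blast
  from dirichlet_heat_flow_nonneg[OF this \<Omega>, of t x]
  have "0 \<le> (LINT z:\<Omega>|lborel. q t x z * f z)" using t x by (auto simp: f_def)
  moreover have "- (q t x z * f z) \<ge> 0" for z
    using r(2)[of z] by (cases "dist z y < r") (auto simp: f_def max_def mult_nonpos_nonneg)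
  moreover have "set_integrable lborel \<Omega> (\<lambda>z. - (q t x z * f z))"
    using \<Omega> by (intro set_integrable_continuous_closure continuous_intros ccl fc)
  moreover have "continuous_on \<Omega> (\<lambda>z. - (q t x z * f z))" by (intro continuous_intros cy fc)
  ultimately have "- (q t x y * f y) = 0"
    using y by (intro set_integral_nonpos_imp_zero[OF \<Omega>(1), of "\<lambda>z. - (q t x z * f z)"])
      (auto simp: set_lebesgue_integral_def)
  then show False using neg r(1) by (simp add: f_def)
qed

section \<open>The heat kernel of the unit interval\<close>

text \<open>Dominates every sine mode by the ground mode with a polynomial factor, so that the
  higher modes vanish at the boundary at least as fast as the ground mode.\<close>

lemma abs_sin_mult_le: "\<bar>sin (real n * x)\<bar> \<le> real n * \<bar>sin x\<bar>"
proof (induction n)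
  case (Suc n)
  have "real (Suc n) * x = real n * x + x" by (simp add: distrib_right)
  then have "\<bar>sin (real (Suc n) * x)\<bar> = \<bar>sin (real n * x) * cos x + cos (real n * x) * sin x\<bar>"
    by (simp only: sin_add)
  also have "\<dots> \<le> \<bar>sin (real n * x)\<bar> * \<bar>cos x\<bar> + \<bar>cos (real n * x)\<bar> * \<bar>sin x\<bar>"
    by (metis abs_mult abs_triangle_ineq)
  also have "\<dots> \<le> \<bar>sin (real n * x)\<bar> * 1 + 1 * \<bar>sin x\<bar>"
    by (intro add_mono mult_mono) auto
  finally show ?case using Suc by (simp add: distrib_right)
qed simp

lemma integral_sin_sin:
  fixes m n :: nat assumes "m > 0" "n > 0"
  shows "(LINT y:{0<..<1}|lborel. sin (pi * real m * y) * sin (pi * real n * y)) = (if m = n then 1 / 2 else 0)"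
proof -
  define F where "F = (\<lambda>y. (if m = n then y / 2 else sin (pi * (real m - real n) * y) / (2 * pi * (real m - real n)))
     - sin (pi * (real m + real n) * y) / (2 * pi * (real m + real n)))"
  have pos: "real m + real n > 0" using assms by simp
  have F: "(F has_real_derivative sin (pi * real m * y) * sin (pi * real n * y)) (at y)" for y
  proof -
    have e: "sin (pi * real m * y) * sin (pi * real n * y) =
      (cos (pi * (real m - real n) * y) - cos (pi * (real m + real n) * y)) / 2"
      by (simp add: sin_times_sin algebra_simps)
    have *: "((\<lambda>y. sin (pi * k * y) / (2 * pi * k)) has_real_derivative cos (pi * k * y) / 2) (at y)"
      if "k \<noteq> 0" for k :: real
      using that by (auto intro!: derivative_eq_intros)
    have "((\<lambda>y. if m = n then y / 2 else sin (pi * (real m - real n) * y) / (2 * pi * (real m - real n)))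
        has_real_derivative cos (pi * (real m - real n) * y) / 2) (at y)"
      using *[of "real m - real n"] by (cases "m = n") (auto intro!: derivative_eq_intros)
    from DERIV_diff[OF this *[of "real m + real n"]] show ?thesis
      unfolding e F_def using pos by (simp add: diff_divide_distrib)
  qed
  have s: "sin (pi * (real m + real n)) = 0" "sin (pi * (real m - real n)) = 0"
    by (simp_all add: distrib_left right_diff_distrib sin_add sin_diff mult.commute[of pi])
  have "(LBINT y=ereal 0..ereal 1. sin (pi * real m * y) * sin (pi * real n * y)) = F 1 - F 0"
    by (rule interval_integral_FTC_finite)
      (auto intro!: continuous_intros has_vector_derivative_at_within[OF F[unfolded has_real_derivative_iff_has_vector_derivative]])
  also have "\<dots> = (if m = n then 1 / 2 else 0)" by (simp add: F_def s)
  finally show ?thesis by (subst (asm) interval_integral_Ioo) auto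
qed

text \<open>The eigenfunction expansion of the heat kernel of the unit interval, with normalized
  eigenfunctions sqrt 2 sin(pi n x); \<open>Suc m\<close> makes the sum start at mode 1.\<close>

definition sine_kernel :: "real \<Rightarrow> real \<Rightarrow> real \<Rightarrow> real" where
  "sine_kernel t x y = (\<Sum>m. 2 * exp (- (pi\<^sup>2 * (real (Suc m))\<^sup>2 * t)) * sin (pi * real (Suc m) * x) * sin (pi * real (Suc m) * y))"

lemma summable_sine_coeff:
  assumes "t > 0" shows "summable (\<lambda>m. 2 * exp (- (pi\<^sup>2 * (real (Suc m))\<^sup>2 * t)))"
proof (rule summable_comparison_test')
  show "summable (\<lambda>m. 2 * exp (- (pi\<^sup>2 * t)) ^ m)"
    using assms by (intro summable_mult summable_geometric) simp
  fix m :: nat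
  have "real m \<le> (real (Suc m))\<^sup>2" by (simp add: power2_eq_square algebra_simps)
  then have "pi\<^sup>2 * t * real m \<le> pi\<^sup>2 * t * (real (Suc m))\<^sup>2"
    using assms by (intro mult_left_mono) auto
  then show "norm (2 * exp (- (pi\<^sup>2 * (real (Suc m))\<^sup>2 * t))) \<le> 2 * exp (- (pi\<^sup>2 * t)) ^ m"
    by (simp add: exp_of_nat_mult[symmetric] algebra_simps)
qed

lemma sine_term_bound:
  "norm (2 * exp (- (pi\<^sup>2 * (real (Suc m))\<^sup>2 * t)) * sin (pi * real (Suc m) * x) * sin (pi * real (Suc m) * y))
    \<le> 2 * exp (- (pi\<^sup>2 * (real (Suc m))\<^sup>2 * t))"
proof -
  have "\<bar>sin (pi * real (Suc m) * x)\<bar> * \<bar>sin (pi * real (Suc m) * y)\<bar> \<le> 1 * 1"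
    by (intro mult_mono) auto
  then show ?thesis by (simp add: abs_mult mult.assoc)
qed

lemma summable_sine_kernel:
  assumes "t > 0"
  shows "summable (\<lambda>m. 2 * exp (- (pi\<^sup>2 * (real (Suc m))\<^sup>2 * t)) * sin (pi * real (Suc m) * x) * sin (pi * real (Suc m) * y))"
  by (rule summable_comparison_test'[OF summable_sine_coeff[OF assms]]) (rule sine_term_bound)

lemma continuous_sine_kernel:
  assumes "t > 0" shows "continuous_on UNIV (\<lambda>(x, y). sine_kernel t x y)"
proof -
  have "uniform_limit UNIV (\<lambda>n z. \<Sum>m<n. 2 * exp (- (pi\<^sup>2 * (real (Suc m))\<^sup>2 * t)) * sin (pi * real (Suc m) * fst z) * sin (pi * real (Suc m) * snd z))
     (\<lambda>z. sine_kernel t (fst z) (snd z)) sequentially"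
    unfolding sine_kernel_def
    by (rule Weierstrass_m_test[OF _ summable_sine_coeff[OF assms]]) (rule sine_term_bound)
  then show ?thesis unfolding case_prod_beta
    by (rule uniform_limit_theorem[rotated]) (auto intro!: always_eventually continuous_intros)
qed

text \<open>Termwise integration, justified by the summable exponential coefficients and a bound on
  f. The eigenvalue relation is the case of a sine for f, the semigroup law the case of another
  kernel.\<close>

lemma integral_sine_kernel:
  fixes f :: "real \<Rightarrow> real"
  assumes t: "t > 0" and f: "continuous_on {0..1} f"
  shows "(LINT y:{0<..<1}|lborel. f y * sine_kernel t x y) =
    (\<Sum>m. 2 * exp (- (pi\<^sup>2 * (real (Suc m))\<^sup>2 * t)) * sin (pi * real (Suc m) * x)
         * (LINT y:{0<..<1}|lborel. f y * sin (pi * real (Suc m) * y)))"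
proof -
  obtain B where B: "\<And>y. y \<in> {0..1} \<Longrightarrow> \<bar>f y\<bar> \<le> B" "B \<ge> 0"
  proof -
    have "bounded (f ` {0..1})" using f by (intro compact_imp_bounded compact_continuous_image) auto
    then show thesis using that unfolding bounded_iff
      by (metis abs_ge_zero image_eqI order_trans real_norm_def atLeastAtMost_iff zero_le_one order_refl)
  qed
  define a where "a m = 2 * exp (- (pi\<^sup>2 * (real (Suc m))\<^sup>2 * t))" for m
  define T where "T m y = a m * sin (pi * real (Suc m) * x) * (indicator {0<..<1} y * (f y * sin (pi * real (Suc m) * y)))" for m y
  have si: "integrable lborel (\<lambda>y. indicator {0<..<1} y * (f y * sin (pi * real (Suc m) * y)))" for m
  proof -
    have "set_integrable lborel {0<..<1} (\<lambda>y. f y * sin (pi * real (Suc m) * y))"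
    proof (rule set_integrable_subset)
      show "set_integrable lborel {0..1} (\<lambda>y. f y * sin (pi * real (Suc m) * y))"
        unfolding set_integrable_def by (intro borel_integrable_compact continuous_intros f) auto
    qed auto
    then show ?thesis by (simp add: set_integrable_def)
  qed
  have i: "integrable lborel (T m)" for m unfolding T_def using si by (intro integrable_mult_right) auto
  have Tb: "norm (T m y) \<le> a m * B * indicator {0<..<1} y" for m y
  proof -
    have "\<bar>sin (pi * real (Suc m) * x)\<bar> * (\<bar>f y\<bar> * \<bar>sin (pi * real (Suc m) * y)\<bar>) \<le> 1 * (B * 1)" if "y \<in> {0<..<1}"
      using B that by (intro mult_mono) auto
    then show ?thesis by (auto simp: T_def abs_mult a_def indicator_def mult.assoc)
  qed
  have sa: "summable a" unfolding a_def using summable_sine_coeff[OF t] .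
  have "(\<lambda>m. integral\<^sup>L lborel (T m)) sums (\<integral>y. (\<Sum>m. T m y) \<partial>lborel)"
  proof (rule sums_integral[OF i])
    show "AE y in lborel. summable (\<lambda>m. norm (T m y))"
    proof (rule AE_I2)
      fix y show "summable (\<lambda>m. norm (T m y))"
        by (rule summable_comparison_test'[of "\<lambda>m. a m * B * indicator {0<..<1} y"])
          (use Tb sa in \<open>auto intro!: summable_mult2\<close>)
    qed
    show "summable (\<lambda>m. \<integral>y. norm (T m y) \<partial>lborel)"
    proof (rule summable_comparison_test'[of "\<lambda>m. a m * B"])
      fix m
      have "integrable lborel (\<lambda>y::real. a m * B * indicator {0<..<1} y)" by simp
      from integral_mono[OF integrable_norm[OF i[of m]] this Tb]
      have "(\<integral>y. norm (T m y) \<partial>lborel) \<le> (\<integral>y. a m * B * indicator {0<..<1} (y::real) \<partial>lborel)" .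
      then show "norm (\<integral>y. norm (T m y) \<partial>lborel) \<le> a m * B" by simp
    qed (use sa in \<open>auto intro!: summable_mult2\<close>)
  qed
  moreover have "(\<Sum>m. T m y) = indicator {0<..<1} y * (f y * sine_kernel t x y)" for y
  proof -
    have "(\<Sum>m. T m y) = (\<Sum>m. (indicator {0<..<1} y * f y) *
      (2 * exp (- (pi\<^sup>2 * (real (Suc m))\<^sup>2 * t)) * sin (pi * real (Suc m) * x) * sin (pi * real (Suc m) * y)))"
      by (simp add: T_def a_def mult_ac)
    also have "\<dots> = (indicator {0<..<1} y * f y) * sine_kernel t x y"
      unfolding sine_kernel_def by (rule suminf_mult[OF summable_sine_kernel[OF t]])
    finally show ?thesis by simp
  qed
  moreover have "integral\<^sup>L lborel (T m) = 2 * exp (- (pi\<^sup>2 * (real (Suc m))\<^sup>2 * t)) * sin (pi * real (Suc m) * x)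
         * (LINT y:{0<..<1}|lborel. f y * sin (pi * real (Suc m) * y))" for m
    by (simp add: T_def[abs_def] a_def set_lebesgue_integral_def del: of_nat_Suc)
  ultimately show ?thesis
    by (simp add: sums_iff set_lebesgue_integral_def del: of_nat_Suc)
qed

lemma sine_kernel_sym: "sine_kernel t x y = sine_kernel t y x"
  unfolding sine_kernel_def by (simp add: mult_ac)

lemma continuous_sine_kernel_left: "t > 0 \<Longrightarrow> continuous_on A (\<lambda>y. sine_kernel t x y)"
  using continuous_on_compose2[OF continuous_sine_kernel continuous_on_Pair[OF continuous_on_const[of _ x] continuous_on_id], of t A]
  by auto

lemma sine_kernel_coeff:
  assumes t: "t > 0"
  shows "(LINT y:{0<..<1}|lborel. sin (pi * real n * y) * sine_kernel t x y)
    = exp (- (pi\<^sup>2 * (real n)\<^sup>2 * t)) * sin (pi * real n * x)"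
proof (cases "n = 0")
  case False
  have "(LINT y:{0<..<1}|lborel. sin (pi * real n * y) * sine_kernel t x y) =
    (\<Sum>m. 2 * exp (- (pi\<^sup>2 * (real (Suc m))\<^sup>2 * t)) * sin (pi * real (Suc m) * x) * (if n = Suc m then 1/2 else 0))"
    using False by (subst integral_sine_kernel[OF t]) (auto intro!: continuous_intros simp: integral_sin_sin simp del: of_nat_Suc)
  also have "\<dots> = (\<Sum>m\<in>{n-1}. 2 * exp (- (pi\<^sup>2 * (real (Suc m))\<^sup>2 * t)) * sin (pi * real (Suc m) * x) * (if n = Suc m then 1/2 else 0))"
    using False by (intro suminf_finite) auto
  finally show ?thesis using False by simp
qed simp

lemma sine_kernel_semigroup:
  assumes "s > 0" "t > 0"
  shows "(LINT y:{0<..<1}|lborel. sine_kernel s x y * sine_kernel t y z) = sine_kernel (s + t) x z"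
proof -
  have "(LINT y:{0<..<1}|lborel. sine_kernel s x y * sine_kernel t z y) =
    (\<Sum>m. 2 * exp (- (pi\<^sup>2 * (real (Suc m))\<^sup>2 * t)) * sin (pi * real (Suc m) * z)
         * (LINT y:{0<..<1}|lborel. sine_kernel s x y * sin (pi * real (Suc m) * y)))"
    by (rule integral_sine_kernel[OF assms(2) continuous_sine_kernel_left[OF assms(1)]])
  also have "\<dots> = (\<Sum>m. 2 * exp (- (pi\<^sup>2 * (real (Suc m))\<^sup>2 * t)) * sin (pi * real (Suc m) * z)
         * (exp (- (pi\<^sup>2 * (real (Suc m))\<^sup>2 * s)) * sin (pi * real (Suc m) * x)))"
    by (subst mult.commute[of "sine_kernel s x _"], subst sine_kernel_coeff[OF assms(1)]) (rule refl)
  also have "\<dots> = sine_kernel (s + t) x z"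
    unfolding sine_kernel_def by (intro suminf_cong) (simp add: ring_distribs exp_add exp_minus field_simps exp_diff)
  finally show ?thesis by (simp add: sine_kernel_sym[of t z])
qed

text \<open>The error is measured against the ground mode itself. Each higher mode costs a factor
  k^2 from two applications of \<open>abs_sin_mult_le\<close>, and the distance of the eigenvalues
  absorbs it.\<close>

lemma sine_kernel_asymp:
  "\<exists>C\<ge>0. \<forall>t\<ge>1. \<forall>x\<in>{0..1}. \<forall>y\<in>{0..1}.
     \<bar>sine_kernel t x y - 2 * exp (- (pi\<^sup>2 * t)) * sin (pi * x) * sin (pi * y)\<bar>
      \<le> C * exp (- t) * (2 * exp (- (pi\<^sup>2 * t)) * sin (pi * x) * sin (pi * y))"
proof (intro exI[of _ "\<Sum>m. 2 * exp (-1) ^ m"] conjI allI impI ballI)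
  have geo: "summable (\<lambda>m. 2 * exp (-1 :: real) ^ m)" by (intro summable_mult summable_geometric) simp
  then show "0 \<le> (\<Sum>m. 2 * exp (-1 :: real) ^ m)" by (intro suminf_nonneg) auto
  fix t x y :: real assume t: "1 \<le> t" and x: "x \<in> {0..1}" and y: "y \<in> {0..1}"
  have sx: "sin (pi * x) \<ge> 0" "sin (pi * y) \<ge> 0" using x y by (auto intro!: sin_ge_zero mult_left_le)
  define T where "T m = 2 * exp (- (pi\<^sup>2 * (real (Suc m))\<^sup>2 * t)) * sin (pi * real (Suc m) * x) * sin (pi * real (Suc m) * y)" for m
  define A where "A = 2 * exp (- (pi\<^sup>2 * t)) * sin (pi * x) * sin (pi * y)"
  have A: "A \<ge> 0" using sx by (simp add: A_def)
  have sT: "summable T" unfolding T_def using t by (intro summable_sine_kernel) simp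
  have "sine_kernel t x y = (\<Sum>m. T (m + 1)) + T 0"
    using suminf_split_initial_segment[OF sT, of 1] by (simp add: sine_kernel_def T_def[abs_def] del: of_nat_Suc)
  also have "T 0 = A" by (simp add: T_def A_def)
  finally have "sine_kernel t x y - A = (\<Sum>m. T (m + 1))" by simp
  moreover have "\<bar>\<Sum>m. T (m + 1)\<bar> \<le> (\<Sum>m. 2 * exp (-1) ^ m * (exp (- t) * A))"
  proof -
    have b: "norm (T (m + 1)) \<le> 2 * exp (-1) ^ m * (exp (- t) * A)" for m
    proof -
      \<comment> \<open>\<open>T 0\<close> is mode 1, so the remaining term with index m + 1 is mode
        m + 2.\<close>
      let ?k = "real (m + 2)"
      have e: "?k\<^sup>2 * exp (- (pi\<^sup>2 * ?k\<^sup>2 * t)) \<le> 2 * exp (-1) ^ m * exp (- t) * exp (- (pi\<^sup>2 * t))"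
      proof -
        have "?k\<^sup>2 \<le> 2 * exp ?k"
          using exp_lower_Taylor_quadratic[of ?k] by simp
        then have "?k\<^sup>2 * exp (- (pi\<^sup>2 * ?k\<^sup>2 * t)) \<le> 2 * exp ?k * exp (- (pi\<^sup>2 * ?k\<^sup>2 * t))"
          by (intro mult_right_mono) auto
        also have "\<dots> = 2 * exp (?k - pi\<^sup>2 * ?k\<^sup>2 * t)" by (simp add: exp_diff exp_minus field_simps)
        also have "\<dots> \<le> 2 * exp (- real m - t - pi\<^sup>2 * t)"
        proof -
          \<comment> \<open>With pi^2 \<ge> 9 the exponent pi^2 (k^2 - 1) t has room for all three
            debts: the growth exp k bounding k^2, the geometric factor exp(-m) and the final decay
            exp(-t).\<close>
          have "pi\<^sup>2 \<ge> 3\<^sup>2" using pi_gt3 by (intro power_mono) auto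
          then have "pi\<^sup>2 * (?k\<^sup>2 - 1) * t \<ge> 9 * (?k\<^sup>2 - 1) * t"
            using t by (intro mult_right_mono) (auto simp: power2_eq_square algebra_simps)
          moreover have "(?k\<^sup>2 - 1) * t \<ge> (2 * real m + 3) * t"
            using t by (intro mult_right_mono) (auto simp: power2_eq_square algebra_simps)
          moreover have "real m * t \<ge> real m" using t by (simp add: mult_le_cancel_left1)
          ultimately have "?k + real m + t \<le> pi\<^sup>2 * (?k\<^sup>2 - 1) * t"
            using t unfolding distrib_right mult.assoc of_nat_add of_nat_numeral by linarith
          moreover have "pi\<^sup>2 * (?k\<^sup>2 - 1) * t = pi\<^sup>2 * ?k\<^sup>2 * t - pi\<^sup>2 * t" by (simp only: right_diff_distrib left_diff_distrib mult_1_right)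
          ultimately have "?k - pi\<^sup>2 * ?k\<^sup>2 * t \<le> - real m - t - pi\<^sup>2 * t" by linarith
          then show ?thesis by simp
        qed
        also have "\<dots> = 2 * exp (-1) ^ m * exp (- t) * exp (- (pi\<^sup>2 * t))"
        proof -
          have "exp (- real m - t - pi\<^sup>2 * t) = exp (- real m + - t + - (pi\<^sup>2 * t))" by simp
          also have "\<dots> = exp (- real m) * exp (- t) * exp (- (pi\<^sup>2 * t))" by (simp only: exp_add)
          also have "exp (- real m) = exp (-1) ^ m" using exp_of_nat_mult[of m "-1::real"] by simp
          finally show ?thesis by simp
        qed
        finally show ?thesis .
      qed
      have s: "\<bar>sin (pi * ?k * x)\<bar> \<le> ?k * sin (pi * x)" "\<bar>sin (pi * ?k * y)\<bar> \<le> ?k * sin (pi * y)"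
        using abs_sin_mult_le[of "m + 2" "pi * x"] abs_sin_mult_le[of "m + 2" "pi * y"] sx by (simp_all add: mult_ac)
      have "norm (T (m + 1)) = 2 * exp (- (pi\<^sup>2 * ?k\<^sup>2 * t)) * (\<bar>sin (pi * ?k * x)\<bar> * \<bar>sin (pi * ?k * y)\<bar>)"
        by (simp add: T_def abs_mult add.commute)
      also have "\<dots> \<le> 2 * exp (- (pi\<^sup>2 * ?k\<^sup>2 * t)) * ((?k * sin (pi * x)) * (?k * sin (pi * y)))"
        using s sx by (intro mult_left_mono mult_mono) auto
      also have "\<dots> = (?k\<^sup>2 * exp (- (pi\<^sup>2 * ?k\<^sup>2 * t))) * (2 * (sin (pi * x) * sin (pi * y)))"
        by (simp add: power2_eq_square)
      also have "\<dots> \<le> (2 * exp (-1) ^ m * exp (- t) * exp (- (pi\<^sup>2 * t))) * (2 * (sin (pi * x) * sin (pi * y)))"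
        using e sx by (intro mult_right_mono) auto
      finally show ?thesis by (simp add: A_def mult_ac)
    qed
    have sg: "summable (\<lambda>m. 2 * exp (-1) ^ m * (exp (- t) * A))" using geo by (rule summable_mult2)
    have "summable (\<lambda>m. norm (T (m + 1)))" by (rule summable_comparison_test'[OF sg]) (use b in auto)
    then have "norm (\<Sum>m. T (m + 1)) \<le> (\<Sum>m. norm (T (m + 1)))" by (rule summable_norm)
    also have "\<dots> \<le> (\<Sum>m. 2 * exp (-1) ^ m * (exp (- t) * A))"
      by (rule suminf_le[OF b \<open>summable (\<lambda>m. norm (T (m + 1)))\<close> sg])
    finally show ?thesis by simp
  qed
  moreover have "(\<Sum>m. 2 * exp (-1) ^ m * (exp (- t) * A)) = (\<Sum>m. 2 * exp (-1) ^ m) * (exp (- t) * A)"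
    by (rule suminf_mult2[OF geo, symmetric])
  ultimately show "\<bar>sine_kernel t x y - A\<bar> \<le> (\<Sum>m. 2 * exp (-1) ^ m) * exp (- t) * A"
    by (simp add: mult_ac)
qed

section \<open>Identification of the Dirichlet heat kernel of a cube\<close>

lemma Basis_vec_real: "(Basis :: (real ^ 'd) set) = range (\<lambda>i. axis i 1)"
  by (auto simp: Basis_vec_def)

lemma inj_axis: "inj (\<lambda>i. axis i (1::real) :: real ^ 'd)"
  by (auto simp: inj_on_def axis_eq_axis)

lemma has_laplacian_sine_prod:
  fixes a :: "'d::finite \<Rightarrow> real"
  shows "has_laplacian (\<lambda>x::real^'d. c * (\<Prod>i\<in>UNIV. sin (a i * x $ i)))
     (- (\<Sum>i\<in>UNIV. (a i)\<^sup>2) * (c * (\<Prod>i\<in>UNIV. sin (a i * x $ i)))) x"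
proof -
  \<comment> \<open>\<open>has_laplacian\<close> indexes its derivatives by basis vectors;
    \<open>ix\<close> recovers the coordinate from the basis vector.\<close>
  define ix where "ix = inv (\<lambda>i. axis i 1 :: real^'d)"
  have ix: "ix (axis i 1) = i" for i unfolding ix_def by (rule inv_f_f[OF inj_axis])
  define P where "P i = (\<Prod>j\<in>UNIV - {i}. sin (a j * x $ j))" for i
  have P: "(\<Prod>j\<in>UNIV. sin (a j * (x + s *\<^sub>R axis i 1) $ j)) = sin (a i * (x $ i + s)) * P i" for i s
    unfolding P_def by (subst prod.remove[of _ i]) (auto simp: axis_def intro!: prod.cong)
  have P0: "(\<Prod>j\<in>UNIV. sin (a j * x $ j)) = sin (a i * x $ i) * P i" for i using P[of 0 i] by simp
  define g1 where "g1 b s = c * (a (ix b) * cos (a (ix b) * (x $ ix b + s)) * P (ix b))" for b s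
  define g2 where "g2 b = - ((a (ix b))\<^sup>2) * (c * (\<Prod>i\<in>UNIV. sin (a i * x $ i)))" for b
  show ?thesis
    unfolding has_laplacian_def
  proof (intro exI[of _ g1] exI[of _ g2] conjI ballI)
    fix b :: "real^'d" assume "b \<in> Basis"
    then obtain i where b: "b = axis i 1" by (auto simp: Basis_vec_real)
    show "\<forall>\<^sub>F s in nhds 0. ((\<lambda>s. c * (\<Prod>i\<in>UNIV. sin (a i * (x + s *\<^sub>R b) $ i))) has_real_derivative g1 b s) (at s)"
      unfolding b P g1_def ix by (intro always_eventually allI) (auto intro!: derivative_eq_intros)
    show "(g1 b has_real_derivative g2 b) (at 0)"
      unfolding b g1_def[abs_def] g2_def ix P0[of i]
      by (auto intro!: derivative_eq_intros simp: power2_eq_square)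
  next
    have "(\<Sum>b\<in>Basis. g2 b) = (\<Sum>i\<in>UNIV. g2 (axis i 1))"
      unfolding Basis_vec_real by (subst sum.reindex[OF inj_axis]) simp
    then show "- (\<Sum>i\<in>UNIV. (a i)\<^sup>2) * (c * (\<Prod>i\<in>UNIV. sin (a i * x $ i))) = (\<Sum>b\<in>Basis. g2 b)"
      by (simp add: g2_def ix sum_distrib_right sum_negf)
  qed
qed

definition sine_mode :: "('d::finite \<Rightarrow> nat) \<Rightarrow> real ^ 'd \<Rightarrow> real" where
  "sine_mode n x = (\<Prod>i\<in>UNIV. sin (pi * real (n i) * x $ i))"

lemma continuous_sine_mode[continuous_intros]: "continuous_on A (sine_mode n)"
  unfolding sine_mode_def by (intro continuous_intros)

lemma sine_mode_heat_flow:
  fixes n :: "'d::finite \<Rightarrow> nat"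
  assumes L: "L > 0"
  shows "dirichlet_heat_flow (cube L) (\<lambda>x. sine_mode n ((1 / L) *\<^sub>R x))
     (\<lambda>t x. exp (- ((pi / L)\<^sup>2 * (\<Sum>i\<in>UNIV. (real (n i))\<^sup>2) * t)) * sine_mode n ((1 / L) *\<^sub>R x))"
  unfolding dirichlet_heat_flow_def
proof (intro conjI ballI allI impI)
  show "continuous_on ({0..} \<times> closure (cube L)) (\<lambda>(t, x). exp (- ((pi / L)\<^sup>2 * (\<Sum>i\<in>UNIV. (real (n i))\<^sup>2) * t)) * sine_mode n ((1 / L) *\<^sub>R x))"
    unfolding case_prod_beta sine_mode_def by (intro continuous_intros)
next
  fix t :: real and x :: "real ^ 'd" assume "x \<in> frontier (cube L)"
  then obtain i where i: "x $ i = 0 \<or> x $ i = L" using frontier_cube[OF L] by blast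
  have "sin (pi * real (n i) * ((1 / L) *\<^sub>R x) $ i) = 0"
    using i L by (auto simp: mult.commute[of pi])
  then have "sine_mode n ((1 / L) *\<^sub>R x) = 0" unfolding sine_mode_def by (intro prod_zero) auto
  then show "exp (- ((pi / L)\<^sup>2 * (\<Sum>i\<in>UNIV. (real (n i))\<^sup>2) * t)) * sine_mode n ((1 / L) *\<^sub>R x) = 0" by simp
next
  fix t :: real and x :: "real ^ 'd"
  let ?e = "exp (- ((pi / L)\<^sup>2 * (\<Sum>i\<in>UNIV. (real (n i))\<^sup>2) * t))"
  define a where "a i = pi / L * real (n i)" for i
  have m: "sine_mode n ((1 / L) *\<^sub>R x) = (\<Prod>i\<in>UNIV. sin (a i * x $ i))" for x :: "real ^ 'd"
    by (simp add: sine_mode_def a_def)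
  have s: "(\<Sum>i\<in>UNIV. (a i)\<^sup>2) = (pi / L)\<^sup>2 * (\<Sum>i\<in>UNIV. (real (n i))\<^sup>2)"
    by (simp add: a_def power_mult_distrib power_divide sum_distrib_left)
  have "has_laplacian (\<lambda>x. ?e * sine_mode n ((1 / L) *\<^sub>R x))
     (- (\<Sum>i\<in>UNIV. (a i)\<^sup>2) * (?e * sine_mode n ((1 / L) *\<^sub>R x))) x"
    unfolding m by (rule has_laplacian_sine_prod)
  moreover have "((\<lambda>t. exp (- ((pi / L)\<^sup>2 * (\<Sum>i\<in>UNIV. (real (n i))\<^sup>2) * t)) * sine_mode n ((1 / L) *\<^sub>R x)) has_real_derivative
      - (\<Sum>i\<in>UNIV. (a i)\<^sup>2) * (?e * sine_mode n ((1 / L) *\<^sub>R x))) (at t)"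
    unfolding s by (auto intro!: derivative_eq_intros)
  ultimately show "\<exists>D. has_laplacian (\<lambda>x. ?e * sine_mode n ((1 / L) *\<^sub>R x)) D x \<and>
      ((\<lambda>t. exp (- ((pi / L)\<^sup>2 * (\<Sum>i\<in>UNIV. (real (n i))\<^sup>2) * t)) * sine_mode n ((1 / L) *\<^sub>R x)) has_real_derivative D) (at t)"
    by blast
qed simp

text \<open>Both sides are values of Dirichlet flows started from the same mode, one given by the
  kernel and one explicit, so uniqueness identifies them.\<close>

lemma dirichlet_kernel_coeff:
  fixes q :: "real \<Rightarrow> real ^ 'd \<Rightarrow> real ^ 'd \<Rightarrow> real"
  assumes L: "L > 0" and q: "dirichlet_heat_kernel (cube L) q" and t: "t > 0" and x: "x \<in> closure (cube L)"
  shows "(LINT y:cube L|lborel. q t x y * sine_mode n ((1 / L) *\<^sub>R y))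
    = exp (- ((pi / L)\<^sup>2 * (\<Sum>i\<in>UNIV. (real (n i))\<^sup>2) * t)) * sine_mode n ((1 / L) *\<^sub>R x)"
proof -
  let ?f = "\<lambda>x. sine_mode n ((1 / L) *\<^sub>R x)"
  note flow = sine_mode_heat_flow[OF L, of n]
  have "continuous_on (closure (cube L)) ?f" unfolding sine_mode_def by (intro continuous_intros)
  moreover have "?f x = 0" if "x \<in> frontier (cube L)" for x
  proof -
    have "\<forall>t\<ge>0. exp (- ((pi / L)\<^sup>2 * (\<Sum>i\<in>UNIV. (real (n i))\<^sup>2) * t)) * sine_mode n ((1 / L) *\<^sub>R x) = 0"
      using flow that unfolding dirichlet_heat_flow_def by blast
    from spec[OF this, of 0] show ?thesis by simp
  qed
  ultimately have "dirichlet_heat_flow (cube L) ?f (\<lambda>t x. if t = 0 then ?f x else (LINT y:cube L|lborel. q t x y * ?f y))"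
    using q unfolding dirichlet_heat_kernel_def by blast
  from dirichlet_heat_flow_unique[OF this flow open_cube bounded_cube less_imp_le[OF t] x]
  show ?thesis using t by simp
qed

text \<open>The indicator of the cube is the product of the indicators of its sides, so the
  integrand factorizes over the coordinates of \<open>lborel\<close> and the finite product form of
  Fubini applies.\<close>

lemma integral_cube_prod:
  fixes f :: "'d::finite \<Rightarrow> real \<Rightarrow> real"
  assumes "\<And>i. set_integrable lborel {0<..<1} (f i)"
  shows "(LINT y:cube 1|lborel. (\<Prod>i\<in>UNIV. f i (y $ i))) = (\<Prod>i\<in>UNIV. (LINT s:{0<..<1}|lborel. f i s))"
proof -
  interpret product_sigma_finite "\<lambda>_::real^'d. lborel :: real measure" ..
  define ix where "ix = inv (\<lambda>i. axis i 1 :: real^'d)"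
  have ix: "ix (axis i 1) = i" for i unfolding ix_def by (rule inv_f_f[OF inj_axis])
  define g where "g i s = indicator {0<..<1} s * f i s" for i s
  have gi: "integrable lborel (g i)" for i using assms by (simp add: set_integrable_def g_def[abs_def])
  then have gm[measurable]: "g i \<in> borel_measurable borel" for i
    using borel_measurable_integrable by fastforce
  have ind: "indicator (cube 1) y * (\<Prod>i\<in>UNIV. f i (y $ i)) = (\<Prod>i\<in>UNIV. g i (y $ i))" for y :: "real ^ 'd"
  proof (cases "y \<in> cube 1")
    case True then show ?thesis by (auto simp: g_def cube_def intro!: prod.cong)
  next
    case False
    then obtain i where "y $ i \<notin> {0<..<1}" by (auto simp: cube_def)
    then have "g i (y $ i) = 0" by (simp add: g_def)
    then have "(\<Prod>i\<in>UNIV. g i (y $ i)) = 0" by (intro prod_zero) auto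
    then show ?thesis using False by simp
  qed
  have "(LINT y:cube 1|lborel. (\<Prod>i\<in>UNIV. f i (y $ i))) = (\<integral>y. (\<Prod>i\<in>UNIV. g i ((y :: real^'d) $ i)) \<partial>lborel)"
    by (simp add: set_lebesgue_integral_def ind)
  also have "\<dots> = (\<integral>x. (\<Prod>i\<in>UNIV. g i ((\<Sum>b\<in>Basis. x b *\<^sub>R b) $ i)) \<partial>(\<Pi>\<^sub>M b\<in>(Basis::(real^'d) set). lborel))"
    by (subst lborel_eq, subst integral_distr) (auto intro!: borel_measurable_prod)
  also have "\<dots> = (\<integral>x. (\<Prod>b\<in>Basis. g (ix b) (x b)) \<partial>(\<Pi>\<^sub>M b\<in>(Basis::(real^'d) set). lborel))"
  proof (intro Bochner_Integration.integral_cong refl)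
    fix x :: "real^'d \<Rightarrow> real"
    have "(\<Sum>b\<in>Basis. x b *\<^sub>R b) $ i = x (axis i 1)" for i
      unfolding Basis_vec_real by (subst sum.reindex[OF inj_axis]) (simp add: axis_def if_distrib cong: if_cong)
    then show "(\<Prod>i\<in>UNIV. g i ((\<Sum>b\<in>Basis. x b *\<^sub>R b) $ i)) = (\<Prod>b\<in>Basis. g (ix b) (x b))"
      unfolding Basis_vec_real by (subst prod.reindex[OF inj_axis]) (simp add: ix)
  qed
  also have "\<dots> = (\<Prod>b\<in>(Basis::(real^'d) set). integral\<^sup>L lborel (g (ix b)))"
    by (rule product_integral_prod) (auto intro: gi)
  also have "\<dots> = (\<Prod>i\<in>UNIV. (LINT s:{0<..<1}|lborel. f i s))"
    unfolding Basis_vec_real by (subst prod.reindex[OF inj_axis]) (simp add: ix set_lebesgue_integral_def g_def[abs_def])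
  finally show ?thesis .
qed

definition cube_kernel :: "real \<Rightarrow> real ^ 'd \<Rightarrow> real ^ 'd \<Rightarrow> real" where
  "cube_kernel t x y = (\<Prod>i\<in>UNIV. sine_kernel t (x $ i) (y $ i))"

lemma continuous_cube_kernel:
  assumes "t > 0" shows "continuous_on UNIV (\<lambda>(x, y). cube_kernel t x y)"
  unfolding cube_kernel_def case_prod_beta
proof (rule continuous_on_prod)
  fix i
  show "continuous_on UNIV (\<lambda>p. sine_kernel t (fst p $ i) (snd p $ i))"
    by (rule continuous_on_compose2[OF continuous_sine_kernel[OF assms],
      of UNIV "\<lambda>p. (fst p $ i, snd p $ i)", unfolded case_prod_conv]) (auto intro!: continuous_intros)
qed

lemma continuous_cube_kernel_section: "t > 0 \<Longrightarrow> continuous_on A (cube_kernel t x)"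
  using continuous_on_section[of UNIV UNIV "cube_kernel t" x] continuous_cube_kernel[of t]
    continuous_on_subset[OF _ subset_UNIV] by fastforce

lemma set_integrable_unit_interval: "continuous_on {0..1} f \<Longrightarrow> set_integrable lborel {0<..<1} (f :: real \<Rightarrow> real)"
  by (rule set_integrable_continuous_closure) auto

lemma cube_kernel_coeff:
  assumes "t > 0"
  shows "(LINT y:cube 1|lborel. cube_kernel t x y * sine_mode n y) = exp (- (pi\<^sup>2 * (\<Sum>i\<in>UNIV. (real (n i))\<^sup>2) * t)) * sine_mode n x"
proof -
  have "(LINT y:cube 1|lborel. cube_kernel t x y * sine_mode n y) =
    (LINT y:cube 1|lborel. (\<Prod>i\<in>UNIV. sin (pi * real (n i) * y $ i) * sine_kernel t (x $ i) (y $ i)))"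
    by (simp add: cube_kernel_def sine_mode_def prod.distrib mult.commute)
  also have "\<dots> = (\<Prod>i\<in>UNIV. (LINT s:{0<..<1}|lborel. sin (pi * real (n i) * s) * sine_kernel t (x $ i) s))"
    by (rule integral_cube_prod)
      (intro set_integrable_unit_interval continuous_intros continuous_sine_kernel_left assms)
  also have "\<dots> = (\<Prod>i\<in>UNIV. exp (- (pi\<^sup>2 * (real (n i))\<^sup>2 * t)) * sin (pi * real (n i) * x $ i))"
    by (simp add: sine_kernel_coeff assms)
  finally show ?thesis
    by (simp add: prod.distrib sine_mode_def exp_sum sum_distrib_left sum_distrib_right sum_negf[symmetric])
qed

lemma cube_kernel_semigroup:
  assumes "s > 0" "t > 0"
  shows "(LINT y:cube 1|lborel. cube_kernel s x y * cube_kernel t y z) = cube_kernel (s + t) x z"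
proof -
  have "(LINT y:cube 1|lborel. cube_kernel s x y * cube_kernel t y z) =
    (LINT y:cube 1|lborel. (\<Prod>i\<in>UNIV. sine_kernel s (x $ i) (y $ i) * sine_kernel t (z $ i) (y $ i)))"
    by (simp add: cube_kernel_def prod.distrib sine_kernel_sym[of t "_ $ _" "z $ _"])
  also have "\<dots> = (\<Prod>i\<in>UNIV. (LINT r:{0<..<1}|lborel. sine_kernel s (x $ i) r * sine_kernel t (z $ i) r))"
    by (rule integral_cube_prod)
      (intro set_integrable_unit_interval continuous_intros continuous_sine_kernel_left assms)
  also have "\<dots> = cube_kernel (s + t) x z"
    by (simp add: cube_kernel_def sine_kernel_semigroup[OF assms, symmetric] sine_kernel_sym[of t "z $ _"])
  finally show ?thesis .
qed


lemma hD_mult: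
  fixes x y :: "real ^ 'd"
  shows "hD x * hD y = (\<Prod>i\<in>UNIV. 2 * sin (pi * x $ i) * sin (pi * y $ i))"
proof -
  have "2 powr (real CARD('d) / 2) * 2 powr (real CARD('d) / 2) = (2::real) ^ CARD('d)"
    by (simp add: powr_add[symmetric] powr_realpow[symmetric])
  then show ?thesis by (simp add: hD_def prod.distrib mult_ac)
qed

lemma hD_pos: "x \<in> cube 1 \<Longrightarrow> hD x > 0"
  unfolding hD_def by (auto simp: cube_def intro!: mult_pos_pos prod_pos sin_gt_zero)

text \<open>Each of the \<open>CARD('d)\<close> factors has relative error r = C exp(-t), and both
  (1 - r)^d and (1 + r)^d tend to 1.\<close>

lemma cube_kernel_asymp:
  assumes \<eta>: "\<eta> > 0"
  shows "\<forall>\<^sub>F t in at_top. \<forall>x\<in>closure (cube 1). \<forall>y\<in>closure (cube 1).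
     (1 - \<eta>) * (exp (- (pi\<^sup>2 * real CARD('d) * t)) * (hD x * hD y)) \<le> cube_kernel t x (y :: real ^ 'd) \<and>
     cube_kernel t x y \<le> (1 + \<eta>) * (exp (- (pi\<^sup>2 * real CARD('d) * t)) * (hD x * hD y))"
proof -
  obtain C where C: "C \<ge> 0" "\<And>t x y. t \<ge> 1 \<Longrightarrow> x \<in> {0..1} \<Longrightarrow> y \<in> {0..1} \<Longrightarrow>
     \<bar>sine_kernel t x y - 2 * exp (- (pi\<^sup>2 * t)) * sin (pi * x) * sin (pi * y)\<bar>
      \<le> C * exp (- t) * (2 * exp (- (pi\<^sup>2 * t)) * sin (pi * x) * sin (pi * y))"
    using sine_kernel_asymp by blast
  have e0: "((\<lambda>t::real. exp (- t)) \<longlongrightarrow> 0) at_top"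
    using exp_at_bot filterlim_uminus_at_bot_at_top by (rule filterlim_compose)
  have "((\<lambda>t. (1 + C * exp (- t)) ^ CARD('d)) \<longlongrightarrow> (1 + C * 0) ^ CARD('d)) at_top"
    by (intro tendsto_intros e0)
  then have ev1: "\<forall>\<^sub>F t in at_top. (1 + C * exp (- t)) ^ CARD('d) < 1 + \<eta>"
    by (rule order_tendstoD) (use \<eta> in simp)
  have "((\<lambda>t. (1 - C * exp (- t)) ^ CARD('d)) \<longlongrightarrow> (1 - C * 0) ^ CARD('d)) at_top"
    by (intro tendsto_intros e0)
  then have ev2: "\<forall>\<^sub>F t in at_top. (1 - C * exp (- t)) ^ CARD('d) > 1 - \<eta>"
    by (rule order_tendstoD) (use \<eta> in simp)
  \<comment> \<open>With r < 1 the one-dimensional lower bounds are nonnegative and may be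
    multiplied.\<close>
  have "((\<lambda>t. C * exp (- t)) \<longlongrightarrow> C * 0) at_top"
    by (intro tendsto_intros e0)
  then have ev3: "\<forall>\<^sub>F t in at_top. C * exp (- t) < 1"
    by (rule order_tendstoD) simp
  show ?thesis
    using ev1 ev2 ev3 eventually_ge_at_top[of 1]
  proof eventually_elim
    case (elim t)
    define r where "r = C * exp (- t)"
    have r: "0 \<le> r" "r < 1" using C elim by (auto simp: r_def)
    show ?case
    proof (intro ballI)
      fix x y :: "real ^ 'd" assume x: "x \<in> closure (cube 1)" and y: "y \<in> closure (cube 1)"
      define b where "b i = 2 * exp (- (pi\<^sup>2 * t)) * sin (pi * x $ i) * sin (pi * y $ i)" for i
      have xy: "x $ i \<in> {0..1}" "y $ i \<in> {0..1}" for i using x y by (auto simp: mem_closure_cube)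
      have b: "b i \<ge> 0" for i
        using xy[of i] unfolding b_def by (auto intro!: mult_nonneg_nonneg sin_ge_zero mult_left_le)
      have B: "(\<Prod>i\<in>UNIV. b i) = exp (- (pi\<^sup>2 * real CARD('d) * t)) * (hD x * hD y)"
        unfolding hD_mult b_def by (simp add: prod.distrib exp_of_nat_mult[symmetric] mult_ac)
      have k: "\<bar>sine_kernel t (x $ i) (y $ i) - b i\<bar> \<le> r * b i" for i
        unfolding b_def r_def using C(2)[OF elim(4) xy(1)[of i] xy(2)[of i]] by simp
      have lo: "(1 - r) * b i \<le> sine_kernel t (x $ i) (y $ i)" and hi: "sine_kernel t (x $ i) (y $ i) \<le> (1 + r) * b i" for i
        using k[of i] by (simp_all add: algebra_simps abs_le_iff)
      have "(\<Prod>i\<in>UNIV. (1 - r) * b i) \<le> cube_kernel t x y"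
        unfolding cube_kernel_def using lo b r by (intro prod_mono) auto
      moreover have "(\<Prod>i\<in>UNIV. (1 - r) * b i) = (1 - r) ^ CARD('d) * (\<Prod>i\<in>UNIV. b i)"
        by (simp add: prod.distrib)
      moreover have "(1 - \<eta>) * (\<Prod>i\<in>UNIV. b i) \<le> (1 - r) ^ CARD('d) * (\<Prod>i\<in>UNIV. b i)"
        using elim by (intro mult_right_mono prod_nonneg) (auto simp: r_def b)
      moreover have "cube_kernel t x y \<le> (\<Prod>i\<in>UNIV. (1 + r) * b i)"
        unfolding cube_kernel_def
      proof (intro prod_mono conjI hi)
        fix i
        have "0 \<le> (1 - r) * b i" using r b by (intro mult_nonneg_nonneg) auto
        with lo[of i] show "0 \<le> sine_kernel t (x $ i) (y $ i)" by linarith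
      qed
      moreover have "(\<Prod>i\<in>UNIV. (1 + r) * b i) = (1 + r) ^ CARD('d) * (\<Prod>i\<in>UNIV. b i)"
        by (simp add: prod.distrib)
      moreover have "(1 + r) ^ CARD('d) * (\<Prod>i\<in>UNIV. b i) \<le> (1 + \<eta>) * (\<Prod>i\<in>UNIV. b i)"
        using elim by (intro mult_right_mono prod_nonneg) (auto simp: r_def b)
      ultimately show "(1 - \<eta>) * (exp (- (pi\<^sup>2 * real CARD('d) * t)) * (hD x * hD y)) \<le> cube_kernel t x y \<and>
         cube_kernel t x y \<le> (1 + \<eta>) * (exp (- (pi\<^sup>2 * real CARD('d) * t)) * (hD x * hD y))"
        unfolding B by linarith
    qed
  qed
qed

section \<open>Completeness of the sine modes\<close>

inductive_set sine_span :: "(real ^ 'd \<Rightarrow> real) set" where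
  mode: "sine_mode n \<in> sine_span"
| add: "v \<in> sine_span \<Longrightarrow> w \<in> sine_span \<Longrightarrow> (\<lambda>x. v x + w x) \<in> sine_span"
| scale: "v \<in> sine_span \<Longrightarrow> (\<lambda>x. c * v x) \<in> sine_span"

lemma continuous_sine_span: "v \<in> sine_span \<Longrightarrow> continuous_on A v"
  by (induction rule: sine_span.induct) (auto intro!: continuous_intros)

lemma sine_mode_cos:
  assumes "n i > 0"
  shows "cos (pi * x $ i) * sine_mode n x = (1 / 2) * (sine_mode (n(i := n i + 1)) x + sine_mode (n(i := n i - 1)) x)"
proof -
  define P where "P = (\<Prod>j\<in>UNIV - {i}. sin (pi * real (n j) * x $ j))"
  have P: "sine_mode (n(i := k)) x = sin (pi * real k * x $ i) * P" for k
    unfolding P_def sine_mode_def by (subst prod.remove[of _ i]) (auto intro!: prod.cong)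
  have a: "pi * real (n i + 1) * x $ i = pi * real (n i) * x $ i + pi * x $ i"
    "pi * real (n i - 1) * x $ i = pi * real (n i) * x $ i - pi * x $ i"
    using assms by (auto simp: of_nat_diff algebra_simps)
  have "sine_mode n x = sin (pi * real (n i) * x $ i) * P" using P[of "n i"] by simp
  then show ?thesis unfolding P a sin_add sin_diff by (simp add: algebra_simps)
qed

lemma sine_span_cos: "v \<in> sine_span \<Longrightarrow> (\<lambda>x. cos (pi * x $ i) * v x) \<in> sine_span"
proof (induction rule: sine_span.induct)
  case (mode n)
  show ?case
  \<comment> \<open>For mode number 0 the truncated subtraction n i - 1 would break the
    product-to-sum formula, but then the mode itself is zero.\<close>
  proof (cases "n i = 0")
    case True
    then have "sine_mode n x = 0" for x unfolding sine_mode_def by (intro prod_zero bexI[of _ i]) auto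
    then show ?thesis using sine_span.scale[OF sine_span.mode, of 0 n] by simp
  next
    case False
    then have "n i > 0" by simp
    show ?thesis unfolding sine_mode_cos[of n i, OF \<open>n i > 0\<close>]
      by (rule sine_span.scale[OF sine_span.add[OF sine_span.mode sine_span.mode]])
  qed
next
  case (add v w)
  then show ?case by (simp add: distrib_left sine_span.add)
next
  case (scale v c)
  then show ?case using sine_span.scale[of "\<lambda>x. cos (pi * x $ i) * v x" c] by (simp add: mult.left_commute)
qed

text \<open>
  The multipliers of \<open>sine_span\<close> form an algebra containing every \<open>cos (\<pi> x\<^sub>i)\<close>, so they are
  uniformly dense by Stone--Weierstrass; multiplying the positive ground state by an approximation
  of \<open>f\<close> shows \<open>\<integral> f\<^sup>2 h = 0\<close>.
\<close>

lemma sine_modes_complete: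
  fixes f :: "real ^ 'd \<Rightarrow> real"
  assumes f: "continuous_on (closure (cube 1)) f"
    and orth: "\<And>n. (LINT y:cube 1|lborel. f y * sine_mode n y) = 0" and y: "y \<in> cube 1"
  shows "f y = 0"
proof -
  let ?S = "closure (cube 1) :: (real ^ 'd) set"
  have int: "set_integrable lborel (cube 1) g" if "continuous_on ?S g" for g :: "real ^ 'd \<Rightarrow> real"
    using that by (rule set_integrable_continuous_closure[OF open_cube bounded_cube])
  have orth': "(LINT y:cube 1|lborel. f y * v y) = 0" if "v \<in> sine_span" for v
    using that
  proof induction
    case (add v w)
    have "(LINT y:cube 1|lborel. f y * (v y + w y)) = (LINT y:cube 1|lborel. f y * v y) + (LINT y:cube 1|lborel. f y * w y)"
      unfolding distrib_left by (rule set_integral_add) (intro int continuous_intros f continuous_sine_span add)+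
    then show ?case using add by simp
  next
    case (scale v c)
    have "(LINT y:cube 1|lborel. f y * (c * v y)) = c * (LINT y:cube 1|lborel. f y * v y)"
      by (subst set_integral_mult_right[symmetric]) (simp add: mult_ac)
    then show ?case using scale by simp
  qed (rule orth)
  define w where "w = (sine_mode (\<lambda>_. 1) :: real ^ 'd \<Rightarrow> real)"
  have w: "w \<in> sine_span" unfolding w_def by (rule sine_span.mode)
  have wpos: "w x > 0" if "x \<in> cube 1" for x
    using that unfolding w_def sine_mode_def by (auto simp: cube_def intro!: prod_pos sin_gt_zero)
  have wc: "continuous_on A w" for A by (rule continuous_sine_span[OF w])
  define M where "M = (LINT y:cube 1|lborel. \<bar>f y\<bar> * w y)"
  have M0: "M \<ge> 0" unfolding M_def set_lebesgue_integral_def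
    by (intro Bochner_Integration.integral_nonneg) (auto simp: indicator_def less_imp_le wpos)
  have le: "(LINT y:cube 1|lborel. f y * f y * w y) \<le> 0 + e" if "e > 0" for e
  proof -
    define e' where "e' = e / (M + 1)"
    have e': "e' > 0" using \<open>e > 0\<close> M0 by (simp add: e'_def)
    define P where "P g \<longleftrightarrow> continuous_on ?S g \<and> (\<forall>v\<in>sine_span. (\<lambda>x. g x * v x) \<in> sine_span)" for g
    have "\<exists>g. P g \<and> (\<forall>x\<in>?S. \<bar>f x - g x\<bar> < e')"
    proof (rule Stone_Weierstrass_HOL[OF compact_closure_cube _ _ _ _ _ f e'])
      show "P (\<lambda>x. c)" for c by (auto simp: P_def intro: sine_span.scale)
      show "P (\<lambda>x. g x + h x)" if "P g \<and> P h" for g h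
        using that unfolding P_def by (auto intro!: continuous_intros sine_span.add simp: distrib_right)
      show "P (\<lambda>x. g x * h x)" if "P g \<and> P h" for g h
        using that unfolding P_def by (auto intro!: continuous_intros simp: mult.assoc)
      show "\<exists>g. P g \<and> g x \<noteq> g y" if xy: "x \<in> ?S \<and> y \<in> ?S \<and> x \<noteq> y" for x y
      proof -
        \<comment> \<open>Cosine is injective on [0, pi], so the functions cos(pi x_i) separate the
          points of the closed cube.\<close>
        obtain i where i: "x $ i \<noteq> y $ i" using xy by (auto simp: vec_eq_iff)
        have "P (\<lambda>x. cos (pi * x $ i))" unfolding P_def by (auto intro!: continuous_intros sine_span_cos)
        moreover have "0 \<le> x $ i" "x $ i \<le> 1" "0 \<le> y $ i" "y $ i \<le> 1"
          using xy by (auto simp: mem_closure_cube)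
        then have "cos (pi * x $ i) \<noteq> cos (pi * y $ i)"
          using i cos_inj_pi[of "pi * x $ i" "pi * y $ i"] by (auto simp: mult_left_le)
        ultimately show ?thesis by blast
      qed
    qed (auto simp: P_def)
    then obtain g where g: "continuous_on ?S g" "\<And>v. v \<in> sine_span \<Longrightarrow> (\<lambda>x. g x * v x) \<in> sine_span"
      "\<And>x. x \<in> ?S \<Longrightarrow> \<bar>f x - g x\<bar> < e'" by (auto simp: P_def)
    have "(LINT y:cube 1|lborel. f y * f y * w y) - (LINT y:cube 1|lborel. f y * (g y * w y)) =
        (LINT y:cube 1|lborel. f y * f y * w y - f y * (g y * w y))"
      by (rule set_integral_diff(2)[symmetric]) (intro int continuous_intros f g wc)+
    also have "\<dots> \<le> (LINT y:cube 1|lborel. e' * (\<bar>f y\<bar> * w y))"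
    proof (rule set_integral_mono)
      fix x :: "real ^ 'd" assume x: "x \<in> cube 1"
      have "f x * (f x - g x) \<le> \<bar>f x\<bar> * \<bar>f x - g x\<bar>" by (metis abs_mult abs_ge_self)
      also have "\<dots> \<le> \<bar>f x\<bar> * e'" using g(3)[of x] x closure_subset by (intro mult_left_mono) fastforce+
      finally have "f x * (f x - g x) * w x \<le> \<bar>f x\<bar> * e' * w x" using wpos[OF x] by (intro mult_right_mono) auto
      then show "f x * f x * w x - f x * (g x * w x) \<le> e' * (\<bar>f x\<bar> * w x)" by (simp add: algebra_simps)
    qed (intro int continuous_intros f g wc)+
    also have "\<dots> = e' * M" unfolding M_def by simp
    also have "\<dots> \<le> e" using M0 \<open>e > 0\<close> by (simp add: e'_def field_simps)
    finally show ?thesis using orth'[OF g(2)[OF w]] by simp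
  qed
  have "(LINT y:cube 1|lborel. f y * f y * w y) \<le> 0" by (rule field_le_epsilon) (rule le)
  moreover have "continuous_on ?S (\<lambda>y. f y * f y * w y)" by (intro continuous_intros f wc)
  moreover have "f x * f x * w x \<ge> 0" if "x \<in> cube 1" for x using wpos[OF that] by (simp add: less_imp_le)
  ultimately have "f y * f y * w y = 0"
    using y by (intro set_integral_nonpos_imp_zero[OF open_cube, of 1 "\<lambda>y. f y * f y * w y"] int)
      (auto intro: continuous_on_subset[OF _ closure_subset])
  then show ?thesis using wpos[OF y] by simp
qed

section \<open>Scaling between the unit cube and the cube of side L\<close>

lemma lborel_scaleR:
  assumes "L > 0"
  shows "(lborel :: 'a::euclidean_space measure) = density (distr lborel borel (\<lambda>x. L *\<^sub>R x)) (\<lambda>_. ennreal (L ^ DIM('a)))"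
  using lborel_affine[of L "0::'a"] assms by simp

lemma scaleR_mem_cube: "L > 0 \<Longrightarrow> L *\<^sub>R x \<in> cube L \<longleftrightarrow> x \<in> cube 1"
  by (simp add: cube_def zero_less_mult_iff)

lemma scaleR_mem_closure_cube: "L > 0 \<Longrightarrow> L *\<^sub>R x \<in> closure (cube L) \<longleftrightarrow> x \<in> closure (cube 1)"
  by (simp add: mem_closure_cube zero_le_mult_iff)

lemma set_integral_cube_scale:
  fixes f :: "real ^ 'd \<Rightarrow> real"
  assumes L: "L > 0" and f: "set_integrable lborel (cube L) f"
  shows "(LINT y:cube L|lborel. f y) = (LINT y:cube 1|lborel. L ^ CARD('d) * f (L *\<^sub>R y))"
proof -
  have m[measurable]: "(\<lambda>y. indicator (cube L) y *\<^sub>R f y) \<in> borel_measurable borel"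
    using borel_measurable_integrable[OF f[unfolded set_integrable_def]] by simp
  then have m': "(\<lambda>y. L ^ CARD('d) *\<^sub>R (indicator (cube L) y *\<^sub>R f y)) \<in> borel_measurable borel"
    by (rule borel_measurable_const_scaleR)
  have "(LINT y:cube L|lborel. f y) = (\<integral>y. L ^ CARD('d) *\<^sub>R (indicator (cube L) y *\<^sub>R f y) \<partial>(distr lborel borel (\<lambda>x. L *\<^sub>R x)))"
    unfolding set_lebesgue_integral_def
    by (subst lborel_scaleR[OF L], subst integral_density) (use L m in auto)
  also have "\<dots> = (\<integral>y. L ^ CARD('d) *\<^sub>R (indicator (cube L) (L *\<^sub>R y) *\<^sub>R f (L *\<^sub>R y)) \<partial>lborel)"
    by (rule integral_distr[OF _ m']) measurable
  also have "\<dots> = (LINT y:cube 1|lborel. L ^ CARD('d) * f (L *\<^sub>R y))"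
    unfolding set_lebesgue_integral_def
    by (intro Bochner_Integration.integral_cong) (auto simp: indicator_def scaleR_mem_cube[OF L])
  finally show ?thesis .
qed

text \<open>For fixed x both sides are continuous in y and have the same integral against every sine
  mode, so completeness makes them equal. Time scales with L^2 and the density with L^d.\<close>

lemma dirichlet_kernel_eq_cube_kernel:
  fixes q :: "real \<Rightarrow> real ^ 'd \<Rightarrow> real ^ 'd \<Rightarrow> real"
  assumes L: "L > 0" and q: "dirichlet_heat_kernel (cube L) q" and t: "t > 0"
    and x: "x \<in> closure (cube 1)" and y: "y \<in> cube 1"
  shows "L ^ CARD('d) * q t (L *\<^sub>R x) (L *\<^sub>R y) = cube_kernel (t / L\<^sup>2) x y"
proof -
  have t': "t / L\<^sup>2 > 0" using t L by simp
  have x': "L *\<^sub>R x \<in> closure (cube L)" using x L by (simp add: scaleR_mem_closure_cube)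
  have qc: "continuous_on (closure (cube L)) (q t (L *\<^sub>R x))"
    using q t x' unfolding dirichlet_heat_kernel_def by (blast intro: continuous_on_section)
  have qc': "continuous_on (closure (cube 1)) (\<lambda>y. q t (L *\<^sub>R x) (L *\<^sub>R y))"
  proof (rule continuous_on_compose2[OF qc])
    show "continuous_on (closure (cube 1)) (\<lambda>y. L *\<^sub>R y)" by (intro continuous_intros)
    show "(\<lambda>y. L *\<^sub>R y) ` closure (cube 1) \<subseteq> closure (cube L)" using scaleR_mem_closure_cube[OF L] by blast
  qed
  have "L ^ CARD('d) * q t (L *\<^sub>R x) (L *\<^sub>R y) - cube_kernel (t / L\<^sup>2) x y = 0"
  proof (rule sine_modes_complete[OF _ _ y])
    show "continuous_on (closure (cube 1)) (\<lambda>y. L ^ CARD('d) * q t (L *\<^sub>R x) (L *\<^sub>R y) - cube_kernel (t / L\<^sup>2) x y)"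
      by (intro continuous_intros qc' continuous_cube_kernel_section t')
    fix n :: "'d \<Rightarrow> nat"
    have "(LINT y:cube 1|lborel. (L ^ CARD('d) * q t (L *\<^sub>R x) (L *\<^sub>R y) - cube_kernel (t / L\<^sup>2) x y) * sine_mode n y)
      = (LINT y:cube 1|lborel. L ^ CARD('d) * (q t (L *\<^sub>R x) (L *\<^sub>R y) * sine_mode n ((1 / L) *\<^sub>R (L *\<^sub>R y))) - cube_kernel (t / L\<^sup>2) x y * sine_mode n y)"
      using L by (simp add: algebra_simps)
    also have "\<dots> = (LINT y:cube 1|lborel. L ^ CARD('d) * (q t (L *\<^sub>R x) (L *\<^sub>R y) * sine_mode n ((1 / L) *\<^sub>R (L *\<^sub>R y))))
       - (LINT y:cube 1|lborel. cube_kernel (t / L\<^sup>2) x y * sine_mode n y)"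
      using L by (intro set_integral_diff set_integrable_continuous_closure[OF open_cube bounded_cube])
       (simp_all add: continuous_on_mult continuous_intros qc' continuous_cube_kernel_section[OF t'])
    also have "(LINT y:cube 1|lborel. L ^ CARD('d) * (q t (L *\<^sub>R x) (L *\<^sub>R y) * sine_mode n ((1 / L) *\<^sub>R (L *\<^sub>R y))))
       = (LINT y:cube L|lborel. q t (L *\<^sub>R x) y * sine_mode n ((1 / L) *\<^sub>R y))"
      by (rule set_integral_cube_scale[OF L, symmetric])
        (use L in \<open>auto intro!: set_integrable_continuous_closure[OF open_cube bounded_cube] continuous_intros qc
          simp: sine_mode_def\<close>)
    also have "\<dots> = exp (- ((pi / L)\<^sup>2 * (\<Sum>i\<in>UNIV. (real (n i))\<^sup>2) * t)) * sine_mode n x"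
      using dirichlet_kernel_coeff[OF L q t x'] L by simp
    also have "(LINT y:cube 1|lborel. cube_kernel (t / L\<^sup>2) x y * sine_mode n y)
      = exp (- (pi\<^sup>2 * (\<Sum>i\<in>UNIV. (real (n i))\<^sup>2) * (t / L\<^sup>2))) * sine_mode n x"
      by (rule cube_kernel_coeff[OF t'])
    finally show "(LINT y:cube 1|lborel. (L ^ CARD('d) * q t (L *\<^sub>R x) (L *\<^sub>R y) - cube_kernel (t / L\<^sup>2) x y) * sine_mode n y) = 0"
      by (simp add: power_divide)
  qed
  then show ?thesis by simp
qed

section \<open>The Borel sets of path spaces\<close>

lemma space_borel_of[simp]: "space (borel_of X) = topspace X"
  unfolding borel_of_def by (rule space_measure_of) (auto dest: openin_subset)

lemma sets_borel_of: "sets (borel_of X) = sigma_sets (topspace X) {U. openin X U}"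
  unfolding borel_of_def by (rule sets_measure_of) (auto dest: openin_subset)

lemma openin_sets_borel_of: "openin X U \<Longrightarrow> U \<in> sets (borel_of X)"
  by (auto simp: sets_borel_of)

lemma continuous_map_borel_of:
  assumes "continuous_map X Y f" shows "f \<in> borel_of X \<rightarrow>\<^sub>M borel_of Y"
proof (rule measurable_sigma_sets[OF sets_borel_of])
  show "{U. openin Y U} \<subseteq> Pow (topspace Y)" by (auto dest: openin_subset)
  show "f \<in> space (borel_of X) \<rightarrow> topspace Y" using assms by (auto simp: continuous_map_def)
  fix U assume "U \<in> {U. openin Y U}"
  then have "openin X {x \<in> topspace X. f x \<in> U}" using assms by (auto simp: continuous_map_def)
  then show "f -` U \<inter> space (borel_of X) \<in> sets (borel_of X)"
    by (auto simp: vimage_def Int_def conj_commute intro!: openin_sets_borel_of)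
qed

lemma continuous_map_borel_measurable:
  assumes "continuous_map X euclidean f" shows "f \<in> borel_of X \<rightarrow>\<^sub>M borel"
proof (rule borel_measurableI)
  fix U :: "'b set" assume "open U"
  then have "openin X {x \<in> topspace X. f x \<in> U}"
    using assms by (auto simp: continuous_map_def)
  then show "f -` U \<inter> space (borel_of X) \<in> sets (borel_of X)"
    by (auto simp: vimage_def Int_def conj_commute intro!: openin_sets_borel_of)
qed

lemma openin_clocI:
  assumes "U \<subseteq> paths I S"
    and "\<And>\<omega>. \<omega> \<in> U \<Longrightarrow> \<exists>K e. compact K \<and> K \<subseteq> I \<and> e > 0 \<and> {\<eta> \<in> paths I S. \<forall>t\<in>K. dist (\<eta> t) (\<omega> t) < e} \<subseteq> U"
  shows "openin (cloc I S) U"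
  using assms unfolding openin_cloc cloc_open_def by auto

lemma continuous_map_eval:
  assumes t: "t \<in> I" shows "continuous_map (cloc I S) euclidean (\<lambda>\<omega>. \<omega> t)"
  unfolding continuous_map_def topspace_cloc
proof (intro conjI allI impI)
  fix U :: "'a set" assume U: "openin euclidean U"
  show "openin (cloc I S) {\<omega> \<in> paths I S. \<omega> t \<in> U}"
  proof (rule openin_clocI)
    fix \<omega> assume "\<omega> \<in> {\<omega> \<in> paths I S. \<omega> t \<in> U}"
    then obtain e where "e > 0" "\<And>y. dist y (\<omega> t) < e \<Longrightarrow> y \<in> U"
      using U by (auto simp: open_dist)
    then show "\<exists>K e. compact K \<and> K \<subseteq> I \<and> e > 0 \<and>
        {\<eta> \<in> paths I S. \<forall>s\<in>K. dist (\<eta> s) (\<omega> s) < e} \<subseteq> {\<omega> \<in> paths I S. \<omega> t \<in> U}"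
      using t by (intro exI[of _ "{t}"] exI[of _ e]) auto
  qed auto
qed auto

lemma measurable_eval:
  "t \<in> I \<Longrightarrow> (\<lambda>\<omega>. \<omega> t) \<in> borel_of (subtopology (cloc I S) W) \<rightarrow>\<^sub>M borel"
  by (intro continuous_map_borel_measurable continuous_map_from_subtopology continuous_map_eval)

text \<open>
  Every open set of paths is a countable union of sets prescribing closed rational balls for the
  values at the times of a countable dense set in finitely many rational intervals.
\<close>

lemma sets_borel_of_cloc:
  fixes S :: "'a::euclidean_space set" and W :: "(real \<Rightarrow> 'a) set"
  assumes D: "D \<subseteq> I" "I \<subseteq> closure D"
  defines "X \<equiv> subtopology (cloc I S) W"
  shows "sets (borel_of X) = sets (vimage_algebra (topspace X) (\<lambda>\<omega>. restrict \<omega> D) (\<Pi>\<^sub>M t\<in>D. borel))"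
    (is "_ = sets ?V")
proof
  have X: "topspace X = paths I S \<inter> W" by (simp add: X_def topspace_cloc)
  have "(\<lambda>\<omega>. restrict \<omega> D) \<in> borel_of X \<rightarrow>\<^sub>M (\<Pi>\<^sub>M t\<in>D. borel)"
    unfolding X_def using D by (intro measurable_restrict measurable_eval) auto
  from sets_image_in_sets[OF _ this, of "topspace X"]
  show "sets ?V \<subseteq> sets (borel_of X)" by simp
  have ev: "(\<lambda>\<omega>. \<omega> t) \<in> ?V \<rightarrow>\<^sub>M borel" if "t \<in> D" for t
  proof -
    have "(\<lambda>\<omega>. restrict \<omega> D) \<in> ?V \<rightarrow>\<^sub>M (\<Pi>\<^sub>M t\<in>D. borel)"
      by (rule measurable_vimage_algebra1) (auto simp: space_PiM)
    from measurable_compose[OF this measurable_component_singleton[OF that]] show ?thesis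
      using that by simp
  qed
  obtain D0 where D0: "countable D0" "D0 \<subseteq> D" "D \<subseteq> closure D0" using separable[of D] by blast
  have ID0: "I \<subseteq> closure D0" using D(2) closure_minimal[OF D0(3) closed_closure] by (rule order_trans)
  obtain C :: "'a set" where C: "countable C" "\<And>U. open U \<Longrightarrow> U \<noteq> {} \<Longrightarrow> \<exists>c\<in>C. c \<in> U"
    by (rule countable_dense_setE) blast
  define Box where "Box F n = {\<eta> \<in> topspace X. \<forall>(a, b, c)\<in>F. \<forall>t\<in>D0. a < t \<and> t < b \<longrightarrow> dist (\<eta> t) c \<le> 1 / real (Suc n)}"
    for F :: "(real \<times> real \<times> 'a) set" and n
  have Box: "Box F n \<in> sets ?V" if "finite F" for F n
  proof -
    have "Box F n = {\<eta> \<in> space ?V. \<forall>p\<in>F. \<forall>t\<in>D0. fst p < t \<and> t < fst (snd p) \<longrightarrow> dist (\<eta> t) (snd (snd p)) \<le> 1 / real (Suc n)}"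
      by (auto simp: Box_def case_prod_beta)
    also have "\<dots> \<in> sets ?V"
    proof (intro sets.sets_Collect_countable_All' countable_finite[OF that] D0(1))
      fix p :: "real \<times> real \<times> 'a" and t assume t: "t \<in> D0"
      then have [measurable]: "(\<lambda>\<omega>. \<omega> t) \<in> ?V \<rightarrow>\<^sub>M borel" using ev D0(2) by auto
      show "{\<eta> \<in> space ?V. fst p < t \<and> t < fst (snd p) \<longrightarrow> dist (\<eta> t) (snd (snd p)) \<le> 1 / real (Suc n)} \<in> sets ?V"
        by measurable
    qed
    finally show ?thesis .
  qed
  define QF :: "(real \<times> real \<times> 'a) set set" where "QF = {F. finite F \<and> F \<subseteq> (\<rat> \<times> \<rat> \<times> C)}"
  have QF: "countable QF" unfolding QF_def
    by (intro countable_Collect_finite_subset countable_SIGMA countable_rat C)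
  have "U \<in> sets ?V" if U: "openin X U" for U
  proof -
    obtain U' where U': "cloc_open I S U'" "U = U' \<inter> W"
      using U unfolding X_def openin_subtopology openin_cloc by blast
    have "U = (\<Union>p\<in>{p\<in>QF \<times> (UNIV :: nat set). Box (fst p) (snd p) \<subseteq> U}. Box (fst p) (snd p))"
    proof (intro equalityI subsetI)
      fix \<gamma> assume g: "\<gamma> \<in> U"
      then obtain K e where K: "compact K" "K \<subseteq> I" "e > 0"
        and sub: "{\<eta> \<in> paths I S. \<forall>t\<in>K. dist (\<eta> t) (\<gamma> t) < e} \<subseteq> U'"
        using U' unfolding cloc_open_def by blast
      have gp: "\<gamma> \<in> paths I S" "\<gamma> \<in> W" using g U' unfolding cloc_open_def by auto
      then have gc: "continuous_on I \<gamma>" by (simp add: paths_def)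
      \<comment> \<open>Two paths in the same box are both within r of a common centre, hence the
        requirement 2 r < e.\<close>
      obtain n where n: "1 / real (Suc n) < e / 2" using nat_approx_posE[of "e/2"] K(3) by auto
      define r where "r = 1 / real (Suc n)"
      have r: "r > 0" "2 * r < e" using n by (auto simp: r_def)
      have "\<exists>a b c. a \<in> \<rat> \<and> b \<in> \<rat> \<and> c \<in> C \<and> a < t \<and> t < b \<and> (\<forall>s\<in>I. a < s \<and> s < b \<longrightarrow> dist (\<gamma> s) c \<le> r)"
        if t: "t \<in> K" for t
      proof -
        obtain d where d: "d > 0" "\<And>s. s \<in> I \<Longrightarrow> dist s t < d \<Longrightarrow> dist (\<gamma> s) (\<gamma> t) < r / 2"
          using gc[unfolded continuous_on_iff] t K(2) r by (meson half_gt_zero subsetD)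
        obtain c where c: "c \<in> C" "c \<in> ball (\<gamma> t) (r/2)"
          using C(2)[of "ball (\<gamma> t) (r/2)"] r by auto
        obtain a where a: "a \<in> \<rat>" "t - d < a" "a < t" using Rats_dense_in_real[of "t - d" t] d by auto
        obtain b where b: "b \<in> \<rat>" "t < b" "b < t + d" using Rats_dense_in_real[of t "t + d"] d by auto
        have "dist (\<gamma> s) c \<le> r" if "s \<in> I" "a < s" "s < b" for s
        proof -
          have "dist (\<gamma> s) (\<gamma> t) < r / 2" using that a b by (intro d(2)) (auto simp: dist_real_def)
          then show ?thesis using c(2) dist_triangle[of "\<gamma> s" c "\<gamma> t"] by simp
        qed
        then show ?thesis using a b c by blast
      qed
      then obtain a b c where abc: "\<And>t. t \<in> K \<Longrightarrow> a t \<in> \<rat> \<and> b t \<in> \<rat> \<and> c t \<in> C \<and> a t < t \<and> t < b t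
          \<and> (\<forall>s\<in>I. a t < s \<and> s < b t \<longrightarrow> dist (\<gamma> s) (c t) \<le> r)" by metis
      obtain K' where K': "K' \<subseteq> K" "finite K'" "K \<subseteq> (\<Union>t\<in>K'. {a t<..<b t})"
      proof (rule compactE_image[OF K(1), of K "\<lambda>t. {a t<..<b t}"])
        show "K \<subseteq> (\<Union>t\<in>K. {a t<..<b t})" using abc by auto
      qed auto
      define F where "F = (\<lambda>t. (a t, b t, c t)) ` K'"
      have F: "F \<in> QF" using K' abc unfolding F_def QF_def by auto
      have gB: "\<gamma> \<in> Box F n"
        unfolding Box_def F_def X r_def[symmetric]
      proof (intro CollectI conjI ballI IntI gp)
        fix p assume "p \<in> (\<lambda>t. (a t, b t, c t)) ` K'"
        then obtain t where t: "t \<in> K'" "p = (a t, b t, c t)" by blast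
        then have "\<forall>s\<in>I. a t < s \<and> s < b t \<longrightarrow> dist (\<gamma> s) (c t) \<le> r" using abc K'(1) by blast
        then show "case p of (a, b, c) \<Rightarrow> \<forall>t\<in>D0. a < t \<and> t < b \<longrightarrow> dist (\<gamma> t) c \<le> r"
          using D0(2) D(1) unfolding t(2) by blast
      qed
      have "Box F n \<subseteq> U"
      proof
        fix \<eta> assume h: "\<eta> \<in> Box F n"
        then have hp: "\<eta> \<in> paths I S" "\<eta> \<in> W" by (auto simp: Box_def X)
        then have hc: "continuous_on I \<eta>" by (simp add: paths_def)
        have "dist (\<eta> s) (\<gamma> s) < e" if s: "s \<in> K" for s
        proof -
          obtain t where t: "t \<in> K'" "a t < s" "s < b t" using K'(3) s by auto
          have sI: "s \<in> I" using s K(2) by auto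
          \<comment> \<open>The box constrains \<eta> only at times in \<open>D0\<close>. A
            violation at s would persist, by continuity, at nearby times, and some of these lie in
            \<open>D0\<close>.\<close>
          have "dist (\<eta> s) (c t) \<le> r"
          proof (rule ccontr)
            assume "\<not> dist (\<eta> s) (c t) \<le> r"
            then have pos: "dist (\<eta> s) (c t) - r > 0" by simp
            obtain d where d: "d > 0" "\<And>s'. s' \<in> I \<Longrightarrow> dist s' s < d \<Longrightarrow> dist (\<eta> s') (\<eta> s) < dist (\<eta> s) (c t) - r"
              using hc[unfolded continuous_on_iff] sI pos by meson
            define d' where "d' = min d (min (s - a t) (b t - s))"
            have "d' > 0" using d t by (simp add: d'_def)
            then obtain s' where s': "s' \<in> D0" "dist s' s < d'"
              using ID0 sI closure_approachable[of s D0] by blast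
            then have ab: "a t < s'" "s' < b t" by (auto simp: d'_def dist_real_def)
            have "dist (\<eta> s') (c t) \<le> r" using h t(1) s'(1) ab unfolding Box_def F_def r_def by auto
            moreover have "dist (\<eta> s') (\<eta> s) < dist (\<eta> s) (c t) - r"
              using s' D0(2) D(1) by (intro d(2)) (auto simp: d'_def)
            ultimately show False using dist_triangle[of "\<eta> s" "c t" "\<eta> s'"] by (simp add: dist_commute)
          qed
          moreover have "dist (\<gamma> s) (c t) \<le> r" using abc K'(1) t sI by auto
          ultimately show ?thesis using r(2) dist_triangle2[of "\<eta> s" "\<gamma> s" "c t"] by simp
        qed
        then show "\<eta> \<in> U" using sub hp U' by auto
      qed
      then show "\<gamma> \<in> (\<Union>p\<in>{p\<in>QF \<times> (UNIV :: nat set). Box (fst p) (snd p) \<subseteq> U}. Box (fst p) (snd p))"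
        using gB F by force
    qed auto
    also have "\<dots> \<in> sets ?V"
    proof (rule sets.countable_UN')
      show "countable {p \<in> QF \<times> (UNIV :: nat set). Box (fst p) (snd p) \<subseteq> U}"
        by (rule countable_subset[of _ "QF \<times> UNIV"]) (auto intro: QF)
    qed (auto intro!: Box simp: QF_def)
    finally show ?thesis .
  qed
  then show "sets (borel_of X) \<subseteq> sets ?V"
    unfolding sets_borel_of using sets.sigma_sets_subset[of "{U. openin X U}" ?V] by auto
qed

lemma measurable_into_paths:
  fixes S :: "'a::euclidean_space set"
  assumes D: "D \<subseteq> I" "I \<subseteq> closure D"
    and sp: "\<And>x. x \<in> space M \<Longrightarrow> f x \<in> topspace (subtopology (cloc I S) W)"
    and co: "\<And>t. t \<in> D \<Longrightarrow> (\<lambda>x. f x t) \<in> M \<rightarrow>\<^sub>M borel"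
  shows "f \<in> M \<rightarrow>\<^sub>M borel_of (subtopology (cloc I S) W)"
proof -
  let ?X = "subtopology (cloc I S) W"
  have "f \<in> M \<rightarrow>\<^sub>M vimage_algebra (topspace ?X) (\<lambda>\<omega>. restrict \<omega> D) (\<Pi>\<^sub>M t\<in>D. borel)"
  proof (rule measurable_vimage_algebra2)
    show "f \<in> space M \<rightarrow> topspace ?X" using sp by auto
    show "(\<lambda>x. restrict (f x) D) \<in> M \<rightarrow>\<^sub>M (\<Pi>\<^sub>M t\<in>D. borel)"
      using co by (rule measurable_restrict)
  qed
  then show ?thesis
    using measurable_cong_sets[OF refl sets_borel_of_cloc[OF D, of S W]] by blast
qed

lemma XD_eq: "XD = subtopology (cloc UNIV (closure (cube 1))) UNIV"
  by (simp add: XD_def)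

lemma topspace_XD: "topspace (XD :: (real \<Rightarrow> real ^ 'd) topology) = {\<gamma>. continuous_on UNIV \<gamma> \<and> range \<gamma> \<subseteq> closure (cube 1)}"
  by (auto simp: XD_def topspace_cloc paths_def extensional_def)

lemma measurable_XD_eval: "(\<lambda>\<gamma>. \<gamma> t) \<in> borel_of (XD :: (real \<Rightarrow> real ^ 'd) topology) \<rightarrow>\<^sub>M borel"
  unfolding XD_eq by (rule measurable_eval) simp

lemma measurable_into_XD:
  fixes f :: "'a \<Rightarrow> real \<Rightarrow> real ^ 'd"
  assumes "\<And>x. x \<in> space M \<Longrightarrow> f x \<in> topspace XD" and "\<And>t. (\<lambda>x. f x t) \<in> M \<rightarrow>\<^sub>M borel"
  shows "f \<in> M \<rightarrow>\<^sub>M borel_of XD"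
  unfolding XD_eq
proof (rule measurable_into_paths[where D = UNIV])
  show "f x \<in> topspace (subtopology (cloc UNIV (closure (cube 1))) UNIV)" if "x \<in> space M" for x
    using assms(1)[OF that] by (simp add: XD_def)
qed (auto intro: assms)

section \<open>Paths seen through a window\<close>

definition time_clamp :: "real \<Rightarrow> real \<Rightarrow> real" where "time_clamp m t = max (- m) (min m t)"

text \<open>Freezing a path outside the window keeps it in \<open>XD\<close>. A functional of the
  window is thus a functional h on \<open>XD\<close> with
  \<open>h (stopped m \<gamma>) = h \<gamma>\<close>, and its measurability refers to the same Borel
  sets.\<close>

definition stopped :: "real \<Rightarrow> (real \<Rightarrow> 'a) \<Rightarrow> (real \<Rightarrow> 'a)" where
  "stopped m \<gamma> = (\<lambda>t. \<gamma> (time_clamp m t))"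

lemma time_clamp_mem: "m \<ge> 0 \<Longrightarrow> time_clamp m t \<in> {-m..m}"
  by (auto simp: time_clamp_def)

lemma time_clamp_id: "t \<in> {-m..m} \<Longrightarrow> time_clamp m t = t"
  by (auto simp: time_clamp_def)

lemma continuous_time_clamp: "continuous_on A (time_clamp m)"
  unfolding time_clamp_def by (intro continuous_intros)

lemma stopped_XD: "\<gamma> \<in> topspace XD \<Longrightarrow> stopped m \<gamma> \<in> topspace XD"
  unfolding topspace_XD stopped_def
  by (auto simp: image_subset_iff intro!: continuous_on_compose2[OF _ continuous_time_clamp, where t = UNIV])

lemma measurable_stopped: "stopped m \<in> borel_of (XD :: (real \<Rightarrow> real ^ 'd) topology) \<rightarrow>\<^sub>M borel_of XD"
proof (rule measurable_into_XD)
  show "(\<lambda>\<gamma>. stopped m \<gamma> t) \<in> borel_of (XD :: (real \<Rightarrow> real ^ 'd) topology) \<rightarrow>\<^sub>M borel" for t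
    unfolding stopped_def by (rule measurable_XD_eval)
qed (simp add: stopped_XD)

lemma shift_XD: "\<gamma> \<in> topspace XD \<Longrightarrow> shift u \<gamma> \<in> topspace XD"
  unfolding topspace_XD shift_def
  by (auto simp: image_subset_iff intro!: continuous_on_compose2[where t = UNIV and f = "\<lambda>t. u + t"] continuous_intros)

lemma sets_XD_stopped:
  fixes A :: "(real \<Rightarrow> real ^ 'd) set"
  assumes A: "A \<in> sets (borel_of XD)" and m: "m \<ge> 0"
  obtains A' where "A' \<in> sets (\<Pi>\<^sub>M t\<in>{-m..m}. (borel :: (real ^ 'd) measure))"
    "\<And>\<gamma>. \<gamma> \<in> topspace XD \<Longrightarrow> stopped m \<gamma> \<in> A \<longleftrightarrow> restrict \<gamma> {-m..m} \<in> A'"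
proof -
  have "A \<in> sets (vimage_algebra (topspace XD) (\<lambda>\<omega>. restrict \<omega> UNIV) (\<Pi>\<^sub>M t\<in>UNIV. (borel :: (real ^ 'd) measure)))"
    using A sets_borel_of_cloc[of UNIV UNIV "closure (cube 1) :: (real ^ 'd) set" UNIV] by (simp add: XD_eq)
  then obtain B where B: "B \<in> sets (\<Pi>\<^sub>M t\<in>UNIV. (borel :: (real ^ 'd) measure))" "A = B \<inter> topspace XD"
    by (subst (asm) sets_vimage_algebra2) (auto simp: space_PiM restrict_UNIV)
  let ?f = "\<lambda>x :: real \<Rightarrow> real ^ 'd. \<lambda>t\<in>UNIV. x (time_clamp m t)"
  have f: "?f \<in> (\<Pi>\<^sub>M t\<in>{-m..m}. borel) \<rightarrow>\<^sub>M (\<Pi>\<^sub>M t\<in>UNIV. borel)"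
    by (intro measurable_restrict measurable_component_singleton time_clamp_mem m)
  show thesis
  proof
    show "?f -` B \<inter> space (\<Pi>\<^sub>M t\<in>{-m..m}. borel) \<in> sets (\<Pi>\<^sub>M t\<in>{-m..m}. (borel :: (real ^ 'd) measure))"
      using f B(1) by (rule measurable_sets)
    fix \<gamma> :: "real \<Rightarrow> real ^ 'd" assume g: "\<gamma> \<in> topspace XD"
    have "?f (restrict \<gamma> {-m..m}) = stopped m \<gamma>"
      using time_clamp_mem[OF m] by (auto simp: stopped_def)
    then show "stopped m \<gamma> \<in> A \<longleftrightarrow> restrict \<gamma> {-m..m} \<in> ?f -` B \<inter> space (\<Pi>\<^sub>M t\<in>{-m..m}. borel)"
      using stopped_XD[OF g, of m] B(2) by (auto simp: space_PiM)
  qed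
qed

section \<open>Nested integrals along a chain of kernels\<close>

text \<open>The iterated integral of k 0 x y1, k 1 y1 y2, ..., k (n-1) y(n-1) yn and f yn over y1,
  ..., yn. The recursion peels off the last kernel, so the indices of the remaining ones do not
  shift.\<close>

primrec bwd :: "(nat \<Rightarrow> 'a::euclidean_space \<Rightarrow> 'a \<Rightarrow> ennreal) \<Rightarrow> nat \<Rightarrow> ('a \<Rightarrow> ennreal) \<Rightarrow> 'a \<Rightarrow> ennreal" where
  "bwd k 0 f = f"
| "bwd k (Suc n) f = bwd k n (\<lambda>x. \<integral>\<^sup>+y. k n x y * f y \<partial>lborel)"

text \<open>The parameter w stands for the starting point or the root, on which the terminal
  function depends when the chain closes up to a loop.\<close>

lemma measurable_bwd_pair:
  assumes k: "\<And>i. (\<lambda>(x, y). k i x y) \<in> borel_measurable (borel \<Otimes>\<^sub>M borel)"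
    and f: "(\<lambda>(w, x). f w x) \<in> borel_measurable (N \<Otimes>\<^sub>M borel)"
  shows "(\<lambda>(w, x). bwd k n (f w) x) \<in> borel_measurable (N \<Otimes>\<^sub>M borel)"
  using f
proof (induction n arbitrary: f)
  case (Suc n)
  note [measurable] = k Suc.prems
  have "(\<lambda>(w, x). \<integral>\<^sup>+y. k n x y * f w y \<partial>lborel) \<in> borel_measurable (N \<Otimes>\<^sub>M borel)"
    by measurable
  from Suc.IH[OF this] show ?case by simp
qed simp

lemma measurable_bwd:
  assumes "\<And>i. (\<lambda>(x, y). k i x y) \<in> borel_measurable (borel \<Otimes>\<^sub>M borel)" "f \<in> borel_measurable borel"
  shows "bwd k n f \<in> borel_measurable borel"
proof -
  have "(\<lambda>(w::unit, x). f x) \<in> borel_measurable (count_space UNIV \<Otimes>\<^sub>M borel)"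
    using assms(2) by measurable
  from measurable_bwd_pair[where n = n, OF assms(1) this]
  have "(\<lambda>(w::unit, x). bwd k n f x) \<in> borel_measurable (count_space UNIV \<Otimes>\<^sub>M borel)" .
  from measurable_compose[OF _ this, of "\<lambda>x. ((), x)" borel] show ?thesis by simp
qed

lemma bwd_cmult:
  assumes k: "\<And>i. (\<lambda>(x, y). k i x y) \<in> borel_measurable (borel \<Otimes>\<^sub>M borel)" and f: "f \<in> borel_measurable borel"
  shows "bwd k n (\<lambda>x. c * f x) x = c * bwd k n f x"
  using f
proof (induction n arbitrary: f)
  case (Suc n)
  note [measurable] = k Suc.prems
  have "(\<integral>\<^sup>+y. k n x y * (c * f y) \<partial>lborel) = c * (\<integral>\<^sup>+y. k n x y * f y \<partial>lborel)" for x
    by (subst nn_integral_cmult[symmetric]) (auto simp: mult_ac)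
  moreover have "(\<lambda>x. \<integral>\<^sup>+y. k n x y * f y \<partial>lborel) \<in> borel_measurable borel" by measurable
  ultimately show ?case using Suc.IH by simp
qed simp

text \<open>Tonelli along the whole chain; it carries the integral over the root inside to the
  closing kernels.\<close>

lemma bwd_nn_integral:
  assumes k: "\<And>i. (\<lambda>(x, y). k i x y) \<in> borel_measurable (borel \<Otimes>\<^sub>M borel)"
    and f: "(\<lambda>(a, y). f a y) \<in> borel_measurable (borel \<Otimes>\<^sub>M borel)"
  shows "(\<integral>\<^sup>+a. bwd k n (f a) x \<partial>lborel) = bwd k n (\<lambda>y. \<integral>\<^sup>+a. f a y \<partial>lborel) (x :: 'a::euclidean_space)"
  using f
proof (induction n arbitrary: f)
  case (Suc n)
  note [measurable] = k Suc.prems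
  have "(\<lambda>(a, x). \<integral>\<^sup>+y. k n x y * f a y \<partial>lborel) \<in> borel_measurable (borel \<Otimes>\<^sub>M borel)"
    by measurable
  from Suc.IH[OF this]
  have "(\<integral>\<^sup>+a. bwd k (Suc n) (f a) x \<partial>lborel) = bwd k n (\<lambda>x. \<integral>\<^sup>+a. \<integral>\<^sup>+y. k n x y * f a y \<partial>lborel \<partial>lborel) x"
    by simp
  also have "(\<lambda>x. \<integral>\<^sup>+a. \<integral>\<^sup>+y. k n x y * f a y \<partial>lborel \<partial>lborel) = (\<lambda>x. \<integral>\<^sup>+y. k n x y * (\<integral>\<^sup>+a. f a y \<partial>lborel) \<partial>lborel)"
    by (rule ext, subst lborel_pair.Fubini') (auto intro!: nn_integral_cong nn_integral_cmult)
  finally show ?case by simp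
qed simp

lemma bwd_append: "bwd k (n + m) f = bwd k n (bwd (\<lambda>i. k (n + i)) m f)"
  by (induction m arbitrary: f) auto

lemma bwd_cong:
  assumes "\<And>i x y. i < n \<Longrightarrow> k i x y = k' i x y" "\<And>x. f x = f' x"
  shows "bwd k n f = bwd k' n f'"
proof -
  have "f = f'" using assms(2) by auto
  then show ?thesis using assms(1) by (induction n arbitrary: f f') auto
qed

lemma nn_integral_scaleR:
  fixes f :: "'a::euclidean_space \<Rightarrow> ennreal"
  assumes L: "L > 0" and f[measurable]: "f \<in> borel_measurable borel"
  shows "(\<integral>\<^sup>+y. f y \<partial>lborel) = (\<integral>\<^sup>+y. ennreal (L ^ DIM('a)) * f (L *\<^sub>R y) \<partial>lborel)"
proof -
  have "(\<integral>\<^sup>+y. f y \<partial>lborel) = (\<integral>\<^sup>+y. ennreal (L ^ DIM('a)) * f y \<partial>distr lborel borel (\<lambda>x. L *\<^sub>R x))"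
    by (subst lborel_scaleR[OF L], subst nn_integral_density) auto
  also have "\<dots> = (\<integral>\<^sup>+y. ennreal (L ^ DIM('a)) * f (L *\<^sub>R y) \<partial>lborel)"
    by (subst nn_integral_distr) auto
  finally show ?thesis .
qed

text \<open>Each integration along the chain produces one Jacobian L^d, and \<open>kk\<close> says
  that the rescaled kernel absorbs exactly one.\<close>

lemma bwd_scaleR:
  fixes f :: "'a::euclidean_space \<Rightarrow> ennreal"
  assumes L: "L > 0" and k: "\<And>i. (\<lambda>(x, y). k i x y) \<in> borel_measurable (borel \<Otimes>\<^sub>M borel)"
    and f: "f \<in> borel_measurable borel"
    and kk: "\<And>i x y. ennreal (L ^ DIM('a)) * k i (L *\<^sub>R x) (L *\<^sub>R y) = k' i x y"
  shows "bwd k n f (L *\<^sub>R x) = bwd k' n (\<lambda>x. f (L *\<^sub>R x)) x"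
  using f
proof (induction n arbitrary: f)
  case (Suc n)
  note [measurable] = k Suc.prems
  have "(\<lambda>x. \<integral>\<^sup>+y. k n x y * f y \<partial>lborel) \<in> borel_measurable borel" by measurable
  from Suc.IH[OF this] have "bwd k (Suc n) f (L *\<^sub>R x) =
      bwd k' n (\<lambda>x. \<integral>\<^sup>+y. k n (L *\<^sub>R x) y * f y \<partial>lborel) x" by simp
  also have "(\<lambda>x. \<integral>\<^sup>+y. k n (L *\<^sub>R x) y * f y \<partial>lborel) = (\<lambda>x. \<integral>\<^sup>+y. k' n x y * f (L *\<^sub>R y) \<partial>lborel)"
    by (rule ext, subst nn_integral_scaleR[OF L]) (auto simp: kk[symmetric] mult_ac)
  finally show ?case by simp
qed simp

text \<open>The bridge and tab marginals are densities on a product space; this is their passage to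
  nested integrals. The function f sees both ends of the chain, as the kernel that closes a loop
  does.\<close>

lemma nn_integral_PiM_chain:
  fixes c :: "'a::euclidean_space \<Rightarrow> ennreal" and f :: "'a \<Rightarrow> 'a \<Rightarrow> ennreal"
  assumes c: "c \<in> borel_measurable borel"
    and k: "\<And>i. (\<lambda>(x, y). k i x y) \<in> borel_measurable (borel \<Otimes>\<^sub>M borel)"
    and f: "(\<lambda>(x, y). f x y) \<in> borel_measurable (borel \<Otimes>\<^sub>M borel)"
  shows "(\<integral>\<^sup>+x. c (x 0) * (\<Prod>i<n. k i (x i) (x (Suc i))) * f (x 0) (x n) \<partial>(\<Pi>\<^sub>M i\<in>{..n}. lborel))
     = (\<integral>\<^sup>+x. c x * bwd k n (f x) x \<partial>lborel)"
  using f
proof (induction n arbitrary: f)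
  case 0
  interpret product_sigma_finite "\<lambda>_::nat. lborel :: 'a measure" ..
  note [measurable] = c 0
  have "{..0::nat} = {0}" by auto
  moreover have "(\<lambda>x. c x * f x x) \<in> borel_measurable lborel" by measurable
  ultimately show ?case using product_nn_integral_singleton[of "\<lambda>x. c x * f x x" 0] by simp
next
  case (Suc n)
  interpret product_sigma_finite "\<lambda>_::nat. lborel :: 'a measure" ..
  note [measurable] = c k Suc.prems
  have i: "{..Suc n} = insert (Suc n) {..n}" by auto
  have "(\<integral>\<^sup>+x. c (x 0) * (\<Prod>i<Suc n. k i (x i) (x (Suc i))) * f (x 0) (x (Suc n)) \<partial>(\<Pi>\<^sub>M i\<in>{..Suc n}. lborel))
    = (\<integral>\<^sup>+x. \<integral>\<^sup>+y. c (x 0) * ((\<Prod>i<n. k i (x i) (x (Suc i))) * k n (x n) y) * f (x 0) y \<partial>lborel \<partial>(\<Pi>\<^sub>M i\<in>{..n}. lborel))"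
    unfolding i
    by (subst product_nn_integral_insert) (auto intro!: nn_integral_cong arg_cong2[where f = "(*)"] prod.cong)
  also have "\<dots> = (\<integral>\<^sup>+x. c (x 0) * (\<Prod>i<n. k i (x i) (x (Suc i))) * (\<integral>\<^sup>+y. k n (x n) y * f (x 0) y \<partial>lborel) \<partial>(\<Pi>\<^sub>M i\<in>{..n}. lborel))"
  proof (rule nn_integral_cong)
    fix x :: "nat \<Rightarrow> 'a"
    show "(\<integral>\<^sup>+y. c (x 0) * ((\<Prod>i<n. k i (x i) (x (Suc i))) * k n (x n) y) * f (x 0) y \<partial>lborel) =
      c (x 0) * (\<Prod>i<n. k i (x i) (x (Suc i))) * (\<integral>\<^sup>+y. k n (x n) y * f (x 0) y \<partial>lborel)"
      by (subst nn_integral_cmult[symmetric]) (auto simp: mult_ac)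
  qed
  also have "\<dots> = (\<integral>\<^sup>+x. c x * bwd k n (\<lambda>z. \<integral>\<^sup>+y. k n z y * f x y \<partial>lborel) x \<partial>lborel)"
  proof (rule Suc.IH)
    show "(\<lambda>(x, z). \<integral>\<^sup>+y. k n z y * f x y \<partial>lborel) \<in> borel_measurable (borel \<Otimes>\<^sub>M borel)"
      by measurable
  qed
  finally show ?case by simp
qed

text \<open>The marginals of the definitions are indexed by increasing sequences of times, cylinder
  sets by finite sets of times. Prescribing the two extreme times keeps the ends of a window at the
  indices 0 and n.\<close>

lemma strict_mono_enumeration:
  fixes J :: "real set"
  assumes "finite J" "a \<in> J" "b \<in> J" "\<And>x. x \<in> J \<Longrightarrow> a \<le> x \<and> x \<le> b"
  obtains n :: nat and t where "strict_mono_on {..n} t" "t ` {..n} = J" "t 0 = a" "t n = b"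
proof -
  define xs where "xs = sorted_list_of_set J"
  have xs: "sorted_wrt (<) xs" "set xs = J" using assms(1) by (auto simp: xs_def)
  have ne: "xs \<noteq> []" using xs assms(2) by auto
  define n where "n = length xs - 1"
  have len: "length xs = Suc n" using ne by (simp add: n_def)
  have sm: "strict_mono_on {..n} ((!) xs)"
    using xs(1) len by (auto simp: strict_mono_on_def sorted_wrt_iff_nth_less)
  have im: "(!) xs ` {..n} = J"
    using xs(2) len by (auto simp: set_conv_nth image_def less_Suc_eq_le)
  obtain i where i: "i \<le> n" "xs ! i = a" using im assms(2) by auto
  obtain j where j: "j \<le> n" "xs ! j = b" using im assms(3) by auto
  have "xs ! 0 = a"
  proof (cases "i = 0")
    case False
    then have "xs ! 0 < a" using sm i by (auto simp: strict_mono_on_def)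
    moreover have "xs ! 0 \<in> J" using im by auto
    ultimately show ?thesis using assms(4) by force
  qed (use i in simp)
  moreover have "xs ! n = b"
  proof (cases "j = n")
    case False
    then have "b < xs ! n" using sm j by (auto simp: strict_mono_on_def)
    moreover have "xs ! n \<in> J" using im by auto
    ultimately show ?thesis using assms(4) by force
  qed (use j in simp)
  ultimately show thesis using that[of n "(!) xs"] sm im by simp
qed

section \<open>Kernels and ground state with extended nonnegative values\<close>

definition ground_state :: "real ^ 'd \<Rightarrow> ennreal" where
  "ground_state x = (if x \<in> cube 1 then ennreal (hD x) else 0)"

text \<open>Off the cube \<open>hD\<close> takes both signs, so the ground state and its reciprocal
  are both cut off there. Their product is therefore the indicator of the cube, not 1.\<close>

definition inv_ground_state :: "real ^ 'd \<Rightarrow> ennreal" where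
  "inv_ground_state x = (if x \<in> cube 1 then ennreal (1 / hD x) else 0)"

text \<open>The value \<open>0\<close> for \<open>t \<le> 0\<close> makes the kernel jointly measurable for every \<open>t\<close>.\<close>

definition killed_kernel :: "'a set \<Rightarrow> (real \<Rightarrow> 'a \<Rightarrow> 'a \<Rightarrow> real) \<Rightarrow> real \<Rightarrow> 'a \<Rightarrow> 'a \<Rightarrow> ennreal" where
  "killed_kernel \<Omega> q t x y = (if 0 < t \<and> x \<in> \<Omega> \<and> y \<in> \<Omega> then ennreal (q t x y) else 0)"

abbreviation unit_kernel :: "real \<Rightarrow> real ^ 'd \<Rightarrow> real ^ 'd \<Rightarrow> ennreal" where
  "unit_kernel \<equiv> killed_kernel (cube 1) cube_kernel"

lemma measurable_cube[measurable]: "cube L \<in> sets borel"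
  using open_cube by (rule borel_open)

lemma measurable_hD[measurable]: "hD \<in> borel_measurable borel"
  unfolding hD_def by (intro borel_measurable_continuous_onI continuous_intros)

lemma measurable_ground_state[measurable]: "ground_state \<in> borel_measurable borel"
  unfolding ground_state_def by measurable

lemma measurable_inv_ground_state[measurable]: "inv_ground_state \<in> borel_measurable borel"
  unfolding inv_ground_state_def by measurable

lemma measurable_killed_kernel:
  fixes q :: "real \<Rightarrow> 'a::euclidean_space \<Rightarrow> 'a \<Rightarrow> real"
  assumes \<Omega>: "open \<Omega>" and q: "\<And>t. t > 0 \<Longrightarrow> continuous_on (\<Omega> \<times> \<Omega>) (\<lambda>(x, y). q t x y)"
  shows "(\<lambda>(x, y). killed_kernel \<Omega> q t x y) \<in> borel_measurable (borel \<Otimes>\<^sub>M borel)"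
proof (cases "t > 0")
  case True
  have "open (\<Omega> \<times> \<Omega>)" using \<Omega> by (simp add: open_Times)
  then have "(\<lambda>z. if z \<in> \<Omega> \<times> \<Omega> then (\<lambda>(x, y). q t x y) z else 0) \<in> borel_measurable borel"
    by (intro borel_measurable_continuous_on_if q True) auto
  then have "(\<lambda>z. ennreal (if z \<in> \<Omega> \<times> \<Omega> then (\<lambda>(x, y). q t x y) z else 0)) \<in> borel_measurable borel"
    by measurable
  moreover have "(\<lambda>z. ennreal (if z \<in> \<Omega> \<times> \<Omega> then (\<lambda>(x, y). q t x y) z else 0)) = (\<lambda>(x, y). killed_kernel \<Omega> q t x y)"
    using True by (auto simp: killed_kernel_def fun_eq_iff)
  ultimately show ?thesis by (simp add: borel_prod)
qed (simp add: killed_kernel_def)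

lemma measurable_unit_kernel:
  "(\<lambda>(x, y). unit_kernel t x y) \<in> borel_measurable (borel \<Otimes>\<^sub>M borel)"
  by (rule measurable_killed_kernel[OF open_cube]) (rule continuous_on_subset[OF continuous_cube_kernel], auto)

lemma ground_state_inv: "ground_state x * inv_ground_state x = indicator (cube 1) x"
proof (cases "x \<in> cube 1")
  case True
  then have "hD x > 0" by (rule hD_pos)
  then show ?thesis using True by (simp add: ground_state_def inv_ground_state_def ennreal_mult[symmetric])
qed (simp add: ground_state_def)

section \<open>The tab process\<close>

lemma indicator_prod_atMost:
  "(\<Prod>i\<le>n. indicator (A i) (x i) :: ennreal) = indicator (A 0) (x 0) * (\<Prod>i<n. indicator (A (Suc i)) (x (Suc i)))"
  unfolding lessThan_Suc_atMost[symmetric] by (rule prod.lessThan_Suc_shift[unfolded o_def])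

lemma indicator_Collect_le:
  "indicator {x. \<forall>i\<le>n. f x i \<in> A i} x = (\<Prod>i\<le>n. indicator (A i) (f x i) :: ennreal)" for n :: nat
proof (cases "\<forall>i\<le>n. f x i \<in> A i")
  case False
  then obtain i where "i \<le> n" "f x i \<notin> A i" by auto
  then have "(\<Prod>i\<le>n. indicator (A i) (f x i) :: ennreal) = 0" by (intro prod_zero bexI[of _ i]) auto
  then show ?thesis using False by (simp add: indicator_def)
qed simp

lemma prod_killed_kernel:
  assumes nn: "\<And>t x y. t > 0 \<Longrightarrow> x \<in> \<Omega> \<Longrightarrow> y \<in> \<Omega> \<Longrightarrow> q t x y \<ge> 0"
    and t: "\<And>i. i < n \<Longrightarrow> s i > 0" and x: "\<And>i. i \<le> n \<Longrightarrow> x i \<in> \<Omega>"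
  shows "(\<Prod>i<n. killed_kernel \<Omega> q (s i) (x i) (x (Suc i))) = ennreal (\<Prod>i<n. q (s i) (x i) (x (Suc i)))"
proof -
  have "(\<Prod>i<n. killed_kernel \<Omega> q (s i) (x i) (x (Suc i))) = (\<Prod>i<n. ennreal (q (s i) (x i) (x (Suc i))))"
    using t x by (intro prod.cong) (auto simp: killed_kernel_def)
  also have "\<dots> = ennreal (\<Prod>i<n. q (s i) (x i) (x (Suc i)))"
    using nn t x by (intro prod_ennreal) auto
  finally show ?thesis .
qed

lemma prod_killed_kernel_outside:
  assumes x: "i \<le> n" "x i \<notin> \<Omega>"
  shows "indicator \<Omega> (x 0) * (\<Prod>i<n. killed_kernel \<Omega> q (s i) (x i) (x (Suc i))) = 0"
proof (cases i)
  case (Suc j)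
  then have "(\<Prod>i<n. killed_kernel \<Omega> q (s i) (x i) (x (Suc i))) = 0"
    using x by (intro prod_zero bexI[of _ j]) (auto simp: killed_kernel_def)
  then show ?thesis by simp
qed (use x in simp)

locale tab_process =
  fixes p :: "real \<Rightarrow> real ^ 'd \<Rightarrow> real ^ 'd \<Rightarrow> real" and Q :: "(real \<Rightarrow> real ^ 'd) measure"
  assumes p: "dirichlet_heat_kernel (cube 1) p" and tab: "tab_two_sided_law p Q"
begin

text \<open>The lowest eigenvalue of minus the Dirichlet Laplacian on the unit cube, that is, the
  distance of its spectrum from 0.\<close>

definition gap :: real where "gap = pi\<^sup>2 * real CARD('d)"

lemma p_eq: "t > 0 \<Longrightarrow> x \<in> cube 1 \<Longrightarrow> y \<in> cube 1 \<Longrightarrow> p t x y = cube_kernel t x y"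
  using dirichlet_kernel_eq_cube_kernel[OF _ p, of t x y] closure_subset[of "cube 1 :: (real ^ 'd) set"] by auto

lemma cube_kernel_nonneg: "t > 0 \<Longrightarrow> x \<in> cube 1 \<Longrightarrow> y \<in> cube 1 \<Longrightarrow> cube_kernel t x (y :: real ^ 'd) \<ge> 0"
  using dirichlet_heat_kernel_nonneg[OF p open_cube bounded_cube, of t x y] closure_subset[of "cube 1 :: (real ^ 'd) set"]
  by (auto simp: p_eq)

lemma unit_kernel_semigroup:
  assumes "s > 0" "t > 0"
  shows "(\<integral>\<^sup>+a. unit_kernel s x a * unit_kernel t a z \<partial>lborel) = unit_kernel (s + t) x (z :: real ^ 'd)"
proof (cases "x \<in> cube 1 \<and> z \<in> cube 1")
  case True
  have "(\<integral>\<^sup>+a. unit_kernel s x a * unit_kernel t a z \<partial>lborel) =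
      (\<integral>\<^sup>+a. ennreal (indicator (cube 1) a *\<^sub>R (cube_kernel s x a * cube_kernel t a z)) \<partial>lborel)"
    using True assms by (intro nn_integral_cong) (auto simp: killed_kernel_def indicator_def ennreal_mult cube_kernel_nonneg)
  also have "\<dots> = ennreal (LINT a:cube 1|lborel. cube_kernel s x a * cube_kernel t a z)"
    unfolding set_lebesgue_integral_def
  proof (rule nn_integral_eq_integral)
    have "continuous_on (closure (cube 1)) (\<lambda>a. cube_kernel t a z)"
      by (rule continuous_on_compose2[OF continuous_cube_kernel[OF assms(2)] continuous_on_Pair[OF continuous_on_id continuous_on_const[of _ z]], simplified])
    then have "set_integrable lborel (cube 1) (\<lambda>a. cube_kernel s x a * cube_kernel t a z)"
      by (intro set_integrable_continuous_closure[OF open_cube bounded_cube] continuous_on_mult continuous_cube_kernel_section assms)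
    then show "integrable lborel (\<lambda>a. indicator (cube 1) a *\<^sub>R (cube_kernel s x a * cube_kernel t a z))"
      by (simp add: set_integrable_def)
    show "AE a in lborel. 0 \<le> indicator (cube 1) a *\<^sub>R (cube_kernel s x a * cube_kernel t a z)"
      using True assms by (intro AE_I2) (auto simp: indicator_def cube_kernel_nonneg)
  qed
  also have "\<dots> = unit_kernel (s + t) x z"
    using True assms by (simp add: cube_kernel_semigroup killed_kernel_def)
  finally show ?thesis .
next
  case False
  then have "unit_kernel s x a * unit_kernel t a z = 0" for a by (auto simp: killed_kernel_def)
  then show ?thesis using False by (auto simp: killed_kernel_def)
qed

lemma prob_Q: "prob_space Q" and sets_Q[measurable_cong]: "sets Q = sets (borel_of XD)"
  using tab by (auto simp: tab_two_sided_law_def prob_measures_def)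

lemma space_Q: "space Q = topspace XD"
  using sets_eq_imp_space_eq[OF sets_Q] by simp

text \<open>The quotients of \<open>hD\<close> in the transition densities telescope. A tab chain is
  a chain of plain heat kernels with one ground state at each end and one exponential of the elapsed
  time.\<close>

lemma tab_density:
  assumes t: "\<And>i. i < n \<Longrightarrow> t i < t (Suc i)"
  shows "ennreal (if \<forall>i\<le>n. x i \<in> cube 1 then (hD (x 0))\<^sup>2 * (\<Prod>i<n. ptab p (t (Suc i) - t i) (x i) (x (Suc i))) else 0)
    = ground_state (x 0) * (\<Prod>i<n. unit_kernel (t (Suc i) - t i) (x i) (x (Suc i)))
        * (ennreal (exp (gap * (t n - t 0))) * ground_state (x n))"
proof (cases "\<forall>i\<le>n. x i \<in> cube 1")
  case True
  have "(hD (x 0))\<^sup>2 * (\<Prod>i<n. ptab p (t (Suc i) - t i) (x i) (x (Suc i))) =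
    hD (x 0) * (\<Prod>i<n. cube_kernel (t (Suc i) - t i) (x i) (x (Suc i))) * (exp (gap * (t n - t 0)) * hD (x n))"
    using t True
  proof (induction n)
    case (Suc n)
    have h: "hD (x n) > 0" using Suc.prems(2) hD_pos[of "x n"] by simp
    have e: "exp (gap * (t (Suc n) - t 0)) = exp (gap * (t (Suc n) - t n)) * exp (gap * (t n - t 0))"
      by (simp add: exp_add[symmetric] algebra_simps)
    have "(hD (x 0))\<^sup>2 * (\<Prod>i<Suc n. ptab p (t (Suc i) - t i) (x i) (x (Suc i))) =
      ((hD (x 0))\<^sup>2 * (\<Prod>i<n. ptab p (t (Suc i) - t i) (x i) (x (Suc i)))) * ptab p (t (Suc n) - t n) (x n) (x (Suc n))"
      by simp
    also have "\<dots> = hD (x 0) * (\<Prod>i<n. cube_kernel (t (Suc i) - t i) (x i) (x (Suc i))) * (exp (gap * (t n - t 0)) * hD (x n))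
      * (exp (gap * (t (Suc n) - t n)) * (hD (x (Suc n)) / hD (x n)) * cube_kernel (t (Suc n) - t n) (x n) (x (Suc n)))"
      using Suc by (simp add: ptab_def p_eq gap_def)
    also have "\<dots> = hD (x 0) * (\<Prod>i<Suc n. cube_kernel (t (Suc i) - t i) (x i) (x (Suc i))) * (exp (gap * (t (Suc n) - t 0)) * hD (x (Suc n)))"
      using h unfolding e by simp
    finally show ?case .
  qed (simp add: power2_eq_square)
  moreover have "(\<Prod>i<n. unit_kernel (t (Suc i) - t i) (x i) (x (Suc i))) =
      ennreal (\<Prod>i<n. cube_kernel (t (Suc i) - t i) (x i) (x (Suc i)))"
    using True t by (intro prod_killed_kernel) (auto intro: cube_kernel_nonneg)
  moreover have "hD (x 0) \<ge> 0" "hD (x n) \<ge> 0" using True hD_pos by (auto intro: less_imp_le)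
  moreover have "(\<Prod>i<n. cube_kernel (t (Suc i) - t i) (x i) (x (Suc i))) \<ge> 0"
    using True t by (intro prod_nonneg) (auto intro!: cube_kernel_nonneg)
  ultimately show ?thesis using True by (simp add: ground_state_def ennreal_mult)
next
  case False
  then obtain i where "i \<le> n" "x i \<notin> cube 1" by auto
  from prod_killed_kernel_outside[of i n x "cube 1", OF this, of cube_kernel "\<lambda>i. t (Suc i) - t i"]
  have "ground_state (x 0) * (\<Prod>i<n. unit_kernel (t (Suc i) - t i) (x i) (x (Suc i))) = 0"
    by (auto simp: ground_state_def)
  then show ?thesis using False by auto
qed

text \<open>The weight f of the first and the last position is there for the window density, which
  depends on the window ends only.\<close>

lemma tab_cylinder:
  assumes t: "strict_mono_on {..n} t" and A[measurable]: "\<And>i. A i \<in> sets borel"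
    and f[measurable]: "(\<lambda>(x, y). f x y) \<in> borel_measurable (borel \<Otimes>\<^sub>M borel)"
  shows "(\<integral>\<^sup>+\<gamma>. (\<Prod>i\<le>n. indicator (A i) (\<gamma> (t i))) * f (\<gamma> (t 0)) (\<gamma> (t n)) \<partial>Q) =
    (\<integral>\<^sup>+x. ground_state x * indicator (A 0) x *
       bwd (\<lambda>i x y. unit_kernel (t (Suc i) - t i) x y * indicator (A (Suc i)) y) n
         (\<lambda>y. ennreal (exp (gap * (t n - t 0))) * ground_state y * f x y) x \<partial>lborel)"
proof -
  note [measurable] = measurable_unit_kernel
  let ?P = "\<Pi>\<^sub>M i\<in>{..n}. (lborel :: (real ^ 'd) measure)"
  let ?D = "\<lambda>x. ennreal (if \<forall>i\<le>n. x i \<in> cube 1 then (hD (x 0))\<^sup>2 * (\<Prod>i<n. ptab p (t (Suc i) - t i) (x i) (x (Suc i))) else 0)"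
  let ?G = "\<lambda>x. (\<Prod>i\<le>n. indicator (A i) (x i)) * f (x 0) (x n)"
  have ti: "t i < t (Suc i)" if "i < n" for i using t that by (auto simp: strict_mono_on_def)
  have D: "?D x = ground_state (x 0) * (\<Prod>i<n. unit_kernel (t (Suc i) - t i) (x i) (x (Suc i)))
        * (ennreal (exp (gap * (t n - t 0))) * ground_state (x n))" for x
    by (rule tab_density) (rule ti)
  have [measurable]: "(\<lambda>x. x i) \<in> ?P \<rightarrow>\<^sub>M borel" if "i \<le> n" for i
    using measurable_component_singleton[of i "{..n}" "\<lambda>_. lborel :: (real ^ 'd) measure"] that by simp
  have [measurable]: "?D \<in> borel_measurable ?P" unfolding D by measurable
  have [measurable]: "?G \<in> borel_measurable ?P" by measurable
  have fdd: "fdd Q n t = density ?P ?D" using tab t by (auto simp: tab_two_sided_law_def)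
  have m: "(\<lambda>\<omega>. \<lambda>i\<in>{..n}. \<omega> (t i)) \<in> Q \<rightarrow>\<^sub>M ?P"
    by (intro measurable_restrict) (simp add: measurable_cong_sets[OF sets_Q refl] measurable_XD_eval)
  have "(\<integral>\<^sup>+\<gamma>. (\<Prod>i\<le>n. indicator (A i) (\<gamma> (t i))) * f (\<gamma> (t 0)) (\<gamma> (t n)) \<partial>Q) = (\<integral>\<^sup>+x. ?G x \<partial>fdd Q n t)"
    unfolding fdd_def by (subst nn_integral_distr[OF m]) auto
  also have "\<dots> = (\<integral>\<^sup>+x. ?D x * ?G x \<partial>?P)" unfolding fdd by (rule nn_integral_density) auto
  also have "\<dots> = (\<integral>\<^sup>+x. (ground_state (x 0) * indicator (A 0) (x 0))
      * (\<Prod>i<n. unit_kernel (t (Suc i) - t i) (x i) (x (Suc i)) * indicator (A (Suc i)) (x (Suc i)))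
      * (ennreal (exp (gap * (t n - t 0))) * ground_state (x n) * f (x 0) (x n)) \<partial>?P)"
    unfolding D indicator_prod_atMost prod.distrib by (intro nn_integral_cong) (simp add: mult_ac)
  also have "\<dots> = (\<integral>\<^sup>+x. ground_state x * indicator (A 0) x *
       bwd (\<lambda>i x y. unit_kernel (t (Suc i) - t i) x y * indicator (A (Suc i)) y) n
         (\<lambda>y. ennreal (exp (gap * (t n - t 0))) * ground_state y * f x y) x \<partial>lborel)"
    by (rule nn_integral_PiM_chain[where c = "\<lambda>x. ground_state x * indicator (A 0) x"
       and k = "\<lambda>i x y. unit_kernel (t (Suc i) - t i) x y * indicator (A (Suc i)) y"
       and f = "\<lambda>x y. ennreal (exp (gap * (t n - t 0))) * ground_state y * f x y"]) measurable
  finally show ?thesis .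
qed

text \<open>The normalization is read off from the one-time law of the tab process, which is a
  probability measure, instead of integrating the squared sines.\<close>

lemma nn_integral_ground_state_sq: "(\<integral>\<^sup>+x. ground_state x * ground_state (x :: real ^ 'd) \<partial>lborel) = 1"
proof -
  have "strict_mono_on {..0} real" by (auto simp: strict_mono_on_def)
  then have "(\<integral>\<^sup>+\<gamma>. 1 \<partial>Q) = (\<integral>\<^sup>+x. ground_state x * ground_state (x :: real ^ 'd) \<partial>lborel)"
    using tab_cylinder[of 0 real "\<lambda>_. UNIV" "\<lambda>_ _. 1"] by simp
  then show ?thesis using prob_space.emeasure_space_1[OF prob_Q] by simp
qed

text \<open>The trace of the Dirichlet semigroup of the unit cube;
  \<open>partition_function_eq\<close> identifies it with the normalizing constant of the root
  density.\<close>

definition partition_function :: "real \<Rightarrow> ennreal" where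
  "partition_function S = (\<integral>\<^sup>+x. unit_kernel S x (x :: real ^ 'd) \<partial>lborel)"

text \<open>In the window density the kernels stand in the numerator and the trace in the
  denominator, so an upper bound here and the lower bound \<open>partition_function_lower\<close>
  together dominate it from above.\<close>

lemma unit_kernel_upper:
  assumes "\<eta> > 0"
  shows "\<forall>\<^sub>F t in at_top. \<forall>x y. unit_kernel t x y \<le> ennreal ((1 + \<eta>) * exp (- (gap * t))) * (ground_state x * ground_state (y :: real ^ 'd))"
  using cube_kernel_asymp[OF assms, where 'd = 'd]
proof eventually_elim
  case (elim t)
  show ?case
  proof (intro allI)
    fix x y :: "real ^ 'd"
    show "unit_kernel t x y \<le> ennreal ((1 + \<eta>) * exp (- (gap * t))) * (ground_state x * ground_state y)"
    proof (cases "x \<in> cube 1 \<and> y \<in> cube 1")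
      case True
      then have "cube_kernel t x y \<le> (1 + \<eta>) * exp (- (gap * t)) * (hD x * hD y)"
        using elim closure_subset[of "cube 1 :: (real ^ 'd) set"] by (auto simp: gap_def mult_ac)
      moreover have "hD x \<ge> 0" "hD y \<ge> 0" using True hD_pos by (auto intro: less_imp_le)
      ultimately show ?thesis using True assms
        by (auto simp: killed_kernel_def ground_state_def ennreal_mult[symmetric])
    qed (auto simp: killed_kernel_def)
  qed
qed

lemma partition_function_lower:
  assumes "\<eta> > 0" "\<eta> < 1"
  shows "\<forall>\<^sub>F t in at_top. ennreal ((1 - \<eta>) * exp (- (gap * t))) \<le> partition_function t"
  using cube_kernel_asymp[OF assms(1), where 'd = 'd] eventually_gt_at_top[of 0]
proof eventually_elim
  case (elim t)
  have "ennreal ((1 - \<eta>) * exp (- (gap * t))) = (\<integral>\<^sup>+x. ennreal ((1 - \<eta>) * exp (- (gap * t))) * (ground_state x * ground_state (x :: real ^ 'd)) \<partial>lborel)"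
    by (subst nn_integral_cmult) (auto simp: nn_integral_ground_state_sq)
  also have "\<dots> \<le> partition_function t"
    unfolding partition_function_def
  proof (rule nn_integral_mono)
    fix x :: "real ^ 'd"
    show "ennreal ((1 - \<eta>) * exp (- (gap * t))) * (ground_state x * ground_state x) \<le> unit_kernel t x x"
    proof (cases "x \<in> cube 1")
      case True
      then have "(1 - \<eta>) * exp (- (gap * t)) * (hD x * hD x) \<le> cube_kernel t x x"
        using elim(1) closure_subset[of "cube 1 :: (real ^ 'd) set"] by (auto simp: gap_def mult_ac)
      moreover have "hD x \<ge> 0" using True hD_pos by (auto intro: less_imp_le)
      ultimately show ?thesis using True assms elim(2)
        by (auto simp: killed_kernel_def ground_state_def ennreal_mult[symmetric] intro!: ennreal_leI)
    qed (auto simp: ground_state_def)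
  qed
  finally show ?case .
qed

end

section \<open>The one-loop law\<close>

text \<open>The rescaled loop with its root forgotten: the chain through the given times is closed
  by one kernel of duration S - s n + s 0, the arc that passes through the root. Geometry and
  duration enter through S alone.\<close>

definition (in tab_process) loop_path_law :: "real \<Rightarrow> (real \<Rightarrow> real ^ 'd) measure \<Rightarrow> bool" where
  "loop_path_law S P \<longleftrightarrow> prob_space P \<and> sets P = sets (borel_of XD) \<and>
     (\<forall>n s A. strict_mono_on {..n} s \<longrightarrow> 0 < s 0 \<longrightarrow> s n < S \<longrightarrow> (\<forall>i. A i \<in> sets borel) \<longrightarrow>
        emeasure P {\<gamma> \<in> topspace XD. \<forall>i\<le>n. \<gamma> (s i) \<in> A i} =
        inverse (partition_function S) * (\<integral>\<^sup>+x. indicator (A 0) x *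
          bwd (\<lambda>i x y. unit_kernel (s (Suc i) - s i) x y * indicator (A (Suc i)) y) n
            (\<lambda>y. unit_kernel (S - s n + s 0) y x) x \<partial>lborel))"

locale cube_loop = tab_process p Q for p :: "real \<Rightarrow> real ^ 'd \<Rightarrow> real ^ 'd \<Rightarrow> real" and Q +
  fixes L T :: real and q :: "real \<Rightarrow> real ^ 'd \<Rightarrow> real ^ 'd \<Rightarrow> real"
    and B :: "real ^ 'd \<Rightarrow> (real \<Rightarrow> real ^ 'd) measure"
  assumes L: "L > 0" and T: "T > 0" and q: "dirichlet_heat_kernel (cube L) q"
    and B: "\<And>a. a \<in> cube L \<Longrightarrow> killed_bridge_law (cube L) q T a (B a)"
begin

abbreviation "kk \<equiv> killed_kernel (cube L) q"
abbreviation "N \<equiv> borel_of (loops (closure (cube L)) T :: (real \<Rightarrow> real ^ 'd) topology)"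

definition S :: real where "S = T / L\<^sup>2"

lemma S_pos: "S > 0" using L T by (simp add: S_def)

lemma q_nonneg: "t > 0 \<Longrightarrow> x \<in> cube L \<Longrightarrow> y \<in> cube L \<Longrightarrow> q t x y \<ge> 0"
  using dirichlet_heat_kernel_nonneg[OF q open_cube bounded_cube] closure_subset by blast

lemma measurable_kk: "(\<lambda>(x, y). kk t x y) \<in> borel_measurable (borel \<Otimes>\<^sub>M borel)"
proof (rule measurable_killed_kernel[OF open_cube])
  fix t :: real assume "t > 0"
  then have "continuous_on (closure (cube L) \<times> closure (cube L)) (\<lambda>(x, y). q t x y)"
    using q unfolding dirichlet_heat_kernel_def by blast
  then show "continuous_on (cube L \<times> cube L) (\<lambda>(x, y). q t x y)"
    by (rule continuous_on_subset) (use closure_subset in blast)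
qed

lemma kk_scale: "ennreal (L ^ CARD('d)) * kk t (L *\<^sub>R x) (L *\<^sub>R y) = unit_kernel (t / L\<^sup>2) x y"
proof (cases "t > 0 \<and> x \<in> cube 1 \<and> y \<in> cube 1")
  case True
  then have "x \<in> closure (cube 1)" using closure_subset by blast
  then have "L ^ CARD('d) * q t (L *\<^sub>R x) (L *\<^sub>R y) = cube_kernel (t / L\<^sup>2) x y"
    using True by (intro dirichlet_kernel_eq_cube_kernel[OF L q]) auto
  then show ?thesis using True L
    by (simp add: killed_kernel_def scaleR_mem_cube ennreal_mult'[symmetric])
qed (use L in \<open>auto simp: killed_kernel_def scaleR_mem_cube zero_less_divide_iff\<close>)

lemma kk_eq: "kk t x y = ennreal (1 / L ^ CARD('d)) * unit_kernel (t / L\<^sup>2) ((1 / L) *\<^sub>R x) ((1 / L) *\<^sub>R y)"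
proof -
  have "ennreal (1 / L ^ CARD('d)) * (ennreal (L ^ CARD('d)) * kk t x y) = kk t x y"
    using L by (simp add: mult.assoc[symmetric] ennreal_mult''[symmetric])
  then show ?thesis using kk_scale[of t "(1 / L) *\<^sub>R x" "(1 / L) *\<^sub>R y"] L by simp
qed

lemma kk_semigroup:
  assumes "s > 0" "t > 0"
  shows "(\<integral>\<^sup>+a. kk s x a * kk t a z \<partial>lborel) = kk (s + t) x z"
proof -
  note [measurable] = measurable_kk measurable_unit_kernel
  have "(\<integral>\<^sup>+a. kk s x a * kk t a z \<partial>lborel) =
    (\<integral>\<^sup>+a. ennreal (L ^ CARD('d)) * (kk s x (L *\<^sub>R a) * kk t (L *\<^sub>R a) z) \<partial>lborel)"
    by (subst nn_integral_scaleR[OF L]) auto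
  also have "\<dots> = (\<integral>\<^sup>+a. ennreal (1 / L ^ CARD('d)) * (unit_kernel (s / L\<^sup>2) ((1 / L) *\<^sub>R x) a * unit_kernel (t / L\<^sup>2) a ((1 / L) *\<^sub>R z)) \<partial>lborel)"
  proof (rule nn_integral_cong)
    fix a :: "real ^ 'd"
    have "ennreal (L ^ CARD('d)) * (kk s x (L *\<^sub>R a) * kk t (L *\<^sub>R a) z) =
      kk s x (L *\<^sub>R a) * (ennreal (L ^ CARD('d)) * kk t (L *\<^sub>R a) (L *\<^sub>R ((1 / L) *\<^sub>R z)))"
      using L by (simp add: mult_ac)
    also have "\<dots> = ennreal (1 / L ^ CARD('d)) * (unit_kernel (s / L\<^sup>2) ((1 / L) *\<^sub>R x) a * unit_kernel (t / L\<^sup>2) a ((1 / L) *\<^sub>R z))"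
      unfolding kk_scale using L by (simp add: kk_eq[of s] mult_ac)
    finally show "ennreal (L ^ CARD('d)) * (kk s x (L *\<^sub>R a) * kk t (L *\<^sub>R a) z) =
      ennreal (1 / L ^ CARD('d)) * (unit_kernel (s / L\<^sup>2) ((1 / L) *\<^sub>R x) a * unit_kernel (t / L\<^sup>2) a ((1 / L) *\<^sub>R z))" .
  qed
  also have "\<dots> = ennreal (1 / L ^ CARD('d)) * unit_kernel (s / L\<^sup>2 + t / L\<^sup>2) ((1 / L) *\<^sub>R x) ((1 / L) *\<^sub>R z)"
    using assms L by (subst nn_integral_cmult) (auto simp: unit_kernel_semigroup)
  finally show ?thesis by (simp add: kk_eq add_divide_distrib)
qed

lemma loops_eq: "loops (closure (cube L)) T = subtopology (cloc {0..T} (closure (cube L))) {\<omega>. \<omega> 0 = \<omega> T}"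
  by (simp add: loops_def)

lemma topspace_loops: "\<omega> \<in> topspace (loops (closure (cube L)) T) \<longleftrightarrow>
   \<omega> \<in> paths {0..T} (closure (cube L)) \<and> \<omega> 0 = \<omega> T"
  by (simp add: loops_eq topspace_cloc)

lemma measurable_N_eval: "t \<in> {0..T} \<Longrightarrow> (\<lambda>\<omega>. \<omega> t) \<in> N \<rightarrow>\<^sub>M borel"
  unfolding loops_eq by (rule measurable_eval)

lemma prob_B: "a \<in> cube L \<Longrightarrow> prob_space (B a)" and sets_B: "a \<in> cube L \<Longrightarrow> sets (B a) = sets N"
  using B unfolding killed_bridge_law_def prob_measures_def by auto

lemma space_B: "a \<in> cube L \<Longrightarrow> space (B a) = space N"
  using sets_eq_imp_space_eq[OF sets_B] .

lemma q_diag_nonneg: "a \<in> cube L \<Longrightarrow> q T a a \<ge> 0"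
  using q_nonneg T by blast

lemma bridge_cylinder:
  assumes a: "a \<in> cube L" and t: "strict_mono_on {..n} t" "0 < t 0" "t n < T"
    and A[measurable]: "\<And>i. A i \<in> sets borel"
  shows "emeasure (B a) {\<omega> \<in> space N. \<forall>i\<le>n. \<omega> (t i) \<in> A i} =
    ennreal (1 / q T a a) * (\<integral>\<^sup>+x. kk (t 0) a x * indicator (A 0) x *
       bwd (\<lambda>i x y. kk (t (Suc i) - t i) x y * indicator (A (Suc i)) y) n (\<lambda>y. kk (T - t n) y a) x \<partial>lborel)"
proof -
  note [measurable] = measurable_kk
  let ?P = "\<Pi>\<^sub>M i\<in>{..n}. (lborel :: (real ^ 'd) measure)"
  let ?D = "\<lambda>x. ennreal (if \<forall>i\<le>n. x i \<in> cube L
             then q (t 0) a (x 0) * (\<Prod>i<n. q (t (Suc i) - t i) (x i) (x (Suc i))) * q (T - t n) (x n) a / q T a a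
             else 0)"
  have ti: "t i < t (Suc i)" if "i < n" for i using t that by (auto simp: strict_mono_on_def)
  have tI: "t i \<in> {0..T}" if "i \<le> n" for i
  proof -
    have "t 0 \<le> t i" "t i \<le> t n" using t(1) that by (auto simp: strict_mono_on_leD)
    then show ?thesis using t by auto
  qed
  have D: "?D x = ennreal (1 / q T a a) * (kk (t 0) a (x 0) * (\<Prod>i<n. kk (t (Suc i) - t i) (x i) (x (Suc i))) * kk (T - t n) (x n) a)" for x
  proof (cases "\<forall>i\<le>n. x i \<in> cube L")
    case True
    have "(\<Prod>i<n. kk (t (Suc i) - t i) (x i) (x (Suc i))) = ennreal (\<Prod>i<n. q (t (Suc i) - t i) (x i) (x (Suc i)))"
      using True ti by (intro prod_killed_kernel) (auto intro: q_nonneg)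
    moreover have "(\<Prod>i<n. q (t (Suc i) - t i) (x i) (x (Suc i))) \<ge> 0"
      using True ti by (intro prod_nonneg) (auto intro!: q_nonneg)
    moreover have "q (t 0) a (x 0) \<ge> 0" "q (T - t n) (x n) a \<ge> 0" "1 / q T a a \<ge> 0"
      using True t a by (auto intro!: q_nonneg simp: q_diag_nonneg)
    ultimately show ?thesis using True t a
      by (simp add: killed_kernel_def ennreal_mult[symmetric])
  next
    case False
    then obtain i where "i \<le> n" "x i \<notin> cube L" by auto
    from prod_killed_kernel_outside[of i n x "cube L", OF this, of q "\<lambda>i. t (Suc i) - t i"]
    have "kk (t 0) a (x 0) * (\<Prod>i<n. kk (t (Suc i) - t i) (x i) (x (Suc i))) = 0"
      by (auto simp: killed_kernel_def[of _ _ "t 0"])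
    then show ?thesis using False by auto
  qed
  have [measurable]: "(\<lambda>x. x i) \<in> ?P \<rightarrow>\<^sub>M borel" if "i \<le> n" for i
    using measurable_component_singleton[of i "{..n}" "\<lambda>_. lborel :: (real ^ 'd) measure"] that by simp
  have [measurable]: "?D \<in> borel_measurable ?P" unfolding D by measurable
  have fdd: "fdd (B a) n t = density ?P ?D"
    using B[OF a] t by (auto simp: killed_bridge_law_def)
  have m: "(\<lambda>\<omega>. \<lambda>i\<in>{..n}. \<omega> (t i)) \<in> B a \<rightarrow>\<^sub>M ?P"
    by (intro measurable_restrict) (simp add: measurable_cong_sets[OF sets_B[OF a] refl] measurable_N_eval[OF tI])
  let ?C = "{x \<in> space ?P. \<forall>i\<le>n. x i \<in> A i}"
  have C: "?C \<in> sets ?P" by measurable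
  have "{\<omega> \<in> space N. \<forall>i\<le>n. \<omega> (t i) \<in> A i} = (\<lambda>\<omega>. \<lambda>i\<in>{..n}. \<omega> (t i)) -` ?C \<inter> space (B a)"
    using measurable_space[OF m] by (auto simp: space_B[OF a])
  then have "emeasure (B a) {\<omega> \<in> space N. \<forall>i\<le>n. \<omega> (t i) \<in> A i} = emeasure (fdd (B a) n t) ?C"
    unfolding fdd_def by (simp add: emeasure_distr[OF m C])
  also have "\<dots> = (\<integral>\<^sup>+x. ?D x * indicator ?C x \<partial>?P)"
    unfolding fdd by (rule emeasure_density) (auto intro: C)
  also have "\<dots> = (\<integral>\<^sup>+x. ennreal (1 / q T a a) * ((kk (t 0) a (x 0) * indicator (A 0) (x 0))
     * (\<Prod>i<n. kk (t (Suc i) - t i) (x i) (x (Suc i)) * indicator (A (Suc i)) (x (Suc i))) * kk (T - t n) (x n) a) \<partial>?P)"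
  proof (rule nn_integral_cong)
    fix x assume "x \<in> space ?P"
    then have "indicator ?C x = (indicator {x. \<forall>i\<le>n. x i \<in> A i} x :: ennreal)" by (simp add: indicator_def)
    also have "\<dots> = indicator (A 0) (x 0) * (\<Prod>i<n. indicator (A (Suc i)) (x (Suc i)))"
      using indicator_Collect_le[of n "\<lambda>x i. x i" A x] indicator_prod_atMost[of A x n] by simp
    finally show "?D x * indicator ?C x = ennreal (1 / q T a a) * ((kk (t 0) a (x 0) * indicator (A 0) (x 0))
     * (\<Prod>i<n. kk (t (Suc i) - t i) (x i) (x (Suc i)) * indicator (A (Suc i)) (x (Suc i))) * kk (T - t n) (x n) a)"
      unfolding D prod.distrib by (simp only: mult_ac)
  qed
  also have "\<dots> = ennreal (1 / q T a a) * (\<integral>\<^sup>+x. ((kk (t 0) a (x 0) * indicator (A 0) (x 0))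
     * (\<Prod>i<n. kk (t (Suc i) - t i) (x i) (x (Suc i)) * indicator (A (Suc i)) (x (Suc i))) * kk (T - t n) (x n) a) \<partial>?P)"
    by (rule nn_integral_cmult) measurable
  also have "(\<integral>\<^sup>+x. ((kk (t 0) a (x 0) * indicator (A 0) (x 0))
     * (\<Prod>i<n. kk (t (Suc i) - t i) (x i) (x (Suc i)) * indicator (A (Suc i)) (x (Suc i))) * kk (T - t n) (x n) a) \<partial>?P) =
    (\<integral>\<^sup>+x. kk (t 0) a x * indicator (A 0) x *
       bwd (\<lambda>i x y. kk (t (Suc i) - t i) x y * indicator (A (Suc i)) y) n (\<lambda>y. kk (T - t n) y a) x \<partial>lborel)"
    by (rule nn_integral_PiM_chain[where c = "\<lambda>x. kk (t 0) a x * indicator (A 0) x"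
       and k = "\<lambda>i x y. kk (t (Suc i) - t i) x y * indicator (A (Suc i)) y"
       and f = "\<lambda>x y. kk (T - t n) y a"]) measurable
  finally show ?thesis .
qed

text \<open>A vanishing diagonal would, by division by zero, turn the bridge density into 0, which
  contradicts that the bridge law has mass 1.\<close>

lemma q_diag_pos:
  assumes a: "a \<in> cube L" shows "q T a a > 0"
proof (rule ccontr)
  assume "\<not> q T a a > 0"
  then have "1 / q T a a = 0" using q_diag_nonneg[OF a] by simp
  moreover have "strict_mono_on {..0::nat} (\<lambda>i. T / 2 + real i)" by (auto simp: strict_mono_on_def)
  ultimately have "emeasure (B a) {\<omega> \<in> space N. \<forall>i\<le>0. \<omega> (T / 2) \<in> UNIV} = 0"
    using bridge_cylinder[OF a, of 0 "\<lambda>i. T / 2 + real i" "\<lambda>_. UNIV"] T by simp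
  then have "emeasure (B a) (space (B a)) = 0" by (simp add: space_B[OF a])
  then show False using prob_space.emeasure_space_1[OF prob_B[OF a]] by simp
qed

lemma continuous_q_diag: "continuous_on (closure (cube L)) (\<lambda>a. q T a a)"
proof -
  have "continuous_on (closure (cube L) \<times> closure (cube L)) (\<lambda>(x, y). q T x y)"
    using q T unfolding dirichlet_heat_kernel_def by blast
  from continuous_on_compose2[OF this continuous_on_Pair[OF continuous_on_id continuous_on_id], of "closure (cube L)"]
  show ?thesis by auto
qed

definition Z :: real where "Z = (LINT z:cube L|lborel. q T z z)"

lemma Z_pos: "Z > 0"
proof (rule ccontr)
  assume "\<not> Z > 0"
  define a :: "real ^ 'd" where "a = (\<chi> i. L / 2)"
  have a: "a \<in> cube L" using L by (simp add: cube_def a_def)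
  have "q T a a = 0"
    using \<open>\<not> Z > 0\<close> a
    by (intro set_integral_nonpos_imp_zero[OF open_cube, of L "\<lambda>a. q T a a"] set_integrable_continuous_closure[OF open_cube bounded_cube])
      (auto simp: Z_def continuous_q_diag q_diag_nonneg intro: continuous_on_subset[OF continuous_q_diag closure_subset])
  then show False using q_diag_pos[OF a] by simp
qed

lemma nn_integral_q_diag: "(\<integral>\<^sup>+a. kk T a a \<partial>lborel) = ennreal Z"
proof -
  have "(\<integral>\<^sup>+a. kk T a a \<partial>lborel) = (\<integral>\<^sup>+a. ennreal (indicator (cube L) a *\<^sub>R q T a a) \<partial>lborel)"
    using T by (intro nn_integral_cong) (auto simp: killed_kernel_def indicator_def)
  also have "\<dots> = ennreal Z"
    unfolding Z_def set_lebesgue_integral_def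
  proof (rule nn_integral_eq_integral)
    have "set_integrable lborel (cube L) (\<lambda>a. q T a a)"
      by (intro set_integrable_continuous_closure[OF open_cube bounded_cube] continuous_q_diag)
    then show "integrable lborel (\<lambda>a. indicator (cube L) a *\<^sub>R q T a a)" by (simp add: set_integrable_def)
  qed (auto simp: indicator_def q_diag_nonneg)
  finally show ?thesis .
qed

lemma partition_function_eq: "partition_function S = ennreal Z"
proof -
  note [measurable] = measurable_kk
  have "ennreal Z = (\<integral>\<^sup>+a. ennreal (L ^ CARD('d)) * kk T (L *\<^sub>R a) (L *\<^sub>R a) \<partial>lborel)"
    unfolding nn_integral_q_diag[symmetric] by (subst nn_integral_scaleR[OF L]) auto
  then show ?thesis unfolding kk_scale partition_function_def S_def by simp
qed

abbreviation "rlaw \<equiv> root_law (cube L) q T"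

lemma sets_rlaw: "sets rlaw = sets (restrict_space borel (cube L))"
  unfolding root_law_def by (simp cong: sets_restrict_space_cong)

lemma space_rlaw: "space rlaw = cube L"
  unfolding root_law_def by (simp add: space_restrict_space)

lemma nn_integral_rlaw:
  assumes [measurable]: "f \<in> borel_measurable borel"
  shows "(\<integral>\<^sup>+a. f a \<partial>rlaw) = ennreal (1 / Z) * (\<integral>\<^sup>+a. kk T a a * f a \<partial>lborel)"
proof -
  note [measurable] = measurable_kk
  have k: "(\<lambda>a. kk T a a / ennreal Z) \<in> borel_measurable borel" by measurable
  have e: "ennreal (q T a a / Z) = kk T a a / ennreal Z" if "a \<in> cube L" for a
    using that T Z_pos q_diag_nonneg[OF that] by (simp add: killed_kernel_def divide_ennreal)
  have m: "(\<lambda>a. ennreal (q T a a / Z)) \<in> borel_measurable (restrict_space lborel (cube L))"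
    by (subst measurable_cong[of _ _ "\<lambda>a. kk T a a / ennreal Z"])
      (auto simp: space_restrict_space e intro!: measurable_restrict_space1 k)
  have "(\<integral>\<^sup>+a. f a \<partial>rlaw) = (\<integral>\<^sup>+a. ennreal (q T a a / Z) * f a \<partial>restrict_space lborel (cube L))"
    unfolding root_law_def Z_def[symmetric]
    by (rule nn_integral_density[OF m]) (intro measurable_restrict_space1, simp)
  also have "\<dots> = (\<integral>\<^sup>+a. ennreal (q T a a / Z) * f a * indicator (cube L) a \<partial>lborel)"
    by (rule nn_integral_restrict_space) simp
  also have "\<dots> = (\<integral>\<^sup>+a. ennreal (1 / Z) * (kk T a a * f a) \<partial>lborel)"
  proof (rule nn_integral_cong)
    fix a
    show "ennreal (q T a a / Z) * f a * indicator (cube L) a = ennreal (1 / Z) * (kk T a a * f a)"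
    proof (cases "a \<in> cube L")
      case True
      have "ennreal (q T a a / Z) = ennreal (1 / Z) * ennreal (q T a a)"
        using Z_pos q_diag_nonneg[OF True] by (simp add: ennreal_mult[symmetric])
      then show ?thesis using True T by (simp add: killed_kernel_def mult_ac)
    qed (simp add: killed_kernel_def)
  qed
  also have "\<dots> = ennreal (1 / Z) * (\<integral>\<^sup>+a. kk T a a * f a \<partial>lborel)"
  proof (rule nn_integral_cmult)
    have "(\<lambda>a. kk T a a) \<in> borel_measurable borel" by measurable
    then show "(\<lambda>a. kk T a a * f a) \<in> borel_measurable lborel" using assms by simp
  qed
  finally show ?thesis .
qed

lemma prob_rlaw: "prob_space rlaw"
proof
  have "emeasure rlaw (space rlaw) = (\<integral>\<^sup>+a. 1 \<partial>rlaw)" by simp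
  also have "\<dots> = ennreal (1 / Z) * ennreal Z"
    by (subst nn_integral_rlaw) (auto simp: nn_integral_q_diag)
  also have "\<dots> = 1" using Z_pos by (simp add: ennreal_mult[symmetric])
  finally show "emeasure rlaw (space rlaw) = 1" .
qed

text \<open>Bridge marginals are prescribed at interior times only. These are dense in the duration,
  so by \<open>sets_borel_of_cloc\<close> they generate the Borel sets of the loop space.\<close>

lemma times_interior: "{0<..<T} \<subseteq> {0..T}" "{0..T} \<subseteq> closure {0<..<T}"
  using T by auto

text \<open>The mixture over the root is a genuine mixture only if the bridge laws form a kernel. On
  the generating cylinders the mass of B a is an explicit integral, measurable in a, and a stable
  generator suffices.\<close>

lemma measurable_B: "B \<in> rlaw \<rightarrow>\<^sub>M prob_algebra N"
proof -
  define I where "I = {0<..<T}"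
  define \<iota> where "\<iota> = (\<lambda>\<omega> :: real \<Rightarrow> real ^ 'd. restrict \<omega> I)"
  let ?PM = "\<Pi>\<^sub>M t\<in>I. (borel :: (real ^ 'd) measure)"
  let ?pa = "prod_algebra I (\<lambda>_. borel :: (real ^ 'd) measure)"
  define G where "G = {\<iota> -` E \<inter> space N | E. E \<in> ?pa}"
  \<comment> \<open>A nonempty time set allows the index set of a cylinder to be taken nonempty, so
    that its minimum and maximum exist.\<close>
  have T2: "T / 2 \<in> I" using T by (simp add: I_def)
  have "sets N = sets (vimage_algebra (space N) \<iota> ?PM)"
    using sets_borel_of_cloc[OF times_interior, of "closure (cube L) :: (real ^ 'd) set" "{\<omega>. \<omega> 0 = \<omega> T}"]
    unfolding loops_eq \<iota>_def I_def by simp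
  also have "\<dots> = {\<iota> -` E \<inter> space N | E. E \<in> sets ?PM}"
    by (rule sets_vimage_algebra2) (auto simp: \<iota>_def space_PiM)
  also have "\<dots> = sigma_sets (space N) G"
    unfolding sets_PiM G_def by (rule sigma_sets_vimage_commute) (auto simp: \<iota>_def)
  finally have eq: "sets N = sigma_sets (space N) G" .
  have "B \<in> rlaw \<rightarrow>\<^sub>M prob_algebra N"
  proof (rule measurable_prob_algebra_generated[OF eq])
    show "Int_stable G"
    proof (rule Int_stableI)
      fix a b assume "a \<in> G" "b \<in> G"
      then obtain E F where "a = \<iota> -` E \<inter> space N" "b = \<iota> -` F \<inter> space N" "E \<in> ?pa" "F \<in> ?pa" by (auto simp: G_def)
      moreover from this have "E \<inter> F \<in> ?pa" using Int_stable_prod_algebra by (auto simp: Int_stable_def)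
      moreover have "a \<inter> b = \<iota> -` (E \<inter> F) \<inter> space N" using calculation by auto
      ultimately show "a \<inter> b \<in> G" unfolding G_def by blast
    qed
    show "G \<subseteq> Pow (space N)" by (auto simp: G_def)
    show "prob_space (B a)" "sets (B a) = sets N" if "a \<in> space rlaw" for a
      using that prob_B sets_B by (auto simp: space_rlaw)
    fix X assume "X \<in> G"
    then obtain E where E: "E \<in> ?pa" "X = \<iota> -` E \<inter> space N" by (auto simp: G_def)
    obtain J A where J: "E = prod_emb I (\<lambda>_. borel :: (real ^ 'd) measure) J (Pi\<^sub>E J A)" "finite J" "J \<noteq> {}" "J \<subseteq> I"
      "\<And>i. i \<in> J \<Longrightarrow> A i \<in> sets borel"
      using E(1) T2 by (elim prod_algebraE) auto
    obtain n :: nat and t where t: "strict_mono_on {..n} t" "t ` {..n} = J" "t 0 = Min J" "t n = Max J"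
      by (rule strict_mono_enumeration[of J "Min J" "Max J"]) (use J in auto)
    have t0: "0 < t 0" "t n < T" using t J(2,3,4) by (auto simp: I_def)
    \<comment> \<open>\<open>bridge_cylinder\<close> asks for a measurable set at every index, so
      indices beyond n repeat the last set.\<close>
    have At: "A (t (min i n)) \<in> sets borel" for i using J(5) t(2) by auto
    have X: "X = {\<omega> \<in> space N. \<forall>i\<le>n. \<omega> (t i) \<in> A (t (min i n))}"
    proof -
      have "X = {\<omega> \<in> space N. \<forall>s\<in>J. \<omega> s \<in> A s}"
        using J(4) unfolding E(2) J(1) \<iota>_def by (auto simp: prod_emb_def PiE_iff space_PiM Int_absorb1)
      also have "\<dots> = {\<omega> \<in> space N. \<forall>i\<le>n. \<omega> (t i) \<in> A (t (min i n))}"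
        unfolding t(2)[symmetric] by (auto simp: min_def)
      finally show ?thesis .
    qed
    let ?F = "\<lambda>a. ennreal (1 / q T a a) * (\<integral>\<^sup>+x. kk (t 0) a x * indicator (A (t (min 0 n))) x *
       bwd (\<lambda>i x y. kk (t (Suc i) - t i) x y * indicator (A (t (min (Suc i) n))) y) n (\<lambda>y. kk (T - t n) y a) x \<partial>lborel)"
    have F: "emeasure (B a) X = ?F a" if "a \<in> cube L" for a
      unfolding X using bridge_cylinder[OF that t(1) t0, of "\<lambda>i. A (t (min i n))"] At by simp
    show "(\<lambda>a. emeasure (B a) X) \<in> borel_measurable rlaw"
    proof (subst measurable_cong[of _ _ ?F])
      note [measurable] = measurable_kk At
      have "continuous_on (cube L) (\<lambda>a. q T a a)"
        by (rule continuous_on_subset[OF continuous_q_diag closure_subset])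
      then have "(\<lambda>a. q T a a) \<in> borel_measurable (restrict_space borel (cube L))"
        by (rule borel_measurable_continuous_on_restrict)
      then have 1: "(\<lambda>a. ennreal (1 / q T a a)) \<in> borel_measurable rlaw"
        unfolding measurable_cong_sets[OF sets_rlaw refl] by measurable
      have km: "(\<lambda>(x, y). kk (t (Suc i) - t i) x y * indicator (A (t (min (Suc i) n))) y) \<in> borel_measurable (borel \<Otimes>\<^sub>M borel)" for i
        by measurable
      have fm: "(\<lambda>(a, y). kk (T - t n) y a) \<in> borel_measurable (borel \<Otimes>\<^sub>M borel)"
        by measurable
      note [measurable] = measurable_bwd_pair[OF km fm, where n = n]
      have "(\<lambda>a. \<integral>\<^sup>+x. kk (t 0) a x * indicator (A (t (min 0 n))) x *
        bwd (\<lambda>i x y. kk (t (Suc i) - t i) x y * indicator (A (t (min (Suc i) n))) y) n (\<lambda>y. kk (T - t n) y a) x \<partial>lborel) \<in> borel_measurable borel"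
        by measurable
      from measurable_restrict_space1[OF this, of "cube L"]
      have 2: "(\<lambda>a. \<integral>\<^sup>+x. kk (t 0) a x * indicator (A (t (min 0 n))) x *
        bwd (\<lambda>i x y. kk (t (Suc i) - t i) x y * indicator (A (t (min (Suc i) n))) y) n (\<lambda>y. kk (T - t n) y a) x \<partial>lborel) \<in> borel_measurable rlaw"
        unfolding measurable_cong_sets[OF sets_rlaw refl] .
      show "?F \<in> borel_measurable rlaw" by (rule borel_measurable_times_ennreal[OF 1 2])
    qed (simp add: F space_rlaw)
  qed
  then show ?thesis .
qed

abbreviation "loop \<equiv> one_loop_law (cube L) q T B"

lemma space_rlaw_ne: "space rlaw \<noteq> {}"
  using prob_space.not_empty[OF prob_rlaw] .

lemma sets_loop: "sets loop = sets N"
  unfolding one_loop_law_def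
  by (rule sets_bind) (use sets_B space_rlaw space_rlaw_ne in auto)

lemma prob_loop: "prob_space loop"
  unfolding one_loop_law_def
  by (rule prob_space.prob_space_bind[OF prob_rlaw _ measurable_prob_algebraD[OF measurable_B]])
    (auto simp: prob_B space_rlaw)

text \<open>The root density contributes q(a,a), which cancels the normalization of the bridge at a.
  The remaining integral over a joins the last arc to the first one by the semigroup law and yields
  the kernel of duration T - t n + t 0.\<close>

lemma loop_cylinder:
  assumes t: "strict_mono_on {..n} t" "0 < t 0" "t n < T"
    and A[measurable]: "\<And>i. A i \<in> sets borel"
  shows "emeasure loop {\<omega> \<in> space N. \<forall>i\<le>n. \<omega> (t i) \<in> A i} =
    ennreal (1 / Z) * (\<integral>\<^sup>+x. indicator (A 0) x *
       bwd (\<lambda>i x y. kk (t (Suc i) - t i) x y * indicator (A (Suc i)) y) n (\<lambda>y. kk (T - t n + t 0) y x) x \<partial>lborel)"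
proof -
  note [measurable] = measurable_kk
  define k where "k i x y = kk (t (Suc i) - t i) x y * indicator (A (Suc i)) y" for i x y
  have km[measurable]: "(\<lambda>(x, y). k i x y) \<in> borel_measurable (borel \<Otimes>\<^sub>M borel)" for i unfolding k_def by measurable
  have fm: "(\<lambda>(a, y). kk (T - t n) y a) \<in> borel_measurable (borel \<Otimes>\<^sub>M borel)" by measurable
  note bm[measurable] = measurable_bwd_pair[OF km fm, where n = n]
  let ?C = "{\<omega> \<in> space N. \<forall>i\<le>n. \<omega> (t i) \<in> A i}"
  have tI: "t i \<in> {0..T}" if "i \<le> n" for i
  proof -
    have "t 0 \<le> t i" "t i \<le> t n" using t(1) that by (auto simp: strict_mono_on_leD)
    then show ?thesis using t by auto
  qed
  have C: "?C \<in> sets N"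
  proof -
    have [measurable]: "(\<lambda>\<omega>. \<omega> (t i)) \<in> N \<rightarrow>\<^sub>M borel" if "i \<le> n" for i
      by (rule measurable_N_eval[OF tI[OF that]])
    show ?thesis by measurable
  qed
  let ?h = "\<lambda>a x. kk (t 0) a x * indicator (A 0) x * bwd k n (\<lambda>y. kk (T - t n) y a) x"
  have "emeasure loop ?C = (\<integral>\<^sup>+a. emeasure (B a) ?C \<partial>rlaw)"
    unfolding one_loop_law_def
    by (rule emeasure_bind[OF space_rlaw_ne measurable_prob_algebraD[OF measurable_B] C])
  also have "\<dots> = (\<integral>\<^sup>+a. inverse (kk T a a) * (\<integral>\<^sup>+x. ?h a x \<partial>lborel) \<partial>rlaw)"
  proof (rule nn_integral_cong)
    fix a assume "a \<in> space rlaw"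
    then have a: "a \<in> cube L" by (simp add: space_rlaw)
    have "ennreal (1 / q T a a) = inverse (kk T a a)"
      using a T q_diag_pos[OF a] by (simp add: killed_kernel_def inverse_ennreal inverse_eq_divide)
    then show "emeasure (B a) ?C = inverse (kk T a a) * (\<integral>\<^sup>+x. ?h a x \<partial>lborel)"
      using bridge_cylinder[OF a t A] by (simp add: k_def[abs_def])
  qed
  also have "\<dots> = ennreal (1 / Z) * (\<integral>\<^sup>+a. kk T a a * (inverse (kk T a a) * (\<integral>\<^sup>+x. ?h a x \<partial>lborel)) \<partial>lborel)"
    by (rule nn_integral_rlaw) measurable
  also have "(\<integral>\<^sup>+a. kk T a a * (inverse (kk T a a) * (\<integral>\<^sup>+x. ?h a x \<partial>lborel)) \<partial>lborel) = (\<integral>\<^sup>+a. \<integral>\<^sup>+x. ?h a x \<partial>lborel \<partial>lborel)"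
  proof (rule nn_integral_cong)
    fix a :: "real ^ 'd"
    show "kk T a a * (inverse (kk T a a) * (\<integral>\<^sup>+x. ?h a x \<partial>lborel)) = (\<integral>\<^sup>+x. ?h a x \<partial>lborel)"
    proof (cases "a \<in> cube L")
      case True
      then have "kk T a a * inverse (kk T a a) = 1"
        using T q_diag_pos[OF True] by (simp add: killed_kernel_def inverse_ennreal ennreal_mult[symmetric])
      then show ?thesis by (simp add: mult.assoc[symmetric])
    next
      case False
      \<comment> \<open>Off the cube the inverse of the diagonal is infinite, but the kernel leaving
        a vanishes there and so does the whole product.\<close>
      then have "?h a = (\<lambda>x. 0)" by (simp add: killed_kernel_def[of _ _ "t 0"])
      then show ?thesis by (simp only:) simp
    qed
  qed
  also have "\<dots> = (\<integral>\<^sup>+x. \<integral>\<^sup>+a. ?h a x \<partial>lborel \<partial>lborel)"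
    by (rule lborel_pair.Fubini'[symmetric]) measurable
  also have "\<dots> = (\<integral>\<^sup>+x. indicator (A 0) x * bwd k n (\<lambda>y. kk (T - t n + t 0) y x) x \<partial>lborel)"
  proof (rule nn_integral_cong)
    fix x :: "real ^ 'd"
    have bx: "bwd k n (\<lambda>y. kk (t 0) a x * kk (T - t n) y a) x = kk (t 0) a x * bwd k n (\<lambda>y. kk (T - t n) y a) x" for a
      by (rule bwd_cmult[OF km]) measurable
    have bmx: "(\<lambda>a. bwd k n (\<lambda>y. kk (T - t n) y a) x) \<in> borel_measurable borel"
      using measurable_compose[OF measurable_Pair[OF measurable_ident measurable_const[of x]] bm] by simp
    have "(\<integral>\<^sup>+a. ?h a x \<partial>lborel) = (\<integral>\<^sup>+a. indicator (A 0) x * bwd k n (\<lambda>y. kk (t 0) a x * kk (T - t n) y a) x \<partial>lborel)"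
      unfolding bx by (simp add: mult_ac)
    also have "\<dots> = indicator (A 0) x * (\<integral>\<^sup>+a. bwd k n (\<lambda>y. kk (t 0) a x * kk (T - t n) y a) x \<partial>lborel)"
      unfolding bx
    proof (rule nn_integral_cmult)
      have "(\<lambda>a. kk (t 0) a x) \<in> borel_measurable borel" by measurable
      from borel_measurable_times_ennreal[OF this bmx]
      show "(\<lambda>a. kk (t 0) a x * bwd k n (\<lambda>y. kk (T - t n) y a) x) \<in> borel_measurable lborel" by simp
    qed
    also have "(\<integral>\<^sup>+a. bwd k n (\<lambda>y. kk (t 0) a x * kk (T - t n) y a) x \<partial>lborel) =
        bwd k n (\<lambda>y. \<integral>\<^sup>+a. kk (t 0) a x * kk (T - t n) y a \<partial>lborel) x"
      by (rule bwd_nn_integral[OF km]) measurable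
    also have "(\<lambda>y. \<integral>\<^sup>+a. kk (t 0) a x * kk (T - t n) y a \<partial>lborel) = (\<lambda>y. kk (T - t n + t 0) y x)"
      using t by (subst mult.commute) (simp add: kk_semigroup)
    finally show "(\<integral>\<^sup>+a. ?h a x \<partial>lborel) = indicator (A 0) x * bwd k n (\<lambda>y. kk (T - t n + t 0) y x) x" .
  qed
  finally show ?thesis by (simp add: k_def[abs_def])
qed

end

section \<open>The law of the rescaled loop\<close>

lemma continuous_periodic_ext:
  fixes y :: "real \<Rightarrow> 'a::topological_space"
  assumes S: "S > 0" and y: "continuous_on {0..S} y" and per: "y 0 = y S"
  shows "continuous_on UNIV (periodic_ext S y)"
proof -
  have piece: "continuous_on {S * of_int k..S * of_int k + S} (periodic_ext S y)" for k :: int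
  proof -
    have "continuous_on {S * of_int k..S * of_int k + S} (\<lambda>s. y (s - S * of_int k))"
      by (rule continuous_on_compose2[OF y]) (auto intro!: continuous_intros)
    moreover have "y (s - S * of_int k) = periodic_ext S y s" if "s \<in> {S * of_int k..S * of_int k + S}" for s
    proof (cases "s = S * of_int k + S")
      case True
      then have "s / S = of_int (k + 1)" using S by (simp add: field_simps)
      then have "\<lfloor>s / S\<rfloor> = k + 1" by (metis floor_of_int)
      then show ?thesis using True per by (simp add: periodic_ext_def algebra_simps)
    next
      case False
      then have "\<lfloor>s / S\<rfloor> = k" using that S by (intro floor_unique) (auto simp: field_simps)
      then show ?thesis by (simp add: periodic_ext_def)
    qed
    ultimately show ?thesis by (rule continuous_on_eq)
  qed
  have "isCont (periodic_ext S y) s" for s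
  proof -
    define k where "k = \<lfloor>s / S\<rfloor>"
    have k: "of_int k \<le> s / S" "s / S < of_int k + 1" unfolding k_def by linarith+
    then have k': "S * of_int k \<le> s" "s < S * of_int k + S" using S by (auto simp: field_simps)
    \<comment> \<open>The point s may be the left end of its period, so the preceding period is
      glued on to obtain an open interval around s.\<close>
    have "continuous_on ({S * of_int (k - 1)..S * of_int (k - 1) + S} \<union> {S * of_int k..S * of_int k + S}) (periodic_ext S y)"
      by (rule continuous_on_closed_Un[OF _ _ piece piece]) auto
    then have "continuous_on {S * of_int k - S<..<S * of_int k + S} (periodic_ext S y)"
      by (rule continuous_on_subset) (auto simp: algebra_simps)
    then show ?thesis using k' S by (simp add: continuous_on_eq_continuous_at)
  qed
  then show ?thesis by (simp add: continuous_on_eq_continuous_at)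
qed

context cube_loop
begin

lemma period_arg: "L\<^sup>2 * (s - S * of_int \<lfloor>s / S\<rfloor>) \<in> {0..T}"
proof -
  have "0 \<le> s - S * of_int \<lfloor>s / S\<rfloor>" "s - S * of_int \<lfloor>s / S\<rfloor> \<le> S"
    using floor_divide_lower[OF S_pos, of s] floor_divide_upper[OF S_pos, of s] by (auto simp: algebra_simps)
  moreover have "L\<^sup>2 * S = T" using L by (simp add: S_def)
  ultimately show ?thesis
    using mult_left_mono[of "s - S * of_int \<lfloor>s / S\<rfloor>" S "L\<^sup>2"] by auto
qed

lemma rescaled_loop_XD:
  assumes "\<omega> \<in> space N" shows "rescaled_loop L T \<omega> \<in> topspace XD"
proof -
  have w: "continuous_on {0..T} \<omega>" "\<omega> ` {0..T} \<subseteq> closure (cube L)" "\<omega> 0 = \<omega> T"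
    using assms by (auto simp: topspace_loops paths_def)
  have LS: "L\<^sup>2 * S = T" using L by (simp add: S_def)
  have "continuous_on UNIV (periodic_ext S (\<lambda>s. (1 / L) *\<^sub>R \<omega> (L\<^sup>2 * s)))"
  proof (rule continuous_periodic_ext[OF S_pos])
    have "continuous_on {0..S} (\<lambda>s. \<omega> (L\<^sup>2 * s))"
    proof (rule continuous_on_compose2[OF w(1)])
      show "(\<lambda>s. L\<^sup>2 * s) ` {0..S} \<subseteq> {0..T}" using mult_left_mono[of _ S "L\<^sup>2"] LS by auto
    qed (intro continuous_intros)
    then show "continuous_on {0..S} (\<lambda>s. (1 / L) *\<^sub>R \<omega> (L\<^sup>2 * s))" by (intro continuous_intros)
  qed (simp add: LS w)
  moreover have "(1 / L) *\<^sub>R \<omega> t \<in> closure (cube 1)" if "t \<in> {0..T}" for t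
  proof -
    have "\<omega> t \<in> closure (cube L)" using w(2) that by blast
    then show ?thesis using scaleR_mem_closure_cube[OF L, of "(1 / L) *\<^sub>R \<omega> t"] L by simp
  qed
  ultimately show ?thesis
    using period_arg unfolding topspace_XD rescaled_loop_def S_def[symmetric] by (auto simp: periodic_ext_def)
qed

lemma measurable_rescaled_loop: "rescaled_loop L T \<in> N \<rightarrow>\<^sub>M borel_of XD"
proof (rule measurable_into_XD[OF rescaled_loop_XD])
  fix s
  have [measurable]: "(\<lambda>\<omega>. \<omega> (L\<^sup>2 * (s - S * of_int \<lfloor>s / S\<rfloor>))) \<in> N \<rightarrow>\<^sub>M borel"
    by (rule measurable_N_eval[OF period_arg])
  show "(\<lambda>\<omega>. rescaled_loop L T \<omega> s) \<in> N \<rightarrow>\<^sub>M borel"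
    unfolding rescaled_loop_def S_def[symmetric] periodic_ext_def by measurable
qed

definition path_law :: "(real \<Rightarrow> real ^ 'd) measure" where
  "path_law = distr loop (borel_of XD) (rescaled_loop L T)"

lemma measurable_rescaled_loop': "rescaled_loop L T \<in> loop \<rightarrow>\<^sub>M borel_of XD"
  using measurable_rescaled_loop by (simp add: measurable_cong_sets[OF sets_loop refl])

text \<open>Scaling space by 1/L and time by 1/L^2 turns every kernel of the chain into a unit
  kernel. The outer integral supplies one more factor L^d, which the closing kernel absorbs.\<close>

lemma loop_path_law_path_law: "loop_path_law S path_law"
  unfolding loop_path_law_def
proof (intro conjI allI impI)
  show "prob_space path_law" unfolding path_law_def
    by (rule prob_space.prob_space_distr[OF prob_loop measurable_rescaled_loop'])
  show "sets path_law = sets (borel_of XD)" by (simp add: path_law_def)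
  fix n :: nat and s and A :: "nat \<Rightarrow> (real ^ 'd) set"
  assume s: "strict_mono_on {..n} s" "0 < s 0" "s n < S" and A: "\<forall>i. A i \<in> sets borel"
  note [measurable] = A[rule_format] measurable_kk measurable_unit_kernel
  define A' where "A' i = {x. (1 / L) *\<^sub>R x \<in> A i}" for i
  have A'[measurable]: "A' i \<in> sets borel" for i unfolding A'_def by measurable
  define t where "t i = L\<^sup>2 * s i" for i
  have LS: "L\<^sup>2 * S = T" using L by (simp add: S_def)
  have t: "strict_mono_on {..n} t" "0 < t 0" "t n < T"
    using s L mult_strict_left_mono[of "s n" S "L\<^sup>2"] LS by (auto simp: t_def strict_mono_on_def)
  have ind: "indicator (A' i) (L *\<^sub>R x) = (indicator (A i) x :: ennreal)" for i x
    using L by (simp add: A'_def indicator_def)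
  let ?C = "{\<gamma> \<in> topspace XD. \<forall>i\<le>n. \<gamma> (s i) \<in> A i}"
  have C: "?C \<in> sets (borel_of XD)"
  proof -
    note [measurable] = measurable_XD_eval
    have "{\<gamma> \<in> space (borel_of XD). \<forall>i\<le>n. \<gamma> (s i) \<in> A i} \<in> sets (borel_of XD)" by measurable
    then show ?thesis unfolding space_borel_of .
  qed
  have sS: "0 < s i \<and> s i < S" if "i \<le> n" for i
  proof -
    have "s 0 \<le> s i" "s i \<le> s n" using s(1) that by (auto simp: strict_mono_on_leD)
    then show ?thesis using s by auto
  qed
  have "rescaled_loop L T \<omega> (s i) = (1 / L) *\<^sub>R \<omega> (t i)" if "i \<le> n" for i and \<omega> :: "real \<Rightarrow> real ^ 'd"
  proof -
    have "\<lfloor>s i / S\<rfloor> = 0" using sS[OF that] by (intro floor_unique) auto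
    then show ?thesis by (simp add: rescaled_loop_def S_def[symmetric] periodic_ext_def t_def)
  qed
  then have "rescaled_loop L T -` ?C \<inter> space loop = {\<omega> \<in> space N. \<forall>i\<le>n. \<omega> (t i) \<in> A' i}"
    using rescaled_loop_XD by (auto simp: sets_eq_imp_space_eq[OF sets_loop] A'_def)
  then have "emeasure path_law ?C = emeasure loop {\<omega> \<in> space N. \<forall>i\<le>n. \<omega> (t i) \<in> A' i}"
    unfolding path_law_def by (simp add: emeasure_distr[OF measurable_rescaled_loop' C])
  also have "\<dots> = ennreal (1 / Z) * (\<integral>\<^sup>+x. indicator (A' 0) x *
       bwd (\<lambda>i x y. kk (t (Suc i) - t i) x y * indicator (A' (Suc i)) y) n (\<lambda>y. kk (T - t n + t 0) y x) x \<partial>lborel)"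
    by (rule loop_cylinder[OF t A'])
  also have "(\<integral>\<^sup>+x. indicator (A' 0) x *
       bwd (\<lambda>i x y. kk (t (Suc i) - t i) x y * indicator (A' (Suc i)) y) n (\<lambda>y. kk (T - t n + t 0) y x) x \<partial>lborel)
     = (\<integral>\<^sup>+x. indicator (A 0) x *
          bwd (\<lambda>i x y. unit_kernel (s (Suc i) - s i) x y * indicator (A (Suc i)) y) n
            (\<lambda>y. unit_kernel (S - s n + s 0) y x) x \<partial>lborel)"
  proof -
    define k where "k i x y = kk (t (Suc i) - t i) x y * indicator (A' (Suc i)) y" for i x y
    define k' where "k' i x y = unit_kernel (s (Suc i) - s i) x y * indicator (A (Suc i)) y" for i and x y :: "real ^ 'd"
    have km[measurable]: "(\<lambda>(x, y). k i x y) \<in> borel_measurable (borel \<Otimes>\<^sub>M borel)" for i unfolding k_def by measurable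
    have k'm[measurable]: "(\<lambda>(x, y). k' i x y) \<in> borel_measurable (borel \<Otimes>\<^sub>M borel)" for i unfolding k'_def by measurable
    have kk': "ennreal (L ^ DIM(real ^ 'd)) * k i (L *\<^sub>R x) (L *\<^sub>R y) = k' i x y" for i x y
    proof -
      have "(t (Suc i) - t i) / L\<^sup>2 = s (Suc i) - s i" using L by (simp add: t_def right_diff_distrib[symmetric])
      then show ?thesis using kk_scale[of "t (Suc i) - t i" x y] by (simp add: k_def k'_def ind mult.assoc[symmetric])
    qed
    have fm: "(\<lambda>(x, y). kk (T - t n + t 0) y x) \<in> borel_measurable (borel \<Otimes>\<^sub>M borel)" by measurable
    note [measurable] = measurable_bwd_pair[OF km fm, where n = n]
    have "(\<integral>\<^sup>+x. indicator (A' 0) x * bwd k n (\<lambda>y. kk (T - t n + t 0) y x) x \<partial>lborel)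
      = (\<integral>\<^sup>+x. ennreal (L ^ DIM(real ^ 'd)) * (indicator (A' 0) (L *\<^sub>R x) * bwd k n (\<lambda>y. kk (T - t n + t 0) y (L *\<^sub>R x)) (L *\<^sub>R x)) \<partial>lborel)"
      by (rule nn_integral_scaleR[OF L]) measurable
    also have "\<dots> = (\<integral>\<^sup>+x. indicator (A 0) x * bwd k' n (\<lambda>y. unit_kernel (S - s n + s 0) y x) x \<partial>lborel)"
    proof (rule nn_integral_cong)
      fix x :: "real ^ 'd"
      have "bwd k n (\<lambda>y. kk (T - t n + t 0) y (L *\<^sub>R x)) (L *\<^sub>R x) = bwd k' n (\<lambda>y. kk (T - t n + t 0) (L *\<^sub>R y) (L *\<^sub>R x)) x"
        by (rule bwd_scaleR[OF L km _ kk']) measurable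
      then have "ennreal (L ^ DIM(real ^ 'd)) * bwd k n (\<lambda>y. kk (T - t n + t 0) y (L *\<^sub>R x)) (L *\<^sub>R x) =
        bwd k' n (\<lambda>y. ennreal (L ^ DIM(real ^ 'd)) * kk (T - t n + t 0) (L *\<^sub>R y) (L *\<^sub>R x)) x"
        by (subst bwd_cmult[OF k'm]) measurable
      also have "(\<lambda>y. ennreal (L ^ DIM(real ^ 'd)) * kk (T - t n + t 0) (L *\<^sub>R y) (L *\<^sub>R x)) = (\<lambda>y. unit_kernel (S - s n + s 0) y x)"
      proof -
        have "(T - t n + t 0) / L\<^sup>2 = S - s n + s 0"
          using L by (simp add: t_def S_def add_divide_distrib diff_divide_distrib)
        then show ?thesis using kk_scale[of "T - t n + t 0" _ x] by simp
      qed
      finally show "ennreal (L ^ DIM(real ^ 'd)) * (indicator (A' 0) (L *\<^sub>R x) * bwd k n (\<lambda>y. kk (T - t n + t 0) y (L *\<^sub>R x)) (L *\<^sub>R x))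
        = indicator (A 0) x * bwd k' n (\<lambda>y. unit_kernel (S - s n + s 0) y x) x"
        unfolding ind by (simp add: mult.left_commute)
    qed
    finally show ?thesis unfolding k_def k'_def .
  qed
  also have "ennreal (1 / Z) = inverse (partition_function S)"
    using Z_pos by (simp add: partition_function_eq inverse_ennreal inverse_eq_divide)
  finally show "emeasure path_law ?C = inverse (partition_function S) * (\<integral>\<^sup>+x. indicator (A 0) x *
          bwd (\<lambda>i x y. unit_kernel (s (Suc i) - s i) x y * indicator (A (Suc i)) y) n
            (\<lambda>y. unit_kernel (S - s n + s 0) y x) x \<partial>lborel)" .
qed

end

section \<open>Two windows of the loop\<close>

lemma measurable_shift: "shift u \<in> borel_of (XD :: (real \<Rightarrow> real ^ 'd) topology) \<rightarrow>\<^sub>M borel_of XD"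
proof (rule measurable_into_XD)
  show "(\<lambda>\<gamma>. shift u \<gamma> t) \<in> borel_of (XD :: (real \<Rightarrow> real ^ 'd) topology) \<rightarrow>\<^sub>M borel" for t
    unfolding shift_def by (rule measurable_XD_eval)
qed (simp add: shift_XD)

lemma ennreal_exp_cancel: "ennreal (exp a) * ennreal (exp (- a)) = 1"
  by (simp add: ennreal_mult[symmetric] exp_add[symmetric])

text \<open>The ground state times its reciprocal is only the indicator of the cube; next to a
  kernel it can be cancelled because kernels vanish off the cube.\<close>

lemma unit_kernel_ground_left: "ground_state x * inv_ground_state x * unit_kernel t x y = unit_kernel t x y"
  unfolding ground_state_inv by (auto simp: killed_kernel_def)

lemma unit_kernel_ground_right: "ground_state y * inv_ground_state y * unit_kernel t x y = unit_kernel t x y"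
  unfolding ground_state_inv by (auto simp: killed_kernel_def)

context tab_process
begin

text \<open>
  The density of two windows of length \<open>2 m\<close> of the loop with respect to \<open>Q \<Otimes> Q\<close>: the windows run from \<open>a1\<close> to \<open>b1\<close>
  and from \<open>a2\<close> to \<open>b2\<close>, and \<open>g1\<close>, \<open>g2\<close> are the durations of the two arcs of the loop between them.
\<close>

definition window_ratio :: "real \<Rightarrow> real \<Rightarrow> real \<Rightarrow> real \<Rightarrow> real ^ 'd \<Rightarrow> real ^ 'd \<Rightarrow> real ^ 'd \<Rightarrow> real ^ 'd \<Rightarrow> ennreal" where
  "window_ratio S m g1 g2 a1 b1 a2 b2 =
     inverse (partition_function S) * ennreal (exp (- (gap * (2 * m)))) * ennreal (exp (- (gap * (2 * m))))
     * (inv_ground_state a1 * inv_ground_state b1 * inv_ground_state a2 * inv_ground_state b2)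
     * (unit_kernel g1 b1 a2 * unit_kernel g2 b2 a1)"

text \<open>Both sides reduce to the same nested integral. Each tab window carries a ground state at
  both ends and the factor exp(gap 2 m); \<open>window_ratio\<close> divides these out and inserts
  the two kernels of the connecting arcs and the trace. The window ends are among the times, so the
  ratio is a function of the chain.\<close>

lemma two_window_cylinder:
  fixes n1 n2 :: nat
  assumes P: "loop_path_law S P" and m: "m > 0" and uv: "m < u" "u + m < v - m" "v + m < S"
    and s1: "strict_mono_on {..n1} s1" "s1 0 = - m" "s1 n1 = m"
    and s2: "strict_mono_on {..n2} s2" "s2 0 = - m" "s2 n2 = m"
    and A1: "\<And>i. A1 i \<in> sets borel" and A2: "\<And>i. A2 i \<in> sets borel"
  shows "emeasure P {\<gamma> \<in> topspace XD. (\<forall>i\<le>n1. \<gamma> (u + s1 i) \<in> A1 i) \<and> (\<forall>i\<le>n2. \<gamma> (v + s2 i) \<in> A2 i)} =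
    (\<integral>\<^sup>+\<gamma>1. (\<Prod>i\<le>n1. indicator (A1 i) (\<gamma>1 (s1 i))) * (\<integral>\<^sup>+\<gamma>2. (\<Prod>i\<le>n2. indicator (A2 i) (\<gamma>2 (s2 i))) *
       window_ratio S m (v - u - 2 * m) (S - (v + m) + (u - m)) (\<gamma>1 (s1 0)) (\<gamma>1 (s1 n1)) (\<gamma>2 (s2 0)) (\<gamma>2 (s2 n2)) \<partial>Q) \<partial>Q)"
proof -
  note [measurable] = A1 A2 measurable_unit_kernel
  define g1 where "g1 = v - u - 2 * m"
  define g2 where "g2 = S - (v + m) + (u - m)"
  define E where "E = ennreal (exp (gap * (2 * m)))"
  define iE where "iE = ennreal (exp (- (gap * (2 * m))))"
  define iT where "iT = inverse (partition_function S)"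
  have EE: "E * iE = 1" unfolding E_def iE_def by (rule ennreal_exp_cancel)
  define k1 where "k1 i x y = unit_kernel (s1 (Suc i) - s1 i) x y * indicator (A1 (Suc i)) y" for i and x y :: "real ^ 'd"
  define k2 where "k2 i x y = unit_kernel (s2 (Suc i) - s2 i) x y * indicator (A2 (Suc i)) y" for i and x y :: "real ^ 'd"
  have k1m[measurable]: "(\<lambda>(x, y). k1 i x y) \<in> borel_measurable (borel \<Otimes>\<^sub>M borel)" for i unfolding k1_def by measurable
  have k2m[measurable]: "(\<lambda>(x, y). k2 i x y) \<in> borel_measurable (borel \<Otimes>\<^sub>M borel)" for i unfolding k2_def by measurable
  have fm: "(\<lambda>(x, w). unit_kernel g2 w x) \<in> borel_measurable (borel \<Otimes>\<^sub>M borel)" by measurable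
  note bm[measurable] = measurable_bwd_pair[OF k2m fm, where n = n2]
  \<comment> \<open>The rest of the loop once the first window, begun at a, has ended at b: across
    the gap, through the second window, and along the arc containing the root back to a.\<close>
  define J where "J a b = (\<integral>\<^sup>+y. unit_kernel g1 b y * indicator (A2 0) y * bwd k2 n2 (\<lambda>w. unit_kernel g2 w a) y \<partial>lborel)" for a b
  have Jm[measurable]: "(\<lambda>(a, b). J a b) \<in> borel_measurable (borel \<Otimes>\<^sub>M borel)" unfolding J_def by measurable
  have Jm': "J a \<in> borel_measurable borel" for a
    using measurable_compose[OF measurable_Pair[OF measurable_const[of a] measurable_ident] Jm] by simp

  \<comment> \<open>The times of both windows in one sequence; index \<open>Suc n1\<close> is the
    start of the second window.\<close>
  define s where "s i = (if i \<le> n1 then u + s1 i else v + s2 (i - Suc n1))" for i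
  define A where "A i = (if i \<le> n1 then A1 i else A2 (i - Suc n1))" for i
  define n where "n = n1 + Suc n2"
  have s1r: "s1 i \<le> m" if "i \<le> n1" for i
    using s1(1,3) that strict_mono_on_leD[OF s1(1), of i n1] by simp
  have s2r: "- m \<le> s2 i" if "i \<le> n2" for i
    using s2(1,2) that strict_mono_on_leD[OF s2(1), of 0 i] by simp
  have sm: "strict_mono_on {..n} s"
  proof (rule strict_mono_onI)
    fix i j assume ij: "i \<in> {..n}" "j \<in> {..n}" "i < j"
    show "s i < s j"
    proof (cases "j \<le> n1")
      case True
      then show ?thesis using ij s1(1) by (auto simp: s_def strict_mono_on_def)
    next
      case False
      show ?thesis
      proof (cases "i \<le> n1")
        case True
        moreover have "j - Suc n1 \<le> n2" using ij by (simp add: n_def)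
        ultimately show ?thesis using False s1r[of i] s2r[of "j - Suc n1"] uv by (simp add: s_def)
      next
        case F: False
        have "i - Suc n1 < j - Suc n1" "j - Suc n1 \<le> n2" using ij F by (auto simp: n_def)
        then have "s2 (i - Suc n1) < s2 (j - Suc n1)"
          using s2(1) by (intro strict_mono_onD[OF s2(1)]) auto
        then show ?thesis using F False by (simp add: s_def)
      qed
    qed
  qed
  have s0: "s 0 = u - m" and sn: "s n = v + m" using s1 s2 by (auto simp: s_def n_def)
  have sets: "{\<gamma> \<in> topspace XD. (\<forall>i\<le>n1. \<gamma> (u + s1 i) \<in> A1 i) \<and> (\<forall>i\<le>n2. \<gamma> (v + s2 i) \<in> A2 i)} =
     {\<gamma> \<in> topspace XD. \<forall>i\<le>n. \<gamma> (s i) \<in> A i}"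
  proof -
    have "(\<forall>i\<le>n. \<gamma> (s i) \<in> A i) \<longleftrightarrow> (\<forall>i\<le>n1. \<gamma> (u + s1 i) \<in> A1 i) \<and> (\<forall>i\<le>n2. \<gamma> (v + s2 i) \<in> A2 i)" for \<gamma> :: "real \<Rightarrow> real ^ 'd"
    proof (intro iffI conjI allI impI)
      assume a: "\<forall>i\<le>n. \<gamma> (s i) \<in> A i"
      show "\<gamma> (u + s1 i) \<in> A1 i" if "i \<le> n1" for i using a[rule_format, of i] that by (simp add: s_def A_def n_def)
      show "\<gamma> (v + s2 i) \<in> A2 i" if "i \<le> n2" for i using a[rule_format, of "Suc n1 + i"] that by (simp add: s_def A_def n_def)
    next
      fix i assume a: "(\<forall>i\<le>n1. \<gamma> (u + s1 i) \<in> A1 i) \<and> (\<forall>i\<le>n2. \<gamma> (v + s2 i) \<in> A2 i)" and i: "i \<le> n"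
      show "\<gamma> (s i) \<in> A i"
      proof (cases "i \<le> n1")
        case False
        then have "i - Suc n1 \<le> n2" using i by (simp add: n_def)
        then show ?thesis using a False by (simp add: s_def A_def)
      qed (use a in \<open>simp add: s_def A_def\<close>)
    qed
    then show ?thesis by simp
  qed
  define k where "k i x y = unit_kernel (s (Suc i) - s i) x y * indicator (A (Suc i)) y" for i and x y :: "real ^ 'd"
  \<comment> \<open>The chain is cut around its kernel of index \<open>n1\<close>, the one that
    crosses the gap between the windows.\<close>
  have kn: "bwd k n f = bwd k1 n1 (\<lambda>z. \<integral>\<^sup>+y. unit_kernel g1 z y * indicator (A2 0) y * bwd k2 n2 f y \<partial>lborel)" for f
  proof -
    have "bwd k n f = bwd k n1 (bwd (\<lambda>i. k (n1 + i)) (1 + n2) f)"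
      unfolding n_def by (subst bwd_append) simp
    also have "bwd (\<lambda>i. k (n1 + i)) (1 + n2) f = (\<lambda>z. \<integral>\<^sup>+y. k n1 z y * bwd (\<lambda>i. k (n1 + (1 + i))) n2 f y \<partial>lborel)"
      by (subst bwd_append) simp
    also have "(\<lambda>i. k (n1 + (1 + i))) = k2"
      by (auto simp: k_def k2_def s_def A_def fun_eq_iff)
    also have "k n1 = (\<lambda>z y. unit_kernel g1 z y * indicator (A2 0) y)"
      using s1 s2 by (auto simp: k_def s_def A_def g1_def fun_eq_iff algebra_simps)
    also have "bwd k n1 (\<lambda>z. \<integral>\<^sup>+y. unit_kernel g1 z y * indicator (A2 0) y * bwd k2 n2 f y \<partial>lborel) =
      bwd k1 n1 (\<lambda>z. \<integral>\<^sup>+y. unit_kernel g1 z y * indicator (A2 0) y * bwd k2 n2 f y \<partial>lborel)"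
      by (rule bwd_cong) (auto simp: k_def k1_def s_def A_def)
    finally show ?thesis .
  qed
  have "emeasure P {\<gamma> \<in> topspace XD. \<forall>i\<le>n. \<gamma> (s i) \<in> A i} =
        inverse (partition_function S) * (\<integral>\<^sup>+x. indicator (A 0) x * bwd k n (\<lambda>y. unit_kernel (S - s n + s 0) y x) x \<partial>lborel)"
    using P sm uv A1 A2 unfolding loop_path_law_def k_def s0 sn by (auto simp: A_def s0 sn)
  also have "\<dots> = iT * (\<integral>\<^sup>+x. indicator (A1 0) x * bwd k1 n1 (J x) x \<partial>lborel)"
    unfolding kn J_def s0 sn g2_def iT_def by (simp add: A_def)
  finally have lhs: "emeasure P {\<gamma> \<in> topspace XD. \<forall>i\<le>n. \<gamma> (s i) \<in> A i} = iT * (\<integral>\<^sup>+x. indicator (A1 0) x * bwd k1 n1 (J x) x \<partial>lborel)" .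

  let ?R = "window_ratio S m g1 g2"
  have Rm[measurable]: "(\<lambda>(a2, b2). ?R a1 b1 a2 b2) \<in> borel_measurable (borel \<Otimes>\<^sub>M borel)" for a1 b1
    unfolding window_ratio_def by measurable
  have inner: "(\<integral>\<^sup>+\<gamma>2. (\<Prod>i\<le>n2. indicator (A2 i) (\<gamma>2 (s2 i))) * ?R a1 b1 (\<gamma>2 (s2 0)) (\<gamma>2 (s2 n2)) \<partial>Q) =
     iT * iE * (inv_ground_state a1 * inv_ground_state b1) * J a1 b1" for a1 b1
  proof -
    have "(\<integral>\<^sup>+\<gamma>2. (\<Prod>i\<le>n2. indicator (A2 i) (\<gamma>2 (s2 i))) * ?R a1 b1 (\<gamma>2 (s2 0)) (\<gamma>2 (s2 n2)) \<partial>Q) =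
      (\<integral>\<^sup>+y. ground_state y * indicator (A2 0) y * bwd k2 n2 (\<lambda>w. E * ground_state w * ?R a1 b1 y w) y \<partial>lborel)"
      using tab_cylinder[OF s2(1) A2 Rm[of a1 b1]] s2 by (simp add: k2_def[abs_def] E_def)
    also have "\<dots> = (\<integral>\<^sup>+y. (iT * iE * (inv_ground_state a1 * inv_ground_state b1)) *
        (unit_kernel g1 b1 y * indicator (A2 0) y * bwd k2 n2 (\<lambda>w. unit_kernel g2 w a1) y) \<partial>lborel)"
    proof (rule nn_integral_cong)
      fix y :: "real ^ 'd"
      let ?c = "iT * iE * (inv_ground_state a1 * inv_ground_state b1) * (inv_ground_state y * unit_kernel g1 b1 y)"
      have "E * ground_state w * ?R a1 b1 y w = ?c * unit_kernel g2 w a1" for w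
      proof -
        have "E * ground_state w * ?R a1 b1 y w =
          (E * iE) * ?c * (ground_state w * inv_ground_state w * unit_kernel g2 w a1)"
          unfolding window_ratio_def iE_def[symmetric] iT_def[symmetric] by (simp only: mult_ac)
        then show ?thesis unfolding EE unit_kernel_ground_left by simp
      qed
      then have "bwd k2 n2 (\<lambda>w. E * ground_state w * ?R a1 b1 y w) y = bwd k2 n2 (\<lambda>w. ?c * unit_kernel g2 w a1) y"
        by simp
      also have "\<dots> = ?c * bwd k2 n2 (\<lambda>w. unit_kernel g2 w a1) y"
        by (rule bwd_cmult[OF k2m]) measurable
      finally have "ground_state y * indicator (A2 0) y * bwd k2 n2 (\<lambda>w. E * ground_state w * ?R a1 b1 y w) y =
        (iT * iE * (inv_ground_state a1 * inv_ground_state b1)) *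
        ((ground_state y * inv_ground_state y * unit_kernel g1 b1 y) * indicator (A2 0) y * bwd k2 n2 (\<lambda>w. unit_kernel g2 w a1) y)"
        by (simp only: mult_ac)
      then show "ground_state y * indicator (A2 0) y * bwd k2 n2 (\<lambda>w. E * ground_state w * ?R a1 b1 y w) y =
        (iT * iE * (inv_ground_state a1 * inv_ground_state b1)) *
        (unit_kernel g1 b1 y * indicator (A2 0) y * bwd k2 n2 (\<lambda>w. unit_kernel g2 w a1) y)"
        unfolding unit_kernel_ground_right .
    qed
    also have "\<dots> = iT * iE * (inv_ground_state a1 * inv_ground_state b1) * J a1 b1"
      unfolding J_def
    proof (rule nn_integral_cmult)
      have "(\<lambda>y. bwd k2 n2 (\<lambda>w. unit_kernel g2 w a1) y) \<in> borel_measurable borel"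
        by (rule measurable_bwd[OF k2m]) measurable
      moreover have "(\<lambda>y. unit_kernel g1 b1 y * indicator (A2 0) y) \<in> borel_measurable borel" by measurable
      ultimately show "(\<lambda>y. unit_kernel g1 b1 y * indicator (A2 0) y * bwd k2 n2 (\<lambda>w. unit_kernel g2 w a1) y) \<in> borel_measurable lborel"
        by (simp add: borel_measurable_times_ennreal)
    qed
    finally show ?thesis .
  qed
  have Jz: "ground_state z * inv_ground_state z * J x z = J x z" for x z
  proof (cases "z \<in> cube 1")
    case False
    then have "J x z = 0" unfolding J_def by (simp add: killed_kernel_def[of _ _ g1])
    then show ?thesis by simp
  qed (simp add: ground_state_inv)
  have Jx: "ground_state x * inv_ground_state x * bwd k1 n1 (J x) x = bwd k1 n1 (J x) x" for x
  proof (cases "x \<in> cube 1")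
    case False
    \<comment> \<open>The zero function is written as a product so that \<open>bwd_cmult\<close> can
      extract the factor 0.\<close>
    have "bwd k2 n2 (\<lambda>w. unit_kernel g2 w x) y = bwd k2 n2 (\<lambda>w. 0 * 0) y" for y
      using False by (simp add: killed_kernel_def)
    also have "bwd k2 n2 (\<lambda>w. 0 * 0) y = 0 * bwd k2 n2 (\<lambda>w. 0) y" for y
      by (rule bwd_cmult[OF k2m]) simp
    finally have "J x = (\<lambda>z. 0 * 0)" unfolding J_def by simp
    moreover have "bwd k1 n1 (\<lambda>w. 0 * 0) x = 0 * bwd k1 n1 (\<lambda>w. 0) x"
      by (rule bwd_cmult[OF k1m]) simp
    ultimately show ?thesis by simp
  qed (simp add: ground_state_inv)
  have m1: "(\<lambda>(a, b). iT * iE * (inv_ground_state a * inv_ground_state b) * J a b) \<in> borel_measurable (borel \<Otimes>\<^sub>M borel)"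
    by measurable
  have "(\<integral>\<^sup>+\<gamma>1. (\<Prod>i\<le>n1. indicator (A1 i) (\<gamma>1 (s1 i))) * (\<integral>\<^sup>+\<gamma>2. (\<Prod>i\<le>n2. indicator (A2 i) (\<gamma>2 (s2 i))) *
       ?R (\<gamma>1 (s1 0)) (\<gamma>1 (s1 n1)) (\<gamma>2 (s2 0)) (\<gamma>2 (s2 n2)) \<partial>Q) \<partial>Q) =
     (\<integral>\<^sup>+x. ground_state x * indicator (A1 0) x *
       bwd k1 n1 (\<lambda>z. E * ground_state z * (iT * iE * (inv_ground_state x * inv_ground_state z) * J x z)) x \<partial>lborel)"
    unfolding inner using tab_cylinder[OF s1(1) A1 m1] s1 by (simp add: k1_def[abs_def] E_def)
  also have "\<dots> = (\<integral>\<^sup>+x. iT * (indicator (A1 0) x * bwd k1 n1 (J x) x) \<partial>lborel)"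
  proof (rule nn_integral_cong)
    fix x :: "real ^ 'd"
    have "E * ground_state z * (iT * iE * (inv_ground_state x * inv_ground_state z) * J x z) = (iT * inv_ground_state x) * J x z" for z
    proof -
      have "E * ground_state z * (iT * iE * (inv_ground_state x * inv_ground_state z) * J x z) =
         (E * iE) * (iT * inv_ground_state x) * (ground_state z * inv_ground_state z * J x z)"
        by (simp only: mult_ac)
      then show ?thesis unfolding EE Jz by simp
    qed
    then have "bwd k1 n1 (\<lambda>z. E * ground_state z * (iT * iE * (inv_ground_state x * inv_ground_state z) * J x z)) x
      = bwd k1 n1 (\<lambda>z. (iT * inv_ground_state x) * J x z) x" by simp
    also have "\<dots> = (iT * inv_ground_state x) * bwd k1 n1 (J x) x"
      by (rule bwd_cmult[OF k1m Jm'])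
    finally have "ground_state x * indicator (A1 0) x * bwd k1 n1 (\<lambda>z. E * ground_state z * (iT * iE * (inv_ground_state x * inv_ground_state z) * J x z)) x
      = iT * (indicator (A1 0) x * (ground_state x * inv_ground_state x * bwd k1 n1 (J x) x))"
      by (simp only: mult_ac)
    then show "ground_state x * indicator (A1 0) x * bwd k1 n1 (\<lambda>z. E * ground_state z * (iT * iE * (inv_ground_state x * inv_ground_state z) * J x z)) x
      = iT * (indicator (A1 0) x * bwd k1 n1 (J x) x)" unfolding Jx .
  qed
  also have "\<dots> = iT * (\<integral>\<^sup>+x. indicator (A1 0) x * bwd k1 n1 (J x) x \<partial>lborel)"
  proof (rule nn_integral_cmult)
    have "(\<lambda>x. bwd k1 n1 (J x) x) \<in> borel_measurable borel"
      using measurable_compose[OF measurable_Pair[OF measurable_ident measurable_ident] measurable_bwd_pair[OF k1m Jm, where n = n1]] by simp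
    then show "(\<lambda>x. indicator (A1 0) x * bwd k1 n1 (J x) x) \<in> borel_measurable lborel"
      using A1 by (simp add: borel_measurable_times_ennreal)
  qed
  finally show ?thesis unfolding sets lhs g1_def g2_def by simp
qed

end

context tab_process
begin

lemma enumerate_window:
  assumes J: "finite J" "J \<subseteq> {- m..m}" and m: "m > 0"
  obtains n :: nat and s :: "nat \<Rightarrow> real" where "strict_mono_on {..n} s" "s 0 = - m" "s n = m" "s ` {..n} = insert (- m) (insert m J)"
  by (rule strict_mono_enumeration[of "insert (- m) (insert m J)" "- m" m]) (use assms in auto)

lemma measurable_window_ratio:
  "(\<lambda>\<gamma>. window_ratio S m g1 g2 (fst \<gamma> (- m)) (fst \<gamma> m) (snd \<gamma> (- m)) (snd \<gamma> m)) \<in> borel_measurable (Q \<Otimes>\<^sub>M Q)"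
proof -
  note [measurable] = measurable_unit_kernel
  have e: "(\<lambda>\<gamma>. \<gamma> t) \<in> Q \<rightarrow>\<^sub>M borel" for t
    by (simp add: measurable_cong_sets[OF sets_Q refl] measurable_XD_eval)
  have [measurable]: "(\<lambda>\<gamma>. fst \<gamma> t) \<in> Q \<Otimes>\<^sub>M Q \<rightarrow>\<^sub>M borel" "(\<lambda>\<gamma>. snd \<gamma> t) \<in> Q \<Otimes>\<^sub>M Q \<rightarrow>\<^sub>M borel" for t
    by (rule measurable_compose[OF measurable_fst e], rule measurable_compose[OF measurable_snd e])
  show ?thesis unfolding window_ratio_def by measurable
qed

text \<open>A measure on an infinite product is determined by its finite cylinders, which
  \<open>two_window_cylinder\<close> evaluates. The map \<open>glue\<close> is needed because the
  loop has both windows on one path, whereas the reference measure supplies one path per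
  window.\<close>

lemma two_window_law:
  assumes P: "loop_path_law S P" and m: "m > 0" and uv: "m < u" "u + m < v - m" "v + m < S"
  defines "I \<equiv> {u - m..u + m} \<union> {v - m..v + m}"
  defines "R \<equiv> (\<lambda>\<gamma>. window_ratio S m (v - u - 2 * m) (S - (v + m) + (u - m)) (fst \<gamma> (- m)) (fst \<gamma> m) (snd \<gamma> (- m)) (snd \<gamma> m))"
  defines "glue \<equiv> (\<lambda>\<gamma> :: (real \<Rightarrow> real ^ 'd) \<times> (real \<Rightarrow> real ^ 'd). \<lambda>s\<in>I. if s \<le> u + m then fst \<gamma> (s - u) else snd \<gamma> (s - v))"
  shows "distr P (\<Pi>\<^sub>M s\<in>I. borel) (\<lambda>\<gamma>. restrict \<gamma> I) = distr (density (Q \<Otimes>\<^sub>M Q) R) (\<Pi>\<^sub>M s\<in>I. borel) glue"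
    and "glue \<in> Q \<Otimes>\<^sub>M Q \<rightarrow>\<^sub>M (\<Pi>\<^sub>M s\<in>I. borel)"
    and "(\<lambda>\<gamma>. restrict \<gamma> I) \<in> P \<rightarrow>\<^sub>M (\<Pi>\<^sub>M s\<in>I. borel)"
proof -
  interpret Q: prob_space Q by (rule prob_Q)
  have pP: "prob_space P" and sP: "sets P = sets (borel_of XD)" using P by (auto simp: loop_path_law_def)
  have spP: "space P = topspace XD" using sets_eq_imp_space_eq[OF sP] by simp
  have e: "(\<lambda>\<gamma>. \<gamma> t) \<in> Q \<rightarrow>\<^sub>M borel" for t
    by (simp add: measurable_cong_sets[OF sets_Q refl] measurable_XD_eval)
  have ef: "(\<lambda>\<gamma>. fst \<gamma> t) \<in> Q \<Otimes>\<^sub>M Q \<rightarrow>\<^sub>M borel" and es: "(\<lambda>\<gamma>. snd \<gamma> t) \<in> Q \<Otimes>\<^sub>M Q \<rightarrow>\<^sub>M borel" for t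
    by (rule measurable_compose[OF measurable_fst e], rule measurable_compose[OF measurable_snd e])
  show glue: "glue \<in> Q \<Otimes>\<^sub>M Q \<rightarrow>\<^sub>M (\<Pi>\<^sub>M s\<in>I. borel)"
    unfolding glue_def
  proof (rule measurable_restrict)
    fix s show "(\<lambda>\<gamma>. if s \<le> u + m then fst \<gamma> (s - u) else snd \<gamma> (s - v)) \<in> Q \<Otimes>\<^sub>M Q \<rightarrow>\<^sub>M borel"
      by (cases "s \<le> u + m") (simp_all add: ef es)
  qed
  show rest: "(\<lambda>\<gamma>. restrict \<gamma> I) \<in> P \<rightarrow>\<^sub>M (\<Pi>\<^sub>M s\<in>I. borel)"
    by (intro measurable_restrict) (simp add: measurable_cong_sets[OF sP refl] measurable_XD_eval)
  have Rm: "R \<in> borel_measurable (Q \<Otimes>\<^sub>M Q)" unfolding R_def by (rule measurable_window_ratio)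
  show "distr P (\<Pi>\<^sub>M s\<in>I. borel) (\<lambda>\<gamma>. restrict \<gamma> I) = distr (density (Q \<Otimes>\<^sub>M Q) R) (\<Pi>\<^sub>M s\<in>I. borel) glue"
  proof (rule measure_eqI_PiM_infinite)
    show "finite_measure (distr P (\<Pi>\<^sub>M s\<in>I. borel) (\<lambda>\<gamma>. restrict \<gamma> I))"
      using prob_space.prob_space_distr[OF pP rest] by (rule prob_space.finite_measure)
    fix A :: "real \<Rightarrow> (real ^ 'd) set" and J assume J: "finite J" "J \<subseteq> I" and A: "\<And>i. i \<in> J \<Longrightarrow> A i \<in> sets borel"
    \<comment> \<open>The enumerations always include the window ends; where the cylinder imposes no
      condition on them the set is \<open>UNIV\<close>.\<close>
    define B where "B s = (if s \<in> J then A s else UNIV)" for s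
    have B: "B s \<in> sets borel" for s using A by (auto simp: B_def)
    let ?X = "prod_emb I (\<lambda>_. borel) J (Pi\<^sub>E J A)"
    have X: "?X \<in> sets (\<Pi>\<^sub>M s\<in>I. borel)" by (rule sets_PiM_I) (use J A in auto)
    have Xr: "restrict \<gamma> I \<in> ?X \<longleftrightarrow> (\<forall>s\<in>J. \<gamma> s \<in> A s)" for \<gamma>
      using J(2) by (auto simp: prod_emb_def PiE_iff space_PiM)
    define J1 where "J1 = (\<lambda>s. s - u) ` (J \<inter> {u - m..u + m})"
    define J2 where "J2 = (\<lambda>s. s - v) ` (J \<inter> {v - m..v + m})"
    have J1: "finite J1" "J1 \<subseteq> {- m..m}" and J2: "finite J2" "J2 \<subseteq> {- m..m}" using J(1) by (auto simp: J1_def J2_def)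
    obtain n1 :: nat and s1 :: "nat \<Rightarrow> real" where s1: "strict_mono_on {..n1} s1" "s1 0 = - m" "s1 n1 = m"
        "s1 ` {..n1} = insert (- m) (insert m J1)"
      by (rule enumerate_window[OF J1 m])
    obtain n2 :: nat and s2 :: "nat \<Rightarrow> real" where s2: "strict_mono_on {..n2} s2" "s2 0 = - m" "s2 n2 = m"
        "s2 ` {..n2} = insert (- m) (insert m J2)"
      by (rule enumerate_window[OF J2 m])
    have Biff: "(\<forall>s\<in>J. \<phi> s \<in> A s) \<longleftrightarrow> (\<forall>i\<le>n1. \<phi> (u + s1 i) \<in> B (u + s1 i)) \<and> (\<forall>i\<le>n2. \<phi> (v + s2 i) \<in> B (v + s2 i))" for \<phi> :: "real \<Rightarrow> real ^ 'd"
    proof (intro iffI conjI allI impI ballI)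
      fix s assume h: "(\<forall>i\<le>n1. \<phi> (u + s1 i) \<in> B (u + s1 i)) \<and> (\<forall>i\<le>n2. \<phi> (v + s2 i) \<in> B (v + s2 i))" and s: "s \<in> J"
      have "s \<in> {u - m..u + m} \<or> s \<in> {v - m..v + m}" using s J(2) by (auto simp: I_def)
      then show "\<phi> s \<in> A s"
      proof
        assume "s \<in> {u - m..u + m}"
        then have "s - u \<in> s1 ` {..n1}" using s unfolding s1(4) by (auto simp: J1_def)
        then obtain i where "i \<le> n1" "s = u + s1 i" by (auto simp: algebra_simps)
        then show ?thesis using h s by (auto simp: B_def)
      next
        assume "s \<in> {v - m..v + m}"
        then have "s - v \<in> s2 ` {..n2}" using s unfolding s2(4) by (auto simp: J2_def)
        then obtain i where "i \<le> n2" "s = v + s2 i" by (auto simp: algebra_simps)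
        then show ?thesis using h s by (auto simp: B_def)
      qed
    qed (auto simp: B_def)
    have r1: "u + s1 i \<in> {u - m..u + m}" if "i \<le> n1" for i
    proof -
      have "s1 i \<in> insert (- m) (insert m J1)" using s1(4) that by blast
      then show ?thesis using J1(2) m by auto
    qed
    have r2: "v + s2 i \<in> {v - m..v + m}" if "i \<le> n2" for i
    proof -
      have "s2 i \<in> insert (- m) (insert m J2)" using s2(4) that by blast
      then show ?thesis using J2(2) m by auto
    qed
    have "emeasure (distr P (\<Pi>\<^sub>M s\<in>I. borel) (\<lambda>\<gamma>. restrict \<gamma> I)) ?X =
       emeasure P {\<gamma> \<in> topspace XD. (\<forall>i\<le>n1. \<gamma> (u + s1 i) \<in> B (u + s1 i)) \<and> (\<forall>i\<le>n2. \<gamma> (v + s2 i) \<in> B (v + s2 i))}"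
      unfolding emeasure_distr[OF rest X] Biff[symmetric]
      by (intro arg_cong2[where f = emeasure] refl) (auto simp: Xr spP)
    also have "\<dots> = (\<integral>\<^sup>+\<gamma>1. (\<Prod>i\<le>n1. indicator (B (u + s1 i)) (\<gamma>1 (s1 i))) * (\<integral>\<^sup>+\<gamma>2. (\<Prod>i\<le>n2. indicator (B (v + s2 i)) (\<gamma>2 (s2 i))) *
       window_ratio S m (v - u - 2 * m) (S - (v + m) + (u - m)) (\<gamma>1 (s1 0)) (\<gamma>1 (s1 n1)) (\<gamma>2 (s2 0)) (\<gamma>2 (s2 n2)) \<partial>Q) \<partial>Q)"
      by (rule two_window_cylinder[OF P m uv s1(1-3) s2(1-3) B B])
    also have "\<dots> = (\<integral>\<^sup>+\<gamma>1. \<integral>\<^sup>+\<gamma>2. R (\<gamma>1, \<gamma>2) * indicator ?X (glue (\<gamma>1, \<gamma>2)) \<partial>Q \<partial>Q)"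
    proof (rule nn_integral_cong)
      fix \<gamma>1 :: "real \<Rightarrow> real ^ 'd"
      have gX: "indicator ?X (glue (\<gamma>1, \<gamma>2)) = (\<Prod>i\<le>n1. indicator (B (u + s1 i)) (\<gamma>1 (s1 i))) * (\<Prod>i\<le>n2. indicator (B (v + s2 i)) (\<gamma>2 (s2 i)) :: ennreal)" for \<gamma>2
      proof -
        define \<phi> where "\<phi> s = (if s \<le> u + m then \<gamma>1 (s - u) else \<gamma>2 (s - v))" for s
        have "glue (\<gamma>1, \<gamma>2) = restrict \<phi> I" by (auto simp: glue_def \<phi>_def)
        then have "indicator ?X (glue (\<gamma>1, \<gamma>2)) = (if \<forall>s\<in>J. \<phi> s \<in> A s then 1 else 0 :: ennreal)"
          using Xr[of \<phi>] by (simp add: indicator_def)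
        also have "(\<forall>s\<in>J. \<phi> s \<in> A s) \<longleftrightarrow> (\<forall>i\<le>n1. \<gamma>1 (s1 i) \<in> B (u + s1 i)) \<and> (\<forall>i\<le>n2. \<gamma>2 (s2 i) \<in> B (v + s2 i))"
        proof -
          have "\<phi> (u + s1 i) = \<gamma>1 (s1 i)" if "i \<le> n1" for i using r1[OF that] by (simp add: \<phi>_def)
          moreover have "\<phi> (v + s2 i) = \<gamma>2 (s2 i)" if "i \<le> n2" for i using r2[OF that] uv by (simp add: \<phi>_def)
          ultimately show ?thesis unfolding Biff by auto
        qed
        also have "(if (\<forall>i\<le>n1. \<gamma>1 (s1 i) \<in> B (u + s1 i)) \<and> (\<forall>i\<le>n2. \<gamma>2 (s2 i) \<in> B (v + s2 i)) then 1 else 0 :: ennreal) =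
          indicator {\<gamma>. \<forall>i\<le>n1. \<gamma> (s1 i) \<in> B (u + s1 i)} \<gamma>1 * indicator {\<gamma>. \<forall>i\<le>n2. \<gamma> (s2 i) \<in> B (v + s2 i)} \<gamma>2"
          by (simp add: indicator_def)
        also have "\<dots> = (\<Prod>i\<le>n1. indicator (B (u + s1 i)) (\<gamma>1 (s1 i))) * (\<Prod>i\<le>n2. indicator (B (v + s2 i)) (\<gamma>2 (s2 i)))"
          using indicator_Collect_le[of n1 "\<lambda>\<gamma> i. \<gamma> (s1 i)" "\<lambda>i. B (u + s1 i)" \<gamma>1]
            indicator_Collect_le[of n2 "\<lambda>\<gamma> i. \<gamma> (s2 i)" "\<lambda>i. B (v + s2 i)" \<gamma>2] by simp
        finally show ?thesis .
      qed
      have "(\<integral>\<^sup>+\<gamma>2. R (\<gamma>1, \<gamma>2) * indicator ?X (glue (\<gamma>1, \<gamma>2)) \<partial>Q) =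
        (\<integral>\<^sup>+\<gamma>2. (\<Prod>i\<le>n1. indicator (B (u + s1 i)) (\<gamma>1 (s1 i))) * ((\<Prod>i\<le>n2. indicator (B (v + s2 i)) (\<gamma>2 (s2 i))) *
       window_ratio S m (v - u - 2 * m) (S - (v + m) + (u - m)) (\<gamma>1 (s1 0)) (\<gamma>1 (s1 n1)) (\<gamma>2 (s2 0)) (\<gamma>2 (s2 n2))) \<partial>Q)"
        unfolding gX R_def using s1(2,3) s2(2,3) by (simp add: mult_ac)
      also have "\<dots> = (\<Prod>i\<le>n1. indicator (B (u + s1 i)) (\<gamma>1 (s1 i))) * (\<integral>\<^sup>+\<gamma>2. (\<Prod>i\<le>n2. indicator (B (v + s2 i)) (\<gamma>2 (s2 i))) *
       window_ratio S m (v - u - 2 * m) (S - (v + m) + (u - m)) (\<gamma>1 (s1 0)) (\<gamma>1 (s1 n1)) (\<gamma>2 (s2 0)) (\<gamma>2 (s2 n2)) \<partial>Q)"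
      proof (rule nn_integral_cmult)
        note [measurable] = e B measurable_unit_kernel
        show "(\<lambda>\<gamma>2. (\<Prod>i\<le>n2. indicator (B (v + s2 i)) (\<gamma>2 (s2 i))) *
          window_ratio S m (v - u - 2 * m) (S - (v + m) + (u - m)) (\<gamma>1 (s1 0)) (\<gamma>1 (s1 n1)) (\<gamma>2 (s2 0)) (\<gamma>2 (s2 n2))) \<in> borel_measurable Q"
          unfolding window_ratio_def by measurable
      qed
      finally show "(\<Prod>i\<le>n1. indicator (B (u + s1 i)) (\<gamma>1 (s1 i))) * (\<integral>\<^sup>+\<gamma>2. (\<Prod>i\<le>n2. indicator (B (v + s2 i)) (\<gamma>2 (s2 i))) *
       window_ratio S m (v - u - 2 * m) (S - (v + m) + (u - m)) (\<gamma>1 (s1 0)) (\<gamma>1 (s1 n1)) (\<gamma>2 (s2 0)) (\<gamma>2 (s2 n2)) \<partial>Q)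
        = (\<integral>\<^sup>+\<gamma>2. R (\<gamma>1, \<gamma>2) * indicator ?X (glue (\<gamma>1, \<gamma>2)) \<partial>Q)" by simp
    qed
    also have "\<dots> = (\<integral>\<^sup>+\<gamma>. R \<gamma> * indicator ?X (glue \<gamma>) \<partial>(Q \<Otimes>\<^sub>M Q))"
      by (rule Q.nn_integral_fst) (use Rm measurable_sets[OF glue X] glue X in measurable)
    also have "\<dots> = (\<integral>\<^sup>+\<gamma>. R \<gamma> * indicator (glue -` ?X \<inter> space (Q \<Otimes>\<^sub>M Q)) \<gamma> \<partial>(Q \<Otimes>\<^sub>M Q))"
      by (intro nn_integral_cong) (auto simp: indicator_def)
    also have "\<dots> = emeasure (density (Q \<Otimes>\<^sub>M Q) R) (glue -` ?X \<inter> space (Q \<Otimes>\<^sub>M Q))"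
      by (rule emeasure_density[symmetric, OF Rm measurable_sets[OF glue X]])
    also have "\<dots> = emeasure (distr (density (Q \<Otimes>\<^sub>M Q) R) (\<Pi>\<^sub>M s\<in>I. borel) glue) ?X"
      using glue X by (subst emeasure_distr) auto
    finally show "emeasure (distr P (\<Pi>\<^sub>M s\<in>I. borel) (\<lambda>\<gamma>. restrict \<gamma> I)) ?X = emeasure (distr (density (Q \<Otimes>\<^sub>M Q) R) (\<Pi>\<^sub>M s\<in>I. borel) glue) ?X" .
  qed simp_all
qed

text \<open>The identity of laws is carried from restrictions back to pairs of frozen paths: on
  measurable rectangles \<open>sets_XD_stopped\<close> turns both laws into masses of the same
  product event. Once the density is explicit, it is replaced by its bound C.\<close>

lemma two_window_bound:
  assumes P: "loop_path_law S P" and m: "m > 0" and uv: "m < u" "u + m < v - m" "v + m < S"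
    and C: "\<And>a1 b1 a2 b2. window_ratio S m (v - u - 2 * m) (S - (v + m) + (u - m)) a1 b1 a2 b2 \<le> C"
    and G: "G \<in> borel_measurable (borel_of XD \<Otimes>\<^sub>M borel_of XD)"
  shows "(\<integral>\<^sup>+\<gamma>. G (stopped m (shift u \<gamma>), stopped m (shift v \<gamma>)) \<partial>P)
    \<le> C * (\<integral>\<^sup>+\<gamma>. G (stopped m (fst \<gamma>), stopped m (snd \<gamma>)) \<partial>(Q \<Otimes>\<^sub>M Q))"
proof -
  define I where "I = {u - m..u + m} \<union> {v - m..v + m}"
  define R where "R = (\<lambda>\<gamma>. window_ratio S m (v - u - 2 * m) (S - (v + m) + (u - m)) (fst \<gamma> (- m)) (fst \<gamma> m) (snd \<gamma> (- m)) (snd \<gamma> m))"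
  define glue where "glue = (\<lambda>\<gamma> :: (real \<Rightarrow> real ^ 'd) \<times> (real \<Rightarrow> real ^ 'd). \<lambda>s\<in>I. if s \<le> u + m then fst \<gamma> (s - u) else snd \<gamma> (s - v))"
  note law = two_window_law[OF P m uv, folded I_def R_def, folded glue_def]
  have Rm: "R \<in> borel_measurable (Q \<Otimes>\<^sub>M Q)" unfolding R_def by (rule measurable_window_ratio)
  let ?N = "borel_of (XD :: (real \<Rightarrow> real ^ 'd) topology)"
  have pP: "prob_space P" and sP: "sets P = sets ?N" using P by (auto simp: loop_path_law_def)
  have spP: "space P = topspace XD" using sets_eq_imp_space_eq[OF sP] by simp
  define f where "f = (\<lambda>\<gamma> :: real \<Rightarrow> real ^ 'd. (stopped m (shift u \<gamma>), stopped m (shift v \<gamma>)))"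
  define g where "g = (\<lambda>\<gamma> :: (real \<Rightarrow> real ^ 'd) \<times> (real \<Rightarrow> real ^ 'd). (stopped m (fst \<gamma>), stopped m (snd \<gamma>)))"
  have fm: "f \<in> P \<rightarrow>\<^sub>M ?N \<Otimes>\<^sub>M ?N" unfolding f_def measurable_cong_sets[OF sP refl]
    by (intro measurable_Pair measurable_compose[OF measurable_shift measurable_stopped])
  have sQ: "stopped m \<in> Q \<rightarrow>\<^sub>M ?N" unfolding measurable_cong_sets[OF sets_Q refl] by (rule measurable_stopped)
  have gm: "g \<in> Q \<Otimes>\<^sub>M Q \<rightarrow>\<^sub>M ?N \<Otimes>\<^sub>M ?N" unfolding g_def
    by (intro measurable_Pair measurable_compose[OF measurable_fst sQ] measurable_compose[OF measurable_snd sQ])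
  have gm': "g \<in> density (Q \<Otimes>\<^sub>M Q) R \<rightarrow>\<^sub>M ?N \<Otimes>\<^sub>M ?N" using gm by simp
  have eq: "distr P (?N \<Otimes>\<^sub>M ?N) f = distr (density (Q \<Otimes>\<^sub>M Q) R) (?N \<Otimes>\<^sub>M ?N) g"
  proof (rule measure_eqI_generator_eq[OF Int_stable_pair_measure_generator[of ?N ?N], where \<Omega> = "space ?N \<times> space ?N" and A = "\<lambda>_. space ?N \<times> space ?N"])
    show "{a \<times> b |a b. a \<in> sets ?N \<and> b \<in> sets ?N} \<subseteq> Pow (space ?N \<times> space ?N)"
      using sets.sets_into_space[of _ ?N] by blast
    show "range (\<lambda>_. space ?N \<times> space ?N) \<subseteq> {a \<times> b |a b. a \<in> sets ?N \<and> b \<in> sets ?N}" by blast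
    show "emeasure (distr P (?N \<Otimes>\<^sub>M ?N) f) (space ?N \<times> space ?N) \<noteq> \<infinity>"
      using prob_space.emeasure_le_1[OF prob_space.prob_space_distr[OF pP fm]] by (metis ennreal_one_less_top infinity_ennreal_def leD)
    fix X assume "X \<in> {a \<times> b |a b. a \<in> sets ?N \<and> b \<in> sets ?N}"
    then obtain a b where X: "X = a \<times> b" and ab: "a \<in> sets ?N" "b \<in> sets ?N" by blast
    obtain A where A: "A \<in> sets (\<Pi>\<^sub>M t\<in>{-m..m}. (borel :: (real ^ 'd) measure))"
      "\<And>\<gamma>. \<gamma> \<in> topspace XD \<Longrightarrow> stopped m \<gamma> \<in> a \<longleftrightarrow> restrict \<gamma> {-m..m} \<in> A"
      by (rule sets_XD_stopped[OF ab(1) less_imp_le[OF m]]) (rule that, assumption, blast)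
    obtain B where B: "B \<in> sets (\<Pi>\<^sub>M t\<in>{-m..m}. (borel :: (real ^ 'd) measure))"
      "\<And>\<gamma>. \<gamma> \<in> topspace XD \<Longrightarrow> stopped m \<gamma> \<in> b \<longleftrightarrow> restrict \<gamma> {-m..m} \<in> B"
      by (rule sets_XD_stopped[OF ab(2) less_imp_le[OF m]]) (rule that, assumption, blast)
    define \<kappa> where "\<kappa> w = (\<lambda>x :: real \<Rightarrow> real ^ 'd. \<lambda>t\<in>{-m..m}. x (w + t))" for w
    have \<kappa>m: "\<kappa> w \<in> (\<Pi>\<^sub>M s\<in>I. borel) \<rightarrow>\<^sub>M (\<Pi>\<^sub>M t\<in>{-m..m}. borel)" if "w = u \<or> w = v" for w
      unfolding \<kappa>_def using that by (intro measurable_restrict measurable_component_singleton) (auto simp: I_def)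
    define Y where "Y = {x \<in> space (\<Pi>\<^sub>M s\<in>I. borel). \<kappa> u x \<in> A \<and> \<kappa> v x \<in> B}"
    have Y: "Y \<in> sets (\<Pi>\<^sub>M s\<in>I. borel)"
    proof -
      have "Y = (\<kappa> u -` A \<inter> space (\<Pi>\<^sub>M s\<in>I. borel)) \<inter> (\<kappa> v -` B \<inter> space (\<Pi>\<^sub>M s\<in>I. borel))" by (auto simp: Y_def)
      then show ?thesis using measurable_sets[OF \<kappa>m A(1)] measurable_sets[OF \<kappa>m B(1)] by auto
    qed
    have Xs: "X \<in> sets (?N \<Otimes>\<^sub>M ?N)" using ab X by simp
    have "f -` X \<inter> space P = (\<lambda>\<gamma>. restrict \<gamma> I) -` Y \<inter> space P"
    proof -
      have "f \<gamma> \<in> X \<longleftrightarrow> restrict \<gamma> I \<in> Y" if "\<gamma> \<in> topspace XD" for \<gamma>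
      proof -
        have "\<kappa> w (restrict \<gamma> I) = restrict (shift w \<gamma>) {-m..m}" if "w = u \<or> w = v" for w
          using that by (auto simp: \<kappa>_def shift_def I_def)
        then show ?thesis using A(2)[OF shift_XD[OF that]] B(2)[OF shift_XD[OF that]]
          by (auto simp: f_def X Y_def space_PiM)
      qed
      then show ?thesis unfolding spP by (intro set_eqI) (simp only: vimage_eq Int_iff, blast)
    qed
    then have "emeasure (distr P (?N \<Otimes>\<^sub>M ?N) f) X = emeasure (distr P (\<Pi>\<^sub>M s\<in>I. borel) (\<lambda>\<gamma>. restrict \<gamma> I)) Y"
      by (simp add: emeasure_distr[OF fm Xs] emeasure_distr[OF law(3) Y])
    also have "\<dots> = emeasure (distr (density (Q \<Otimes>\<^sub>M Q) R) (\<Pi>\<^sub>M s\<in>I. borel) glue) Y" unfolding law(1) ..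
    also have "\<dots> = emeasure (density (Q \<Otimes>\<^sub>M Q) R) (glue -` Y \<inter> space (Q \<Otimes>\<^sub>M Q))"
      using law(2) Y by (subst emeasure_distr) auto
    also have "glue -` Y \<inter> space (Q \<Otimes>\<^sub>M Q) = g -` X \<inter> space (Q \<Otimes>\<^sub>M Q)"
    proof -
      have "g (\<gamma>1, \<gamma>2) \<in> X \<longleftrightarrow> glue (\<gamma>1, \<gamma>2) \<in> Y" if "\<gamma>1 \<in> topspace XD" "\<gamma>2 \<in> topspace XD" for \<gamma>1 \<gamma>2
      proof -
        have "\<kappa> u (glue (\<gamma>1, \<gamma>2)) = restrict \<gamma>1 {-m..m}" "\<kappa> v (glue (\<gamma>1, \<gamma>2)) = restrict \<gamma>2 {-m..m}"
          using uv by (auto simp: \<kappa>_def glue_def I_def)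
        moreover have "glue (\<gamma>1, \<gamma>2) \<in> space (\<Pi>\<^sub>M s\<in>I. borel)" by (simp add: glue_def space_PiM)
        ultimately show ?thesis using A(2)[OF that(1)] B(2)[OF that(2)]
          by (auto simp: g_def X Y_def)
      qed
      then show ?thesis by (intro set_eqI) (auto simp only: vimage_eq Int_iff space_pair_measure space_Q mem_Times_iff split_paired_all fst_conv snd_conv)
    qed
    also have "emeasure (density (Q \<Otimes>\<^sub>M Q) R) (g -` X \<inter> space (Q \<Otimes>\<^sub>M Q)) = emeasure (distr (density (Q \<Otimes>\<^sub>M Q) R) (?N \<Otimes>\<^sub>M ?N) g) X"
      by (simp add: emeasure_distr[OF gm' Xs])
    finally show "emeasure (distr P (?N \<Otimes>\<^sub>M ?N) f) X = emeasure (distr (density (Q \<Otimes>\<^sub>M Q) R) (?N \<Otimes>\<^sub>M ?N) g) X" .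
  qed (auto simp: sets_pair_measure)
  have "(\<integral>\<^sup>+\<gamma>. G (f \<gamma>) \<partial>P) = (\<integral>\<^sup>+z. G z \<partial>distr P (?N \<Otimes>\<^sub>M ?N) f)"
    by (subst nn_integral_distr[OF fm]) (simp_all add: G)
  also have "\<dots> = (\<integral>\<^sup>+\<gamma>. G (g \<gamma>) \<partial>density (Q \<Otimes>\<^sub>M Q) R)"
    unfolding eq by (subst nn_integral_distr[OF gm']) (simp_all add: G)
  also have "\<dots> = (\<integral>\<^sup>+\<gamma>. R \<gamma> * G (g \<gamma>) \<partial>(Q \<Otimes>\<^sub>M Q))"
    by (rule nn_integral_density[OF Rm measurable_compose[OF gm G]])
  also have "\<dots> \<le> (\<integral>\<^sup>+\<gamma>. C * G (g \<gamma>) \<partial>(Q \<Otimes>\<^sub>M Q))"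
    unfolding R_def by (intro nn_integral_mono mult_right_mono C) simp
  also have "\<dots> = C * (\<integral>\<^sup>+\<gamma>. G (g \<gamma>) \<partial>(Q \<Otimes>\<^sub>M Q))"
    by (rule nn_integral_cmult[OF measurable_compose[OF gm G]])
  finally show ?thesis unfolding f_def g_def .
qed

end

section \<open>Time averages\<close>

text \<open>Rounding the time down to a grid of mesh 1/(n+1) leaves countably many evaluations, each
  measurable, and continuity of the path makes the rounded values converge.\<close>

lemma measurable_eval_pair:
  "(\<lambda>z. snd z (fst z)) \<in> borel \<Otimes>\<^sub>M borel_of (XD :: (real \<Rightarrow> real ^ 'd) topology) \<rightarrow>\<^sub>M borel"
proof (rule borel_measurable_LIMSEQ_metric)
  fix n :: nat
  let ?M = "borel \<Otimes>\<^sub>M borel_of (XD :: (real \<Rightarrow> real ^ 'd) topology)"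
  show "(\<lambda>z. snd z (of_int \<lfloor>real (Suc n) * fst z\<rfloor> / real (Suc n))) \<in> ?M \<rightarrow>\<^sub>M borel"
  proof (rule measurable_compose_countable[where g = "\<lambda>z. \<lfloor>real (Suc n) * fst z\<rfloor>"])
    show "(\<lambda>z. snd z (of_int i / real (Suc n))) \<in> ?M \<rightarrow>\<^sub>M borel" for i :: int
      by (rule measurable_compose[OF measurable_snd measurable_XD_eval])
    show "(\<lambda>z. \<lfloor>real (Suc n) * fst z\<rfloor>) \<in> ?M \<rightarrow>\<^sub>M count_space UNIV" by measurable
  qed
next
  fix z assume "z \<in> space ((borel :: real measure) \<Otimes>\<^sub>M borel_of (XD :: (real \<Rightarrow> real ^ 'd) topology))"
  then have "continuous_on UNIV (snd z)" by (auto simp: space_pair_measure topspace_XD)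
  then have c: "isCont (snd z) (fst z)" by (simp add: continuous_on_eq_continuous_at)
  have "(\<lambda>n. of_int \<lfloor>real (Suc n) * fst z\<rfloor> / real (Suc n)) \<longlonglongrightarrow> fst z"
  proof (rule LIMSEQ_I)
    fix r :: real assume "r > 0"
    then obtain N where N: "1 / real (Suc N) < r" using nat_approx_posE by auto
    have "norm (of_int \<lfloor>real (Suc n) * fst z\<rfloor> / real (Suc n) - fst z) < r" if "n \<ge> N" for n
    proof -
      have "\<bar>of_int \<lfloor>real (Suc n) * fst z\<rfloor> - real (Suc n) * fst z\<bar> \<le> 1" by linarith
      then have "\<bar>of_int \<lfloor>real (Suc n) * fst z\<rfloor> - real (Suc n) * fst z\<bar> / real (Suc n) \<le> 1 / real (Suc n)"
        by (intro divide_right_mono) auto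
      also have "\<bar>of_int \<lfloor>real (Suc n) * fst z\<rfloor> - real (Suc n) * fst z\<bar> / real (Suc n) =
          \<bar>(of_int \<lfloor>real (Suc n) * fst z\<rfloor> - real (Suc n) * fst z) / real (Suc n)\<bar>" by simp
      also have "(of_int \<lfloor>real (Suc n) * fst z\<rfloor> - real (Suc n) * fst z) / real (Suc n) = of_int \<lfloor>real (Suc n) * fst z\<rfloor> / real (Suc n) - fst z"
        unfolding diff_divide_distrib by (simp del: of_nat_Suc)
      also have "1 / real (Suc n) \<le> 1 / real (Suc N)" using that by (simp add: field_simps)
      finally show ?thesis using N unfolding real_norm_def by linarith
    qed
    then show "\<exists>no. \<forall>n\<ge>no. norm (of_int \<lfloor>real (Suc n) * fst z\<rfloor> / real (Suc n) - fst z) < r" by blast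
  qed
  then show "(\<lambda>n. snd z (of_int \<lfloor>real (Suc n) * fst z\<rfloor> / real (Suc n))) \<longlonglongrightarrow> snd z (fst z)"
    by (rule isCont_tendsto_compose[OF c])
qed

lemma measurable_shift_pair:
  "(\<lambda>z. shift (fst z) (snd z)) \<in> borel \<Otimes>\<^sub>M borel_of (XD :: (real \<Rightarrow> real ^ 'd) topology) \<rightarrow>\<^sub>M borel_of XD"
proof (rule measurable_into_XD)
  fix z assume "z \<in> space ((borel :: real measure) \<Otimes>\<^sub>M borel_of (XD :: (real \<Rightarrow> real ^ 'd) topology))"
  then show "shift (fst z) (snd z) \<in> topspace XD" by (auto simp: space_pair_measure shift_XD)
next
  fix t :: real
  let ?M = "borel \<Otimes>\<^sub>M borel_of (XD :: (real \<Rightarrow> real ^ 'd) topology)"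
  have "(\<lambda>z. (fst z + t, snd z)) \<in> ?M \<rightarrow>\<^sub>M ?M" by measurable
  from measurable_compose[OF this measurable_eval_pair]
  show "(\<lambda>z. shift (fst z) (snd z) t) \<in> ?M \<rightarrow>\<^sub>M borel" by (simp add: shift_def)
qed

definition time_average :: "real \<Rightarrow> ((real \<Rightarrow> 'a) \<Rightarrow> real) \<Rightarrow> (real \<Rightarrow> 'a) \<Rightarrow> real" where
  "time_average S f \<gamma> = (\<integral>u. f (shift u \<gamma>) \<partial>uniform_measure lborel {0..S})"

lemma prob_uniform: "S > 0 \<Longrightarrow> prob_space (uniform_measure lborel {0..S :: real})"
  by (rule prob_space_uniform_measure) auto

lemma measurable_shift_left:
  assumes "\<gamma> \<in> topspace (XD :: (real \<Rightarrow> real ^ 'd) topology)"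
  shows "(\<lambda>u. shift u \<gamma>) \<in> borel \<rightarrow>\<^sub>M borel_of XD"
proof -
  have "(\<lambda>u. (u, \<gamma>)) \<in> borel \<rightarrow>\<^sub>M borel \<Otimes>\<^sub>M borel_of XD" using assms by (intro measurable_Pair) auto
  from measurable_compose[OF this measurable_shift_pair] show ?thesis by simp
qed

lemma measurable_time_average:
  assumes S: "S > 0" and f: "f \<in> borel_measurable (borel_of (XD :: (real \<Rightarrow> real ^ 'd) topology))"
  shows "time_average S f \<in> borel_measurable (borel_of XD)"
proof -
  interpret U: prob_space "uniform_measure lborel {0..S}" by (rule prob_uniform[OF S])
  have "(\<lambda>z. (snd z, fst z)) \<in> borel_of (XD :: (real \<Rightarrow> real ^ 'd) topology) \<Otimes>\<^sub>M uniform_measure lborel {0..S} \<rightarrow>\<^sub>M borel \<Otimes>\<^sub>M borel_of XD"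
    by measurable
  from measurable_compose[OF this measurable_compose[OF measurable_shift_pair f]]
  have "(\<lambda>(\<gamma>, u). f (shift u \<gamma>)) \<in> borel_measurable (borel_of XD \<Otimes>\<^sub>M uniform_measure lborel {0..S})"
    by (simp add: case_prod_beta')
  then show ?thesis unfolding time_average_def by (rule U.borel_measurable_lebesgue_integral)
qed

lemma integrable_bounded_shift:
  fixes f :: "(real \<Rightarrow> real ^ 'd) \<Rightarrow> real"
  assumes S: "S > 0" and f: "f \<in> borel_measurable (borel_of XD)" and \<gamma>: "\<gamma> \<in> topspace (XD :: (real \<Rightarrow> real ^ 'd) topology)"
    and b: "\<And>\<eta>. \<eta> \<in> topspace XD \<Longrightarrow> \<bar>f \<eta>\<bar> \<le> b"
  shows "integrable (uniform_measure lborel {0..S}) (\<lambda>u. f (shift u \<gamma>))"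
proof -
  interpret U: prob_space "uniform_measure lborel {0..S}" by (rule prob_uniform[OF S])
  show ?thesis
  proof (rule U.integrable_const_bound[of _ b])
    show "AE u in uniform_measure lborel {0..S}. norm (f (shift u \<gamma>)) \<le> b"
      using b[OF shift_XD[OF \<gamma>]] by (intro AE_I2) auto
    show "(\<lambda>u. f (shift u \<gamma>)) \<in> borel_measurable (uniform_measure lborel {0..S})"
      using measurable_compose[OF measurable_shift_left[OF \<gamma>] f] by simp
  qed
qed

lemma nn_integral_uniform_le:
  assumes S: "S > 0" and A: "A \<in> sets borel" and m: "emeasure lborel A \<le> ennreal c" and c: "c \<ge> 0"
  shows "(\<integral>\<^sup>+u. indicator A u \<partial>uniform_measure lborel {0..S :: real}) \<le> ennreal (c / S)"
proof -
  have "(\<integral>\<^sup>+u. indicator A u \<partial>uniform_measure lborel {0..S}) = emeasure lborel ({0..S} \<inter> A) / ennreal S"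
    using A S by (simp add: emeasure_uniform_measure)
  also have "\<dots> \<le> ennreal c / ennreal S"
    using A by (intro divide_right_mono_ennreal order_trans[OF emeasure_mono m]) auto
  also have "\<dots> = ennreal (c / S)" using S c by (simp add: divide_ennreal)
  finally show ?thesis .
qed

text \<open>Adding 1 makes the signed products nonnegative, so that Tonelli and monotonicity apply
  without integrability conditions.\<close>

lemma nn_integral_one_plus:
  assumes M: "prob_space M" and f: "f \<in> borel_measurable M" "\<And>x. x \<in> space M \<Longrightarrow> \<bar>f x\<bar> \<le> 1" and a: "\<bar>a\<bar> \<le> 1"
  shows "(\<integral>\<^sup>+x. ennreal (1 + a * f x) \<partial>M) = ennreal (1 + a * (\<integral>x. f x \<partial>M))"
    and "\<bar>\<integral>x. f x \<partial>M\<bar> \<le> 1"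
proof -
  interpret prob_space M by (rule M)
  have i: "integrable M f" by (rule integrable_const_bound[of _ 1]) (use f in auto)
  have nn: "0 \<le> 1 + a * f x" if "x \<in> space M" for x
  proof -
    have "\<bar>a * f x\<bar> \<le> 1 * 1" unfolding abs_mult by (intro mult_mono f a that) auto
    then show ?thesis by linarith
  qed
  have "(\<integral>\<^sup>+x. ennreal (1 + a * f x) \<partial>M) = ennreal (\<integral>x. 1 + a * f x \<partial>M)"
    by (rule nn_integral_eq_integral) (use i nn in \<open>auto intro!: AE_I2\<close>)
  also have "(\<integral>x. 1 + a * f x \<partial>M) = 1 + a * (\<integral>x. f x \<partial>M)"
    using i by (simp add: prob_space)
  finally show "(\<integral>\<^sup>+x. ennreal (1 + a * f x) \<partial>M) = ennreal (1 + a * (\<integral>x. f x \<partial>M))" .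
  have "\<bar>\<integral>x. f x \<partial>M\<bar> \<le> (\<integral>x. \<bar>f x\<bar> \<partial>M)" by (rule integral_abs_bound)
  also have "\<dots> \<le> (\<integral>x. 1 \<partial>M)" using i f(2) by (intro integral_mono) auto
  finally show "\<bar>\<integral>x. f x \<partial>M\<bar> \<le> 1" by (simp add: prob_space)
qed

lemma ennreal_inverse_antimono: "x \<le> y \<Longrightarrow> inverse y \<le> (inverse x :: ennreal)"
proof (cases "x = 0 \<or> y = top")
  case False
  assume "x \<le> y"
  then obtain r s where "x = ennreal r" "y = ennreal s" "0 < r" "r \<le> s"
    using False by (cases x; cases y) (auto simp: top_unique less_le)
  then show ?thesis by (auto simp: inverse_ennreal intro!: ennreal_leI le_imp_inverse_le)
qed auto

context tab_process
begin

text \<open>Since S = g1 + g2 + 4 m, all exponentials cancel; so do the ground states at the four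
  ends. The two kernels leave (1 + \<theta>)^2 and the trace leaves 1 / (1 - \<theta>).\<close>

lemma window_ratio_bound:
  assumes \<eta>: "\<eta> > 0"
  obtains \<tau> where "\<tau> > 0" "\<And>S m g1 g2 a1 b1 a2 b2. m > 0 \<Longrightarrow> g1 \<ge> \<tau> \<Longrightarrow> g2 \<ge> \<tau> \<Longrightarrow> S = g1 + g2 + 4 * m \<Longrightarrow>
     window_ratio S m g1 g2 a1 b1 a2 b2 \<le> ennreal (1 + \<eta>)"
proof -
  \<comment> \<open>The choice gives 4 \<theta> \<le> \<eta> / 2 and \<eta> \<theta> \<le> \<eta> /
    2, whose sum is what (1 + \<theta>)^2 \<le> (1 + \<eta>) (1 - \<theta>) requires.\<close>
  define \<theta> where "\<theta> = min (1 / 2) (\<eta> / 8)"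
  have \<theta>: "0 < \<theta>" "\<theta> < 1" "\<theta> \<le> 1 / 2" "\<theta> \<le> \<eta> / 8" using \<eta> by (auto simp: \<theta>_def)
  have \<theta>2: "(1 + \<theta>)\<^sup>2 \<le> (1 + \<eta>) * (1 - \<theta>)"
  proof -
    have "\<theta> * \<theta> \<le> \<theta> * 1" "\<eta> * \<theta> \<le> \<eta> * (1 / 2)" using \<theta> \<eta> by (intro mult_left_mono; simp)+
    then have "3 * \<theta> + \<theta> * \<theta> + \<eta> * \<theta> \<le> \<eta>" using \<theta> by linarith
    then show ?thesis by (simp add: power2_eq_square algebra_simps)
  qed
  obtain \<tau>1 where \<tau>1: "\<And>t x y. t \<ge> \<tau>1 \<Longrightarrow> unit_kernel t x y \<le> ennreal ((1 + \<theta>) * exp (- (gap * t))) * (ground_state x * ground_state (y :: real ^ 'd))"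
    using unit_kernel_upper[OF \<theta>(1)] unfolding eventually_at_top_linorder by blast
  obtain \<tau>2 where \<tau>2: "\<And>t. t \<ge> \<tau>2 \<Longrightarrow> ennreal ((1 - \<theta>) * exp (- (gap * t))) \<le> partition_function t"
    using partition_function_lower[OF \<theta>(1,2)] unfolding eventually_at_top_linorder by blast
  show thesis
  proof (rule that[of "max 1 (max \<tau>1 \<tau>2)"])
    fix S m g1 g2 :: real and a1 b1 a2 b2 :: "real ^ 'd"
    assume m: "m > 0" and g: "g1 \<ge> max 1 (max \<tau>1 \<tau>2)" "g2 \<ge> max 1 (max \<tau>1 \<tau>2)" and S: "S = g1 + g2 + 4 * m"
    define e where "e = exp (- (gap * S))"
    have "ennreal ((1 - \<theta>) * e) \<le> partition_function S" unfolding e_def using \<tau>2[of S] S g m by auto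
    then have "inverse (partition_function S) \<le> inverse (ennreal ((1 - \<theta>) * e))" by (rule ennreal_inverse_antimono)
    also have "\<dots> = ennreal (1 / ((1 - \<theta>) * e))" using \<theta> by (simp add: inverse_ennreal e_def inverse_eq_divide)
    finally have T: "inverse (partition_function S) \<le> ennreal (1 / ((1 - \<theta>) * e))" .
    have ind: "indicator (cube 1) a1 * indicator (cube 1) b1 * indicator (cube 1) a2 * indicator (cube 1) b2 \<le> (1 :: ennreal)"
      by (auto simp: indicator_def)
    have "inv_ground_state a1 * inv_ground_state b1 * inv_ground_state a2 * inv_ground_state b2
     * (unit_kernel g1 b1 a2 * unit_kernel g2 b2 a1) \<le>
      inv_ground_state a1 * inv_ground_state b1 * inv_ground_state a2 * inv_ground_state b2
     * ((ennreal ((1 + \<theta>) * exp (- (gap * g1))) * (ground_state b1 * ground_state a2)) * (ennreal ((1 + \<theta>) * exp (- (gap * g2))) * (ground_state b2 * ground_state a1)))"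
      by (intro mult_left_mono mult_mono \<tau>1) (use g in auto)
    also have "\<dots> = ennreal ((1 + \<theta>) * exp (- (gap * g1))) * ennreal ((1 + \<theta>) * exp (- (gap * g2))) *
      ((ground_state a1 * inv_ground_state a1) * (ground_state b1 * inv_ground_state b1) * (ground_state a2 * inv_ground_state a2) * (ground_state b2 * inv_ground_state b2))"
      by (simp only: mult_ac)
    also have "\<dots> \<le> ennreal ((1 + \<theta>) * exp (- (gap * g1))) * ennreal ((1 + \<theta>) * exp (- (gap * g2))) * 1"
      unfolding ground_state_inv by (intro mult_left_mono ind) simp
    finally have K: "inv_ground_state a1 * inv_ground_state b1 * inv_ground_state a2 * inv_ground_state b2
     * (unit_kernel g1 b1 a2 * unit_kernel g2 b2 a1) \<le> ennreal ((1 + \<theta>) * exp (- (gap * g1))) * ennreal ((1 + \<theta>) * exp (- (gap * g2)))" by simp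
    have "window_ratio S m g1 g2 a1 b1 a2 b2 \<le> ennreal (1 / ((1 - \<theta>) * e)) * ennreal (exp (- (gap * (2 * m)))) * ennreal (exp (- (gap * (2 * m)))) *
       (ennreal ((1 + \<theta>) * exp (- (gap * g1))) * ennreal ((1 + \<theta>) * exp (- (gap * g2))))"
    proof -
      have "window_ratio S m g1 g2 a1 b1 a2 b2 = inverse (partition_function S) * ennreal (exp (- (gap * (2 * m)))) * ennreal (exp (- (gap * (2 * m)))) *
        (inv_ground_state a1 * inv_ground_state b1 * inv_ground_state a2 * inv_ground_state b2
     * (unit_kernel g1 b1 a2 * unit_kernel g2 b2 a1))" unfolding window_ratio_def by (simp only: mult.assoc)
      also have "\<dots> \<le> ennreal (1 / ((1 - \<theta>) * e)) * ennreal (exp (- (gap * (2 * m)))) * ennreal (exp (- (gap * (2 * m)))) *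
       (ennreal ((1 + \<theta>) * exp (- (gap * g1))) * ennreal ((1 + \<theta>) * exp (- (gap * g2))))"
        by (intro mult_mono T K order_refl) auto
      finally show ?thesis .
    qed
    also have "\<dots> = ennreal (1 / ((1 - \<theta>) * e) * exp (- (gap * (2 * m))) * exp (- (gap * (2 * m))) * (((1 + \<theta>) * exp (- (gap * g1))) * ((1 + \<theta>) * exp (- (gap * g2)))))"
      using \<theta> by (simp add: ennreal_mult[symmetric] e_def)
    also have "1 / ((1 - \<theta>) * e) * exp (- (gap * (2 * m))) * exp (- (gap * (2 * m))) * (((1 + \<theta>) * exp (- (gap * g1))) * ((1 + \<theta>) * exp (- (gap * g2))))
      = (1 + \<theta>)\<^sup>2 / (1 - \<theta>)"
    proof -
      have "exp (- (gap * (2 * m))) * exp (- (gap * (2 * m))) * (exp (- (gap * g1)) * exp (- (gap * g2))) = e"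
        unfolding e_def S by (simp add: exp_add[symmetric] algebra_simps)
      moreover have "1 / ((1 - \<theta>) * e) * exp (- (gap * (2 * m))) * exp (- (gap * (2 * m))) * (((1 + \<theta>) * exp (- (gap * g1))) * ((1 + \<theta>) * exp (- (gap * g2))))
        = (1 + \<theta>)\<^sup>2 / ((1 - \<theta>) * e) * (exp (- (gap * (2 * m))) * exp (- (gap * (2 * m))) * (exp (- (gap * g1)) * exp (- (gap * g2))))"
        by (simp add: power2_eq_square)
      ultimately show ?thesis by (simp add: e_def)
    qed
    also have "ennreal ((1 + \<theta>)\<^sup>2 / (1 - \<theta>)) \<le> ennreal (1 + \<eta>)"
      using \<theta>2 \<theta> by (intro ennreal_leI) (simp add: field_simps)
    finally show "window_ratio S m g1 g2 a1 b1 a2 b2 \<le> ennreal (1 + \<eta>)" .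
  qed simp
qed

end

lemma measurable_ennreal_one_plus:
  fixes f g :: "'a \<Rightarrow> real"
  assumes [measurable]: "f \<in> borel_measurable M" "g \<in> borel_measurable M"
  shows "(\<lambda>x. ennreal (1 + f x * g x)) \<in> borel_measurable M"
  by measurable

context tab_process
begin

text \<open>
  Two windows are only dominated from above by independent ones. This suffices since \<open>1 + h \<otimes> h \<ge> 0\<close>
  has mean \<open>1\<close> under \<open>Q \<Otimes> Q\<close>.
\<close>

lemma local_second_moment:
  fixes h :: "(real \<Rightarrow> real ^ 'd) \<Rightarrow> real"
  assumes hm: "h \<in> borel_measurable (borel_of XD)" and hb: "\<And>\<gamma>. \<gamma> \<in> topspace XD \<Longrightarrow> \<bar>h \<gamma>\<bar> \<le> 1"
    and m: "m > 0" and loc: "\<And>\<gamma>. \<gamma> \<in> topspace XD \<Longrightarrow> h (stopped m \<gamma>) = h \<gamma>"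
    and mean: "(\<integral>\<gamma>. h \<gamma> \<partial>Q) = 0" and \<eta>: "\<eta> > 0"
  obtains S0 where "S0 > 0" "\<And>S P. S \<ge> S0 \<Longrightarrow> loop_path_law S P \<Longrightarrow> (\<integral>\<^sup>+\<gamma>. ennreal ((time_average S h \<gamma>)\<^sup>2) \<partial>P) \<le> ennreal \<eta>"
proof -
  obtain \<tau> where \<tau>: "\<tau> > 0" "\<And>S m g1 g2 a1 b1 a2 b2. m > 0 \<Longrightarrow> g1 \<ge> \<tau> \<Longrightarrow> g2 \<ge> \<tau> \<Longrightarrow> S = g1 + g2 + 4 * m \<Longrightarrow>
     window_ratio S m g1 g2 a1 b1 a2 b2 \<le> ennreal (1 + \<eta> / 2)"
    by (rule window_ratio_bound[of "\<eta> / 2"]) (use \<eta> in auto)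
  \<comment> \<open>Window centres at distance more than a from both ends of the period leave an
    outer arc longer than 2 \<tau>; centres more than w apart leave a gap longer than \<tau>. Both
    arcs are then long enough for the bound on \<open>window_ratio\<close>.\<close>
  define a where "a = m + \<tau>"
  define w where "w = 2 * m + \<tau>"
  have aw: "a > 0" "w > 0" using m \<tau>(1) by (auto simp: a_def w_def)
  \<comment> \<open>The exceptional pairs of centres cost (4 a + 2 w) / S, which is at most \<eta> /
    2 from this value on.\<close>
  define S0 where "S0 = 2 * (4 * a + 2 * w) / \<eta>"
  have S0: "S0 > 0" using aw \<eta> by (simp add: S0_def)
  show thesis
  proof (rule that[OF S0])
    fix S P assume S: "S \<ge> S0" and P: "loop_path_law S P"
    have Sp: "S > 0" using S S0 by simp
    let ?N = "borel_of (XD :: (real \<Rightarrow> real ^ 'd) topology)"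
    let ?U = "uniform_measure lborel {0..S}"
    interpret Q: prob_space Q by (rule prob_Q)
    interpret U: prob_space ?U by (rule prob_uniform[OF Sp])
    have pP: "prob_space P" and sP: "sets P = sets ?N" using P by (auto simp: loop_path_law_def)
    interpret P: prob_space P by (rule pP)
    have spP: "space P = topspace XD" using sets_eq_imp_space_eq[OF sP] by simp
    define V where "V = time_average S h"
    have Vm: "V \<in> borel_measurable P"
      unfolding V_def measurable_cong_sets[OF sP refl] by (rule measurable_time_average[OF Sp hm])
    have hsm: "(\<lambda>u. h (shift u \<gamma>)) \<in> borel_measurable borel" if "\<gamma> \<in> topspace XD" for \<gamma>
      by (rule measurable_compose[OF measurable_shift_left[OF that] hm])
    have hQ: "h \<in> borel_measurable Q" using hm by (simp add: measurable_cong_sets[OF sets_Q refl])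
    have VV: "(\<integral>\<^sup>+u. \<integral>\<^sup>+v. ennreal (1 + h (shift u \<gamma>) * h (shift v \<gamma>)) \<partial>?U \<partial>?U) = ennreal (1 + (V \<gamma>)\<^sup>2)"
      if g: "\<gamma> \<in> topspace XD" for \<gamma>
    proof -
      have b: "\<bar>h (shift u \<gamma>)\<bar> \<le> 1" for u by (rule hb[OF shift_XD[OF g]])
      have m': "(\<lambda>u. h (shift u \<gamma>)) \<in> borel_measurable ?U" using hsm[OF g] by simp
      note one = nn_integral_one_plus[OF prob_uniform[OF Sp] m' b, folded time_average_def, folded V_def]
      have "(\<integral>\<^sup>+u. \<integral>\<^sup>+v. ennreal (1 + h (shift u \<gamma>) * h (shift v \<gamma>)) \<partial>?U \<partial>?U) = (\<integral>\<^sup>+u. ennreal (1 + V \<gamma> * h (shift u \<gamma>)) \<partial>?U)"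
        using one(1)[OF b] by (simp add: mult.commute)
      also have "\<dots> = ennreal (1 + V \<gamma> * V \<gamma>)" by (rule one(1)[OF one(2)[of 0]]) simp
      finally show ?thesis by (simp add: power2_eq_square)
    qed
    define B where "B = {0..a} \<union> {S - a..S}"
    have Bm: "B \<in> sets borel" by (simp add: B_def)
    have Bl: "emeasure lborel B \<le> ennreal (2 * a)"
    proof -
      have "emeasure lborel B \<le> emeasure lborel {0..a} + emeasure lborel {S - a..S}"
        unfolding B_def by (rule emeasure_subadditive) auto
      also have "\<dots> = ennreal (2 * a)" using aw by (simp add: ennreal_plus[symmetric] del: ennreal_plus)
      finally show ?thesis .
    qed
    define pair where "pair u v = (\<integral>\<^sup>+\<gamma>. ennreal (1 + h (shift u \<gamma>) * h (shift v \<gamma>)) \<partial>P)" for u v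
    have pair_sym: "pair u v = pair v u" for u v by (simp add: pair_def mult.commute)
    have pair_le2: "pair u v \<le> 2" for u v
    proof -
      have "pair u v \<le> (\<integral>\<^sup>+\<gamma>. 2 \<partial>P)"
        unfolding pair_def
      proof (rule nn_integral_mono)
        fix \<gamma> assume "\<gamma> \<in> space P"
        then have g: "\<gamma> \<in> topspace XD" by (simp add: spP)
        have "\<bar>h (shift u \<gamma>) * h (shift v \<gamma>)\<bar> \<le> 1 * 1"
          unfolding abs_mult by (intro mult_mono hb shift_XD g) auto
        then have "1 + h (shift u \<gamma>) * h (shift v \<gamma>) \<le> 2" by linarith
        then show "ennreal (1 + h (shift u \<gamma>) * h (shift v \<gamma>)) \<le> 2"
          using ennreal_leI[of _ 2] by simp
      qed
      then show ?thesis by (simp add: P.emeasure_space_1)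
    qed
    define G where "G z = ennreal (1 + h (fst z) * h (snd z))" for z
    have Gm: "G \<in> borel_measurable (?N \<Otimes>\<^sub>M ?N)"
    proof -
      have "(\<lambda>z. h (fst z)) \<in> borel_measurable (?N \<Otimes>\<^sub>M ?N)" "(\<lambda>z. h (snd z)) \<in> borel_measurable (?N \<Otimes>\<^sub>M ?N)"
        by (rule measurable_compose[OF measurable_fst hm], rule measurable_compose[OF measurable_snd hm])
      then show ?thesis unfolding G_def by (rule measurable_ennreal_one_plus)
    qed
    have GQ: "(\<integral>\<^sup>+z. G (stopped m (fst z), stopped m (snd z)) \<partial>(Q \<Otimes>\<^sub>M Q)) = 1"
    proof -
      have sQ: "stopped m \<in> Q \<rightarrow>\<^sub>M ?N" unfolding measurable_cong_sets[OF sets_Q refl] by (rule measurable_stopped)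
      have "(\<lambda>z. (stopped m (fst z), stopped m (snd z))) \<in> Q \<Otimes>\<^sub>M Q \<rightarrow>\<^sub>M ?N \<Otimes>\<^sub>M ?N"
        by (intro measurable_Pair measurable_compose[OF measurable_fst sQ] measurable_compose[OF measurable_snd sQ])
      from Q.nn_integral_fst[OF measurable_compose[OF this Gm]]
      have "(\<integral>\<^sup>+z. G (stopped m (fst z), stopped m (snd z)) \<partial>(Q \<Otimes>\<^sub>M Q)) =
        (\<integral>\<^sup>+\<gamma>1. \<integral>\<^sup>+\<gamma>2. G (stopped m \<gamma>1, stopped m \<gamma>2) \<partial>Q \<partial>Q)" by simp
      also have "\<dots> = (\<integral>\<^sup>+\<gamma>1. \<integral>\<^sup>+\<gamma>2. ennreal (1 + h \<gamma>1 * h \<gamma>2) \<partial>Q \<partial>Q)"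
        by (intro nn_integral_cong) (simp add: G_def loc space_Q)
      also have "\<dots> = (\<integral>\<^sup>+\<gamma>1. 1 \<partial>Q)"
      proof (rule nn_integral_cong)
        fix \<gamma>1 assume "\<gamma>1 \<in> space Q"
        then have "\<bar>h \<gamma>1\<bar> \<le> 1" by (simp add: hb space_Q)
        from nn_integral_one_plus(1)[OF prob_Q hQ _ this] show "(\<integral>\<^sup>+\<gamma>2. ennreal (1 + h \<gamma>1 * h \<gamma>2) \<partial>Q) = 1"
          by (simp add: hb space_Q mean)
      qed
      also have "\<dots> = 1" by (simp add: Q.emeasure_space_1)
      finally show ?thesis .
    qed
    have good: "pair u v \<le> ennreal (1 + \<eta> / 2)" if u: "a < u" and v: "v < S - a" and uv: "v - u > w" for u v
    proof -
      have "pair u v = (\<integral>\<^sup>+\<gamma>. G (stopped m (shift u \<gamma>), stopped m (shift v \<gamma>)) \<partial>P)"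
        unfolding pair_def G_def by (intro nn_integral_cong) (simp add: loc shift_XD spP)
      also have "\<dots> \<le> ennreal (1 + \<eta> / 2) * (\<integral>\<^sup>+z. G (stopped m (fst z), stopped m (snd z)) \<partial>(Q \<Otimes>\<^sub>M Q))"
      proof (rule two_window_bound[OF P m _ _ _ _ Gm])
        show "m < u" "u + m < v - m" "v + m < S" using u v uv \<tau>(1) by (auto simp: a_def w_def)
        show "window_ratio S m (v - u - 2 * m) (S - (v + m) + (u - m)) a1 b1 a2 b2 \<le> ennreal (1 + \<eta> / 2)" for a1 b1 a2 b2
          by (rule \<tau>(2)[OF m]) (use u v uv \<tau>(1) in \<open>auto simp: a_def w_def\<close>)
      qed
      finally show ?thesis unfolding GQ by simp
    qed
    define D where "D u = {u - w..u + w}" for u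
    \<comment> \<open>On exceptional pairs the trivial bound 2 is covered by the main term together
      with one indicator.\<close>
    have pair_bound: "pair u v \<le> ennreal (1 + \<eta> / 2) + indicator B u + indicator B v + indicator (D u) v"
      if "u \<in> {0..S}" "v \<in> {0..S}" for u v
    proof (cases "u \<in> B \<or> v \<in> B \<or> v \<in> D u")
      case True
      have "pair u v \<le> 1 + 1" using pair_le2[of u v] by (simp add: one_add_one)
      also have "\<dots> \<le> ennreal (1 + \<eta> / 2) + (indicator B u + indicator B v + indicator (D u) v)"
      proof (rule add_mono)
        show "1 \<le> ennreal (1 + \<eta> / 2)" using \<eta> by (simp add: ennreal_ge_1)
        show "1 \<le> (indicator B u + indicator B v + indicator (D u) v :: ennreal)"
          using True by (auto simp: indicator_def)
      qed
      finally show ?thesis by (simp add: add.assoc)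
    next
      case False
      then have "a < u" "u < S - a" "a < v" "v < S - a" using that by (auto simp: B_def)
      moreover have "v - u > w \<or> u - v > w" using False by (auto simp: D_def)
      ultimately have "pair u v \<le> ennreal (1 + \<eta> / 2)" using good[of u v] good[of v u] pair_sym by auto
      then show ?thesis using False by simp
    qed
    have sU: "AE u in ?U. u \<in> {0..S}"
      using Sp by (intro AE_uniform_measureI) auto
    have "(\<integral>\<^sup>+u. \<integral>\<^sup>+v. pair u v \<partial>?U \<partial>?U) \<le>
       (\<integral>\<^sup>+u. \<integral>\<^sup>+v. (ennreal (1 + \<eta> / 2) + indicator B u + indicator B v + indicator (D u) v) \<partial>?U \<partial>?U)"
    proof (rule nn_integral_mono_AE)
      show "AE u in ?U. (\<integral>\<^sup>+v. pair u v \<partial>?U) \<le>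
        (\<integral>\<^sup>+v. (ennreal (1 + \<eta> / 2) + indicator B u + indicator B v + indicator (D u) v) \<partial>?U)"
        using sU
      proof eventually_elim
        case (elim u)
        have "AE v in ?U. pair u v \<le> ennreal (1 + \<eta> / 2) + indicator B u + indicator B v + indicator (D u) v"
          using sU by eventually_elim (rule pair_bound[OF elim])
        then show ?case by (rule nn_integral_mono_AE)
      qed
    qed
    also have "\<dots> \<le> (\<integral>\<^sup>+u. (ennreal (1 + \<eta> / 2) + indicator B u + ennreal (2 * a / S) + ennreal (2 * w / S)) \<partial>?U)"
    proof (rule nn_integral_mono)
      fix u
      have "(\<integral>\<^sup>+v. (ennreal (1 + \<eta> / 2) + indicator B u + indicator B v + indicator (D u) v) \<partial>?U) =
        ennreal (1 + \<eta> / 2) + indicator B u + (\<integral>\<^sup>+v. indicator B v \<partial>?U) + (\<integral>\<^sup>+v. indicator (D u) v \<partial>?U)"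
        using Bm by (subst nn_integral_add; simp add: D_def)+ (simp add: U.emeasure_space_1[simplified])
      also have "\<dots> \<le> ennreal (1 + \<eta> / 2) + indicator B u + ennreal (2 * a / S) + ennreal (2 * w / S)"
        using aw by (intro add_mono order_refl nn_integral_uniform_le Sp Bm Bl) (auto simp: D_def)
      finally show "(\<integral>\<^sup>+v. (ennreal (1 + \<eta> / 2) + indicator B u + indicator B v + indicator (D u) v) \<partial>?U)
        \<le> ennreal (1 + \<eta> / 2) + indicator B u + ennreal (2 * a / S) + ennreal (2 * w / S)" .
    qed
    also have "\<dots> = ennreal (1 + \<eta> / 2) + (\<integral>\<^sup>+u. indicator B u \<partial>?U) + ennreal (2 * a / S) + ennreal (2 * w / S)"
      using Bm by (subst nn_integral_add; simp)+ (simp add: U.emeasure_space_1[simplified])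
    also have "\<dots> \<le> ennreal (1 + \<eta> / 2) + ennreal (2 * a / S) + ennreal (2 * a / S) + ennreal (2 * w / S)"
      using aw by (intro add_mono order_refl nn_integral_uniform_le Sp Bm Bl) auto
    also have "\<dots> = ennreal (1 + \<eta> / 2 + 2 * a / S + 2 * a / S + 2 * w / S)"
      using aw Sp \<eta> by (simp add: ennreal_plus[symmetric] del: ennreal_plus)
    also have "\<dots> \<le> ennreal (1 + \<eta>)"
    proof (rule ennreal_leI)
      have "(4 * a + 2 * w) / S \<le> \<eta> / 2"
        using S \<eta> Sp unfolding S0_def by (simp add: field_simps)
      then show "1 + \<eta> / 2 + 2 * a / S + 2 * a / S + 2 * w / S \<le> 1 + \<eta>"
        by (simp add: add_divide_distrib)
    qed
    finally have fin: "(\<integral>\<^sup>+u. \<integral>\<^sup>+v. pair u v \<partial>?U \<partial>?U) \<le> ennreal (1 + \<eta>)" .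
    have swap: "(\<integral>\<^sup>+u. \<integral>\<^sup>+v. pair u v \<partial>?U \<partial>?U) =
       (\<integral>\<^sup>+\<gamma>. \<integral>\<^sup>+u. \<integral>\<^sup>+v. ennreal (1 + h (shift u \<gamma>) * h (shift v \<gamma>)) \<partial>?U \<partial>?U \<partial>P)"
    proof -
      interpret UP: pair_sigma_finite ?U P by unfold_locales
      have hs: "(\<lambda>z. h (shift (fst z) (snd z))) \<in> borel_measurable (borel \<Otimes>\<^sub>M P)"
        using measurable_compose[OF measurable_shift_pair hm] by (simp add: measurable_cong_sets[OF sets_pair_measure_cong[OF refl sP] refl])
      have H: "(\<lambda>x. h (shift (f x) (g x))) \<in> borel_measurable M" if "f \<in> M \<rightarrow>\<^sub>M borel" "g \<in> M \<rightarrow>\<^sub>M P" for f g and M :: "'z measure"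
        using measurable_compose[OF measurable_Pair[OF that] hs] by simp
      have 1: "(\<lambda>(v, \<gamma>). ennreal (1 + h (shift u \<gamma>) * h (shift v \<gamma>))) \<in> borel_measurable (?U \<Otimes>\<^sub>M P)" for u
        unfolding case_prod_beta by (intro measurable_ennreal_one_plus H) auto
      have m3: "(\<lambda>z. ennreal (1 + h (shift (fst (fst z)) (snd (fst z))) * h (shift (snd z) (snd (fst z))))) \<in> borel_measurable ((?U \<Otimes>\<^sub>M P) \<Otimes>\<^sub>M ?U)"
        by (intro measurable_ennreal_one_plus H) auto
      have 2: "(\<lambda>(u, \<gamma>). \<integral>\<^sup>+v. ennreal (1 + h (shift u \<gamma>) * h (shift v \<gamma>)) \<partial>?U) \<in> borel_measurable (?U \<Otimes>\<^sub>M P)"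
        using U.borel_measurable_nn_integral_fst[OF m3] by (simp add: case_prod_beta')
      have "(\<integral>\<^sup>+u. \<integral>\<^sup>+v. pair u v \<partial>?U \<partial>?U) = (\<integral>\<^sup>+u. \<integral>\<^sup>+\<gamma>. \<integral>\<^sup>+v. ennreal (1 + h (shift u \<gamma>) * h (shift v \<gamma>)) \<partial>?U \<partial>P \<partial>?U)"
        unfolding pair_def by (intro nn_integral_cong UP.Fubini'[symmetric] 1)
      also have "\<dots> = (\<integral>\<^sup>+\<gamma>. \<integral>\<^sup>+u. \<integral>\<^sup>+v. ennreal (1 + h (shift u \<gamma>) * h (shift v \<gamma>)) \<partial>?U \<partial>?U \<partial>P)"
        by (rule UP.Fubini'[symmetric, OF 2])
      finally show ?thesis .
    qed
    \<comment> \<open>By \<open>VV\<close> the mean of 1 + V^2 is the double time average of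
      \<open>pair\<close>, hence at most 1 + \<eta>; cancelling the finite summand 1 leaves the
      second moment.\<close>
    have "1 + (\<integral>\<^sup>+\<gamma>. ennreal ((V \<gamma>)\<^sup>2) \<partial>P) = (\<integral>\<^sup>+\<gamma>. 1 + ennreal ((V \<gamma>)\<^sup>2) \<partial>P)"
      using Vm by (subst nn_integral_add) (auto simp: P.emeasure_space_1)
    also have "\<dots> = (\<integral>\<^sup>+\<gamma>. \<integral>\<^sup>+u. \<integral>\<^sup>+v. ennreal (1 + h (shift u \<gamma>) * h (shift v \<gamma>)) \<partial>?U \<partial>?U \<partial>P)"
      by (intro nn_integral_cong) (simp add: VV spP)
    also have "\<dots> \<le> ennreal (1 + \<eta>)" using fin unfolding swap .
    also have "\<dots> = 1 + ennreal \<eta>" using \<eta> by simp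
    finally show "(\<integral>\<^sup>+\<gamma>. ennreal ((time_average S h \<gamma>)\<^sup>2) \<partial>P) \<le> ennreal \<eta>"
      unfolding V_def by (simp add: ennreal_add_left_cancel_le)
  qed
qed

end

section \<open>Window functionals dominating a bounded continuous functional\<close>

definition window_sup :: "real \<Rightarrow> ((real \<Rightarrow> real ^ 'd) \<Rightarrow> real) \<Rightarrow> (real \<Rightarrow> real ^ 'd) \<Rightarrow> real" where
  "window_sup m f \<gamma> = Sup {f \<eta> | \<eta>. \<eta> \<in> topspace XD \<and> (\<forall>t\<in>{-m..m}. \<eta> t = \<gamma> t)}"

lemma openin_XD: "openin XD U \<longleftrightarrow> cloc_open UNIV (closure (cube 1)) U"
  by (simp add: XD_def openin_cloc)

lemma topspace_XD_paths: "topspace XD = paths UNIV (closure (cube 1))"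
  by (simp add: XD_def topspace_cloc)

lemma openin_XD_superlevel:
  assumes "continuous_map XD euclideanreal f" shows "openin XD {\<gamma> \<in> topspace XD. c < f \<gamma>}"
proof -
  have "openin euclideanreal {c<..}" by (simp add: open_greaterThan)
  from openin_continuous_map_preimage[OF assms this] show ?thesis by simp
qed

lemma XD_continuous_ball:
  fixes f :: "(real \<Rightarrow> real ^ 'd) \<Rightarrow> real"
  assumes f: "continuous_map XD euclideanreal f" and \<gamma>: "\<gamma> \<in> topspace XD" and c: "c < f \<gamma>"
  obtains K e where "compact K" "e > 0" "\<And>\<eta>. \<eta> \<in> topspace XD \<Longrightarrow> (\<And>t. t \<in> K \<Longrightarrow> dist (\<eta> t) (\<gamma> t) < e) \<Longrightarrow> c < f \<eta>"
proof -
  have "\<gamma> \<in> {\<gamma> \<in> topspace XD. c < f \<gamma>}" using \<gamma> c by simp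
  then obtain K e where "compact K" "e > 0"
    and sub: "{\<eta> \<in> paths UNIV (closure (cube 1)). \<forall>t\<in>K. dist (\<eta> t) (\<gamma> t) < e} \<subseteq> {\<gamma> \<in> topspace XD. c < f \<gamma>}"
    using openin_XD_superlevel[OF f, of c] unfolding openin_XD cloc_open_def by meson
  then show thesis by (intro that[of K e]) (auto simp: topspace_XD_paths)
qed

context
  fixes f :: "(real \<Rightarrow> real ^ 'd) \<Rightarrow> real" and B :: real
  assumes f: "continuous_map XD euclideanreal f" and B: "\<And>\<gamma>. \<gamma> \<in> topspace XD \<Longrightarrow> \<bar>f \<gamma>\<bar> \<le> B"
begin

lemma window_sup_upper:
  assumes "\<eta> \<in> topspace XD" "\<And>t. t \<in> {-m..m} \<Longrightarrow> \<eta> t = \<gamma> t" shows "f \<eta> \<le> window_sup m f \<gamma>"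
  unfolding window_sup_def
proof (rule cSup_upper)
  show "bdd_above {f \<eta> |\<eta>. \<eta> \<in> topspace XD \<and> (\<forall>t\<in>{-m..m}. \<eta> t = \<gamma> t)}"
    using B by (intro bdd_aboveI[of _ B]) force
qed (use assms in blast)

lemma window_sup_least:
  assumes "\<gamma> \<in> topspace XD" "\<And>\<eta>. \<eta> \<in> topspace XD \<Longrightarrow> (\<And>t. t \<in> {-m..m} \<Longrightarrow> \<eta> t = \<gamma> t) \<Longrightarrow> f \<eta> \<le> c"
  shows "window_sup m f \<gamma> \<le> c"
  unfolding window_sup_def by (rule cSup_least) (use assms in auto)

lemma window_sup_bound: "\<gamma> \<in> topspace XD \<Longrightarrow> \<bar>window_sup m f \<gamma>\<bar> \<le> B"
proof -
  assume g: "\<gamma> \<in> topspace XD"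
  have "f \<gamma> \<le> window_sup m f \<gamma>" by (rule window_sup_upper[OF g]) simp
  moreover have "window_sup m f \<gamma> \<le> B" by (rule window_sup_least[OF g]) (use B in force)
  ultimately show ?thesis using B[OF g] by linarith
qed

lemma window_sup_stopped: "window_sup m f (stopped m \<gamma>) = window_sup m f \<gamma>"
proof -
  have "stopped m \<gamma> t = \<gamma> t" if "t \<in> {-m..m}" for t using time_clamp_id[OF that] by (simp add: stopped_def)
  then show ?thesis unfolding window_sup_def by simp
qed

text \<open>
  A path near \<open>\<gamma>\<close> on the window extends to a path near any given extension \<open>\<eta>\<close> of \<open>\<gamma>\<close>: add the
  difference on the window, frozen outside, and project back to the cube.
\<close>

lemma openin_window_sup:
  assumes m: "m \<ge> 0" shows "openin XD {\<gamma> \<in> topspace XD. c < window_sup m f \<gamma>}"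
proof -
  let ?S = "closure (cube 1) :: (real ^ 'd) set"
  have S: "convex ?S" "closed ?S" "?S \<noteq> {}" by (auto simp: closure_cube interval_ne_empty_cart)
  have "cloc_open UNIV ?S {\<gamma> \<in> topspace XD. c < window_sup m f \<gamma>}"
    unfolding cloc_open_def
  proof (intro conjI ballI)
    show "{\<gamma> \<in> topspace XD. c < window_sup m f \<gamma>} \<subseteq> paths UNIV ?S" by (auto simp: topspace_XD_paths)
    fix \<gamma> assume "\<gamma> \<in> {\<gamma> \<in> topspace XD. c < window_sup m f \<gamma>}"
    then have g: "\<gamma> \<in> topspace XD" and gt: "c < window_sup m f \<gamma>" by auto
    have "{f \<eta> |\<eta>. \<eta> \<in> topspace XD \<and> (\<forall>t\<in>{-m..m}. \<eta> t = \<gamma> t)} \<noteq> {}" using g by blast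
    from less_cSupD[OF this gt[unfolded window_sup_def]]
    obtain \<eta> where \<eta>: "\<eta> \<in> topspace XD" "\<And>t. t \<in> {-m..m} \<Longrightarrow> \<eta> t = \<gamma> t" "c < f \<eta>" by auto
    obtain K e where K: "compact K" "e > 0" "\<And>\<eta>'. \<eta>' \<in> topspace XD \<Longrightarrow> (\<And>t. t \<in> K \<Longrightarrow> dist (\<eta>' t) (\<eta> t) < e) \<Longrightarrow> c < f \<eta>'"
      by (rule XD_continuous_ball[OF f \<eta>(1,3)]) blast
    have "c < window_sup m f \<gamma>'" if g': "\<gamma>' \<in> topspace XD" and near: "\<And>t. t \<in> {-m..m} \<Longrightarrow> dist (\<gamma>' t) (\<gamma> t) < e" for \<gamma>'
    proof -
      define \<eta>' where "\<eta>' t = closest_point ?S (\<eta> t + (\<gamma>' (time_clamp m t) - \<gamma> (time_clamp m t)))" for t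
      have \<eta>S: "\<eta> t \<in> ?S" for t using \<eta>(1) by (auto simp: topspace_XD)
      have cont: "continuous_on UNIV \<eta>" "continuous_on UNIV \<gamma>" "continuous_on UNIV \<gamma>'" using \<eta>(1) g g' by (auto simp: topspace_XD)
      have "continuous_on UNIV (\<lambda>t. \<eta> t + (\<gamma>' (time_clamp m t) - \<gamma> (time_clamp m t)))"
        by (intro continuous_on_add continuous_on_diff cont(1) continuous_on_compose2[OF cont(2) continuous_time_clamp]
          continuous_on_compose2[OF cont(3) continuous_time_clamp]) auto
      then have "continuous_on UNIV \<eta>'" unfolding \<eta>'_def
        by (rule continuous_on_compose2[OF continuous_on_closest_point[OF S]]) auto
      then have "\<eta>' \<in> topspace XD"
        unfolding topspace_XD using closest_point_in_set[OF S(2,3)] by (auto simp: \<eta>'_def)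
      moreover have "dist (\<eta>' t) (\<eta> t) < e" for t
      proof -
        have "dist (\<eta>' t) (\<eta> t) = dist (\<eta>' t) (closest_point ?S (\<eta> t))" by (simp add: closest_point_self[OF \<eta>S])
        also have "\<dots> \<le> dist (\<eta> t + (\<gamma>' (time_clamp m t) - \<gamma> (time_clamp m t))) (\<eta> t)"
          unfolding \<eta>'_def by (rule closest_point_lipschitz[OF S])
        also have "\<dots> = dist (\<gamma>' (time_clamp m t)) (\<gamma> (time_clamp m t))" by (simp add: dist_norm)
        also have "\<dots> < e" by (rule near[OF time_clamp_mem[OF m]])
        finally show ?thesis .
      qed
      ultimately have "c < f \<eta>'" using K(3) by blast
      also have "f \<eta>' \<le> window_sup m f \<gamma>'"
      proof (rule window_sup_upper)
        fix t assume t: "t \<in> {-m..m}"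
        have "\<gamma>' t \<in> ?S" using g' by (auto simp: topspace_XD)
        then show "\<eta>' t = \<gamma>' t" unfolding \<eta>'_def time_clamp_id[OF t] \<eta>(2)[OF t] by (simp add: closest_point_self)
      qed fact
      finally show ?thesis .
    qed
    then show "\<exists>K e. compact K \<and> K \<subseteq> UNIV \<and> e > 0 \<and>
        {\<eta> \<in> paths UNIV ?S. \<forall>t\<in>K. dist (\<eta> t) (\<gamma> t) < e} \<subseteq> {\<gamma> \<in> topspace XD. c < window_sup m f \<gamma>}"
      using K(2) by (intro exI[of _ "{-m..m}"] exI[of _ e]) (auto simp: topspace_XD_paths)
  qed
  then show ?thesis by (simp add: openin_XD)
qed

text \<open>The supremum runs over uncountably many extensions, so measurability comes from lower
  semicontinuity: the superlevel sets are open.\<close>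

lemma measurable_window_sup: "m \<ge> 0 \<Longrightarrow> window_sup m f \<in> borel_measurable (borel_of XD)"
  unfolding borel_measurable_iff_greater using openin_window_sup by (auto intro: openin_sets_borel_of)

text \<open>A neighbourhood of \<gamma> restricts paths on a compact time set only. Once the window
  contains this set, every path agreeing with \<gamma> on the window lies in the neighbourhood, so
  the supremum exceeds f \<gamma> by little.\<close>

lemma window_sup_tendsto:
  assumes g: "\<gamma> \<in> topspace XD"
  shows "(\<lambda>n. window_sup (real (Suc n)) f \<gamma>) \<longlonglongrightarrow> f \<gamma>"
proof (rule LIMSEQ_I)
  fix r :: real assume r: "r > 0"
  \<comment> \<open>\<open>XD_continuous_ball\<close> gives lower bounds; the upper bound on f near
    \<gamma> is a lower bound on -f.\<close>
  have "continuous_map XD euclideanreal (\<lambda>x. - f x)" using f by (rule continuous_map_minus)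
  then obtain K e where K: "compact K" "e > 0"
    "\<And>\<eta>. \<eta> \<in> topspace XD \<Longrightarrow> (\<And>t. t \<in> K \<Longrightarrow> dist (\<eta> t) (\<gamma> t) < e) \<Longrightarrow> - f \<gamma> - r / 2 < - f \<eta>"
    by (rule XD_continuous_ball[OF _ g, of "\<lambda>x. - f x" "- f \<gamma> - r / 2"]) (use r in auto)
  obtain b where b: "\<And>t. t \<in> K \<Longrightarrow> \<bar>t\<bar> \<le> b"
    using compact_imp_bounded[OF K(1)] unfolding bounded_iff real_norm_def by blast
  obtain N :: nat where N: "b \<le> real N" using real_arch_simple by blast
  have "norm (window_sup (real (Suc n)) f \<gamma> - f \<gamma>) < r" if "n \<ge> N" for n
  proof -
    have "window_sup (real (Suc n)) f \<gamma> \<le> f \<gamma> + r / 2"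
    proof (rule window_sup_least[OF g])
      fix \<eta> assume h: "\<eta> \<in> topspace XD" "\<And>t. t \<in> {- real (Suc n)..real (Suc n)} \<Longrightarrow> \<eta> t = \<gamma> t"
      have "dist (\<eta> t) (\<gamma> t) < e" if "t \<in> K" for t
      proof -
        have "t \<in> {- real (Suc n)..real (Suc n)}" using b[OF that] N \<open>n \<ge> N\<close> by (auto simp: abs_le_iff)
        then show ?thesis using h(2) K(2) by simp
      qed
      from K(3)[OF h(1) this] show "f \<eta> \<le> f \<gamma> + r / 2" by simp
    qed
    moreover have "f \<gamma> \<le> window_sup (real (Suc n)) f \<gamma>" by (rule window_sup_upper[OF g]) simp
    ultimately show ?thesis using r unfolding real_norm_def by linarith
  qed
  then show "\<exists>no. \<forall>n\<ge>no. norm (window_sup (real (Suc n)) f \<gamma> - f \<gamma>) < r" by blast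
qed

end

context tab_process
begin

text \<open>A large time average of f forces a large time average of its window supremum g, and g is
  close to f in mean under Q. Centred and normalized, g obeys the second moment bound, and Markov's
  inequality concludes.\<close>

lemma time_average_upper_tail:
  fixes f :: "(real \<Rightarrow> real ^ 'd) \<Rightarrow> real"
  assumes f: "continuous_map XD euclideanreal f" and B: "\<And>\<gamma>. \<gamma> \<in> topspace XD \<Longrightarrow> \<bar>f \<gamma>\<bar> \<le> B"
    and e: "e > 0" and \<eta>: "\<eta> > 0"
  obtains S0 where "S0 > 0" "\<And>S P. S \<ge> S0 \<Longrightarrow> loop_path_law S P \<Longrightarrow>
     emeasure P {\<gamma> \<in> topspace XD. (\<integral>\<gamma>. f \<gamma> \<partial>Q) + e \<le> time_average S f \<gamma>} \<le> ennreal \<eta>"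
proof -
  interpret Q: prob_space Q by (rule prob_Q)
  have mQ: "g \<in> borel_measurable Q" if "g \<in> borel_measurable (borel_of XD)" for g :: "(real \<Rightarrow> real ^ 'd) \<Rightarrow> real"
    using that by (simp add: measurable_cong_sets[OF sets_Q refl])
  have fm: "f \<in> borel_measurable (borel_of XD)" by (rule continuous_map_borel_measurable[OF f])
  have "(\<lambda>n. \<integral>\<gamma>. window_sup (real (Suc n)) f \<gamma> \<partial>Q) \<longlonglongrightarrow> (\<integral>\<gamma>. f \<gamma> \<partial>Q)"
  proof (rule integral_dominated_convergence[where w = "\<lambda>_. B"])
    show "f \<in> borel_measurable Q" by (rule mQ[OF fm])
    show "window_sup (real (Suc n)) f \<in> borel_measurable Q" for n
      by (rule mQ[OF measurable_window_sup[OF f B]]) simp_all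
    show "AE x in Q. (\<lambda>n. window_sup (real (Suc n)) f x) \<longlonglongrightarrow> f x"
      using window_sup_tendsto[OF f B] by (intro AE_I2) (simp add: space_Q)
    show "AE x in Q. norm (window_sup (real (Suc n)) f x) \<le> B" for n
      using window_sup_bound[OF f B] by (intro AE_I2) (simp add: space_Q)
  qed simp
  from order_tendstoD(2)[OF this, of "(\<integral>\<gamma>. f \<gamma> \<partial>Q) + e / 2"]
  obtain n where n: "(\<integral>\<gamma>. window_sup (real (Suc n)) f \<gamma> \<partial>Q) < (\<integral>\<gamma>. f \<gamma> \<partial>Q) + e / 2"
    using e by (auto simp: eventually_sequentially)
  define m where "m = real (Suc n)"
  have m: "m > 0" by (simp add: m_def)
  define g where "g = window_sup m f"
  have gm: "g \<in> borel_measurable (borel_of XD)" unfolding g_def by (rule measurable_window_sup[OF f B]) (use m in auto)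
  have gB: "\<bar>g \<gamma>\<bar> \<le> B" if "\<gamma> \<in> topspace XD" for \<gamma> unfolding g_def by (rule window_sup_bound[OF f B that])
  define c where "c = (\<integral>\<gamma>. g \<gamma> \<partial>Q)"
  have cn: "c < (\<integral>\<gamma>. f \<gamma> \<partial>Q) + e / 2" using n by (simp add: c_def g_def m_def)
  have gi: "integrable Q g" by (rule Q.integrable_const_bound[of _ B]) (auto intro!: AE_I2 gB mQ gm simp: space_Q)
  have cB: "\<bar>c\<bar> \<le> B"
  proof -
    have "\<bar>c\<bar> \<le> (\<integral>\<gamma>. \<bar>g \<gamma>\<bar> \<partial>Q)" unfolding c_def by (rule integral_abs_bound)
    also have "\<dots> \<le> (\<integral>\<gamma>. B \<partial>Q)" using gi gB by (intro integral_mono) (auto simp: space_Q)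
    finally show ?thesis by (simp add: Q.prob_space)
  qed
  \<comment> \<open>The centred functional g - c is bounded by 2 B; the summand 1 keeps the divisor
    positive.\<close>
  define b where "b = 2 * B + 1"
  have b: "b > 0" using cB by (simp add: b_def)
  define h where "h \<gamma> = (g \<gamma> - c) / b" for \<gamma>
  have hm: "h \<in> borel_measurable (borel_of XD)" unfolding h_def using gm by measurable
  have hb: "\<bar>h \<gamma>\<bar> \<le> 1" if "\<gamma> \<in> topspace XD" for \<gamma>
    using gB[OF that] cB b by (auto simp: h_def b_def abs_le_iff field_simps)
  have hl: "h (stopped m \<gamma>) = h \<gamma>" for \<gamma> by (simp add: h_def g_def window_sup_stopped[OF f B])
  have h0: "(\<integral>\<gamma>. h \<gamma> \<partial>Q) = 0" using gi by (simp add: h_def c_def Q.prob_space)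
  \<comment> \<open>Half of e is lost to the approximation of f by g; the other half, divided by b,
    is the deviation required of h.\<close>
  define r where "r = e / (2 * b)"
  have r: "r > 0" using e b by (simp add: r_def)
  obtain S0 where S0: "S0 > 0" "\<And>S P. S \<ge> S0 \<Longrightarrow> loop_path_law S P \<Longrightarrow> (\<integral>\<^sup>+\<gamma>. ennreal ((time_average S h \<gamma>)\<^sup>2) \<partial>P) \<le> ennreal (\<eta> * r\<^sup>2)"
    by (rule local_second_moment[OF hm hb m hl h0, of "\<eta> * r\<^sup>2"]) (use \<eta> r in auto)
  show thesis
  proof (rule that[OF S0(1)])
    fix S P assume S: "S \<ge> S0" and P: "loop_path_law S P"
    have Sp: "S > 0" using S S0 by simp
    interpret U: prob_space "uniform_measure lborel {0..S}" by (rule prob_uniform[OF Sp])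
    have sP: "sets P = sets (borel_of XD)" using P by (auto simp: loop_path_law_def)
    have spP: "space P = topspace XD" using sets_eq_imp_space_eq[OF sP] by simp
    have Vm: "time_average S h \<in> borel_measurable P"
      unfolding measurable_cong_sets[OF sP refl] by (rule measurable_time_average[OF Sp hm])
    have V: "r \<le> time_average S h \<gamma>" if g: "\<gamma> \<in> topspace XD" and ge: "(\<integral>\<gamma>. f \<gamma> \<partial>Q) + e \<le> time_average S f \<gamma>" for \<gamma>
    proof -
      have ig: "integrable (uniform_measure lborel {0..S}) (\<lambda>u. g (shift u \<gamma>))"
        by (rule integrable_bounded_shift[OF Sp gm g gB])
      have "time_average S f \<gamma> \<le> time_average S g \<gamma>"
        unfolding time_average_def
      proof (rule integral_mono)
        show "integrable (uniform_measure lborel {0..S}) (\<lambda>u. f (shift u \<gamma>))"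
          by (rule integrable_bounded_shift[OF Sp fm g B])
        show "f (shift u \<gamma>) \<le> g (shift u \<gamma>)" for u
          unfolding g_def by (rule window_sup_upper[OF f B shift_XD[OF g]]) auto
      qed fact
      moreover have "time_average S h \<gamma> = (time_average S g \<gamma> - c) / b"
        unfolding time_average_def h_def using ig U.prob_space by simp
      moreover have "e / 2 \<le> time_average S f \<gamma> - c" using ge cn by linarith
      ultimately have eq: "time_average S h \<gamma> = (time_average S g \<gamma> - c) / b" and "e / 2 \<le> time_average S g \<gamma> - c"
        by linarith+
      then have "e / 2 / b \<le> (time_average S g \<gamma> - c) / b" using b by (intro divide_right_mono) auto
      then show ?thesis unfolding eq r_def by simp
    qed
    have "emeasure P {\<gamma> \<in> topspace XD. (\<integral>\<gamma>. f \<gamma> \<partial>Q) + e \<le> time_average S f \<gamma>}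
      \<le> emeasure P {\<gamma> \<in> space P. 1 \<le> ennreal (1 / r\<^sup>2) * ennreal ((time_average S h \<gamma>)\<^sup>2)}"
    proof (rule emeasure_mono)
      show "{\<gamma> \<in> topspace XD. (\<integral>\<gamma>. f \<gamma> \<partial>Q) + e \<le> time_average S f \<gamma>} \<subseteq> {\<gamma> \<in> space P. 1 \<le> ennreal (1 / r\<^sup>2) * ennreal ((time_average S h \<gamma>)\<^sup>2)}"
      proof safe
        fix \<gamma> assume g: "\<gamma> \<in> topspace XD" and "(\<integral>\<gamma>. f \<gamma> \<partial>Q) + e \<le> time_average S f \<gamma>"
        then have "r\<^sup>2 \<le> (time_average S h \<gamma>)\<^sup>2" using V r by (intro power_mono) auto
        then have "1 \<le> 1 / r\<^sup>2 * (time_average S h \<gamma>)\<^sup>2" using r by simp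
        then show "1 \<le> ennreal (1 / r\<^sup>2) * ennreal ((time_average S h \<gamma>)\<^sup>2)"
          by (simp add: ennreal_mult[symmetric] ennreal_ge_1)
        show "\<gamma> \<in> space P" using g by (simp add: spP)
      qed
      show "{\<gamma> \<in> space P. 1 \<le> ennreal (1 / r\<^sup>2) * ennreal ((time_average S h \<gamma>)\<^sup>2)} \<in> sets P"
        using Vm by measurable
    qed
    also have "\<dots> \<le> ennreal (1 / r\<^sup>2) * (\<integral>\<^sup>+\<gamma>. ennreal ((time_average S h \<gamma>)\<^sup>2) * indicator (space P) \<gamma> \<partial>P)"
      by (rule nn_integral_Markov_inequality) (use Vm in measurable)
    also have "(\<integral>\<^sup>+\<gamma>. ennreal ((time_average S h \<gamma>)\<^sup>2) * indicator (space P) \<gamma> \<partial>P) = (\<integral>\<^sup>+\<gamma>. ennreal ((time_average S h \<gamma>)\<^sup>2) \<partial>P)"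
      by (intro nn_integral_cong) simp
    also have "ennreal (1 / r\<^sup>2) * \<dots> \<le> ennreal (1 / r\<^sup>2) * ennreal (\<eta> * r\<^sup>2)"
      by (intro mult_left_mono S0(2)[OF S P]) simp
    also have "\<dots> = ennreal \<eta>" using r \<eta> by (simp add: ennreal_mult[symmetric])
    finally show "emeasure P {\<gamma> \<in> topspace XD. (\<integral>\<gamma>. f \<gamma> \<partial>Q) + e \<le> time_average S f \<gamma>} \<le> ennreal \<eta>" .
  qed
qed

end

section \<open>Convergence of the mark\<close>

text \<open>The mark as a function of the rescaled path and S alone, which lets the argument run on
  \<open>XD\<close> without L, T or the original loop.\<close>

definition occupation :: "real \<Rightarrow> (real \<Rightarrow> real ^ 'd) \<Rightarrow> (real \<Rightarrow> real ^ 'd) measure" where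
  "occupation S \<gamma> = uniform_measure lborel {0..S} \<bind> (\<lambda>u. return (borel_of XD) (shift u \<gamma>))"

lemma mark_eq_occupation: "mark L T \<omega> = occupation (T / L\<^sup>2) (rescaled_loop L T \<omega>)"
  by (simp add: mark_def occupation_def)

lemma occupation_distr:
  assumes S: "S > 0" and g: "\<gamma> \<in> topspace XD"
  shows "occupation S \<gamma> = distr (uniform_measure lborel {0..S}) (borel_of XD) (\<lambda>u. shift u \<gamma>)"
    and "(\<lambda>u. shift u \<gamma>) \<in> uniform_measure lborel {0..S} \<rightarrow>\<^sub>M borel_of XD"
proof -
  show m: "(\<lambda>u. shift u \<gamma>) \<in> uniform_measure lborel {0..S} \<rightarrow>\<^sub>M borel_of XD"
    using measurable_shift_left[OF g] by simp
  show "occupation S \<gamma> = distr (uniform_measure lborel {0..S}) (borel_of XD) (\<lambda>u. shift u \<gamma>)"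
    unfolding occupation_def using m by (rule bind_return_distr'[rotated]) simp
qed

lemma occupation_prob:
  assumes "S > 0" "\<gamma> \<in> topspace XD" shows "occupation S \<gamma> \<in> prob_measures XD"
  unfolding prob_measures_def occupation_distr(1)[OF assms]
  using prob_space.prob_space_distr[OF prob_uniform[OF assms(1)] occupation_distr(2)[OF assms]] by simp

lemma integral_occupation:
  fixes f :: "(real \<Rightarrow> real ^ 'd) \<Rightarrow> real"
  assumes "S > 0" "\<gamma> \<in> topspace XD" "f \<in> borel_measurable (borel_of XD)"
  shows "(\<integral>x. f x \<partial>occupation S \<gamma>) = time_average S f \<gamma>"
  unfolding occupation_distr(1)[OF assms(1,2)] time_average_def
  by (rule integral_distr[OF occupation_distr(2)[OF assms(1,2)] assms(3)])

text \<open>Closeness within 1/(n+1) on [-n, n] describes a countable neighbourhood base at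
  \<gamma>, so a failure of openness yields a sequence of paths. Along it f converges at every
  shift, and dominated convergence over one period gives the contradiction.\<close>

lemma openin_time_average:
  fixes f :: "(real \<Rightarrow> real ^ 'd) \<Rightarrow> real"
  assumes S: "S > 0" and f: "continuous_map XD euclideanreal f" and B: "\<And>\<gamma>. \<gamma> \<in> topspace XD \<Longrightarrow> \<bar>f \<gamma>\<bar> \<le> B"
    and U: "open U"
  shows "openin XD {\<gamma> \<in> topspace XD. time_average S f \<gamma> \<in> U}"
proof -
  interpret U: prob_space "uniform_measure lborel {0..S}" by (rule prob_uniform[OF S])
  have fm: "f \<in> borel_measurable (borel_of XD)" by (rule continuous_map_borel_measurable[OF f])
  have "cloc_open UNIV (closure (cube 1)) {\<gamma> \<in> topspace XD. time_average S f \<gamma> \<in> U}"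
    unfolding cloc_open_def
  proof (intro conjI ballI)
    show "{\<gamma> \<in> topspace XD. time_average S f \<gamma> \<in> U} \<subseteq> paths UNIV (closure (cube 1))" by (auto simp: topspace_XD_paths)
    fix \<gamma> assume "\<gamma> \<in> {\<gamma> \<in> topspace XD. time_average S f \<gamma> \<in> U}"
    then have g: "\<gamma> \<in> topspace XD" and gU: "time_average S f \<gamma> \<in> U" by auto
    show "\<exists>K e. compact K \<and> K \<subseteq> UNIV \<and> e > 0 \<and>
        {\<eta> \<in> paths UNIV (closure (cube 1)). \<forall>t\<in>K. dist (\<eta> t) (\<gamma> t) < e} \<subseteq> {\<gamma> \<in> topspace XD. time_average S f \<gamma> \<in> U}"
    proof (rule ccontr)
      assume neg: "\<not> ?thesis"
      have "\<exists>\<eta>. \<eta> \<in> topspace XD \<and> (\<forall>t\<in>{- real n..real n}. dist (\<eta> t) (\<gamma> t) < 1 / real (Suc n)) \<and> time_average S f \<eta> \<notin> U" for n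
      proof (rule ccontr)
        assume "\<not> ?thesis"
        then have "{\<eta> \<in> paths UNIV (closure (cube 1)). \<forall>t\<in>{- real n..real n}. dist (\<eta> t) (\<gamma> t) < 1 / real (Suc n)} \<subseteq> {\<gamma> \<in> topspace XD. time_average S f \<gamma> \<in> U}"
          by (auto simp: topspace_XD_paths)
        moreover have "compact {- real n..real n}" "1 / real (Suc n) > 0" by auto
        ultimately show False using neg by blast
      qed
      then obtain \<eta> where \<eta>: "\<And>n. \<eta> n \<in> topspace XD" "\<And>n t. t \<in> {- real n..real n} \<Longrightarrow> dist (\<eta> n t) (\<gamma> t) < 1 / real (Suc n)"
        "\<And>n. time_average S f (\<eta> n) \<notin> U" by metis
      \<comment> \<open>Stated one-sidedly for any continuous functional, to be applied to f and to
        -f.\<close>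
      have near: "\<exists>N. \<forall>n\<ge>N. c < F (shift u (\<eta> n))"
        if F: "continuous_map XD euclideanreal F" and c: "c < F (shift u \<gamma>)" for F :: "(real \<Rightarrow> real ^ 'd) \<Rightarrow> real" and c u
      proof -
        obtain K e where K: "compact K" "e > 0" "\<And>\<eta>. \<eta> \<in> topspace XD \<Longrightarrow> (\<And>t. t \<in> K \<Longrightarrow> dist (\<eta> t) (shift u \<gamma> t) < e) \<Longrightarrow> c < F \<eta>"
          by (rule XD_continuous_ball[OF F shift_XD[OF g] c]) blast
        obtain b where b: "\<And>t. t \<in> K \<Longrightarrow> \<bar>t\<bar> \<le> b"
          using compact_imp_bounded[OF K(1)] unfolding bounded_iff real_norm_def by blast
        obtain N1 :: nat where N1: "b + \<bar>u\<bar> \<le> real N1" using real_arch_simple by blast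
        obtain N2 where N2: "1 / real (Suc N2) < e" using nat_approx_posE[OF K(2)] by blast
        have "c < F (shift u (\<eta> n))" if n: "n \<ge> max N1 N2" for n
        proof (rule K(3)[OF shift_XD[OF \<eta>(1)]])
          fix t assume t: "t \<in> K"
          have "\<bar>u + t\<bar> \<le> real n" using b[OF t] N1 n by linarith
          then have "dist (\<eta> n (u + t)) (\<gamma> (u + t)) < 1 / real (Suc n)" by (intro \<eta>(2)) (auto simp: abs_le_iff)
          also have "\<dots> \<le> 1 / real (Suc N2)" using n by (simp add: field_simps)
          also have "\<dots> < e" by (rule N2)
          finally show "dist (shift u (\<eta> n) t) (shift u \<gamma> t) < e" by (simp add: shift_def)
        qed
        then show ?thesis by blast
      qed
      have ptw: "(\<lambda>n. f (shift u (\<eta> n))) \<longlonglongrightarrow> f (shift u \<gamma>)" for u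
      proof (rule order_tendstoI)
        show "\<forall>\<^sub>F n in sequentially. a < f (shift u (\<eta> n))" if "a < f (shift u \<gamma>)" for a
          using near[OF f that] by (simp add: eventually_sequentially)
        show "\<forall>\<^sub>F n in sequentially. f (shift u (\<eta> n)) < a" if "f (shift u \<gamma>) < a" for a
          using near[OF continuous_map_minus[OF f], of "- a" u] that by (simp add: eventually_sequentially)
      qed
      have "(\<lambda>n. time_average S f (\<eta> n)) \<longlonglongrightarrow> time_average S f \<gamma>"
        unfolding time_average_def
      proof (rule integral_dominated_convergence[where w = "\<lambda>_. B"])
        show "(\<lambda>u. f (shift u \<gamma>)) \<in> borel_measurable (uniform_measure lborel {0..S})"
          using measurable_compose[OF measurable_shift_left[OF g] fm] by simp
        show "(\<lambda>u. f (shift u (\<eta> n))) \<in> borel_measurable (uniform_measure lborel {0..S})" for n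
          using measurable_compose[OF measurable_shift_left[OF \<eta>(1)] fm] by simp
        show "AE u in uniform_measure lborel {0..S}. norm (f (shift u (\<eta> n))) \<le> B" for n
          using B[OF shift_XD[OF \<eta>(1)]] by (intro AE_I2) simp
      qed (auto intro: ptw)
      from topological_tendstoD[OF this U gU] show False using \<eta>(3) by (auto simp: eventually_sequentially)
    qed
  qed
  then show ?thesis by (simp add: openin_XD)
qed

lemma continuous_map_bounded_XD:
  fixes f :: "(real \<Rightarrow> real ^ 'd) \<Rightarrow> real"
  assumes "bounded (f ` topspace XD)"
  obtains B where "\<And>\<gamma>. \<gamma> \<in> topspace XD \<Longrightarrow> \<bar>f \<gamma>\<bar> \<le> B"
  using assms unfolding bounded_iff by auto

text \<open>Continuity yields measurability for all Borel sets of \<open>MD\<close> at once, without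
  a countability argument for the weak topology.\<close>

lemma continuous_map_occupation:
  assumes S: "S > 0" shows "continuous_map (XD :: (real \<Rightarrow> real ^ 'd) topology) MD (occupation S)"
  unfolding MD_def weak_topology_def
proof (rule continuous_on_generated_topo)
  fix W :: "(real \<Rightarrow> real ^ 'd) measure set" assume "W \<in> {{P \<in> prob_measures XD. (\<integral>x. f x \<partial>P) \<in> U} | f (U :: real set).
        continuous_map XD euclideanreal f \<and> bounded (f ` topspace XD) \<and> open U}"
  then obtain f :: "(real \<Rightarrow> real ^ 'd) \<Rightarrow> real" and U where W: "W = {P \<in> prob_measures XD. (\<integral>x. f x \<partial>P) \<in> U}"
    and f: "continuous_map XD euclideanreal f" "bounded (f ` topspace XD)" "open U" by blast
  obtain B where B: "\<And>\<gamma>. \<gamma> \<in> topspace XD \<Longrightarrow> \<bar>f \<gamma>\<bar> \<le> B" by (rule continuous_map_bounded_XD[OF f(2)]) blast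
  have "occupation S -` W \<inter> topspace XD = {\<gamma> \<in> topspace XD. time_average S f \<gamma> \<in> U}"
    unfolding W using occupation_prob[OF S] integral_occupation[OF S _ continuous_map_borel_measurable[OF f(1)]] by auto
  then show "openin XD (occupation S -` W \<inter> topspace XD)" using openin_time_average[OF S f(1) B f(3)] by simp
next
  have "prob_measures (XD :: (real \<Rightarrow> real ^ 'd) topology) \<in> {{P \<in> prob_measures XD. (\<integral>x. f x \<partial>P) \<in> U} | f (U :: real set).
        continuous_map XD euclideanreal f \<and> bounded (f ` topspace XD) \<and> open U}"
    by (rule CollectI, rule exI[of _ "\<lambda>_. 0"], rule exI[of _ UNIV]) (auto simp: bounded_iff)
  moreover have "occupation S ` topspace XD \<subseteq> prob_measures (XD :: (real \<Rightarrow> real ^ 'd) topology)"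
    by (intro image_subsetI occupation_prob S)
  ultimately show "occupation S ` topspace (XD :: (real \<Rightarrow> real ^ 'd) topology) \<subseteq> \<Union> {{P \<in> prob_measures XD. (\<integral>x. f x \<partial>P) \<in> U} | f (U :: real set).
        continuous_map XD euclideanreal f \<and> bounded (f ` topspace XD) \<and> open U}"
    by (rule subset_trans[OF _ Union_upper, rotated])
qed

text \<open>By induction over the generated topology: an intersection takes the union of the finite
  families and the smaller tolerance, a subbasic set takes one functional. It reduces a weak
  neighbourhood to finitely many time averages.\<close>

lemma weak_topology_nbhd:
  assumes "openin (weak_topology X) W" "Q \<in> W"
  obtains F e where "finite F" "e > 0" "\<And>f. f \<in> F \<Longrightarrow> continuous_map X euclideanreal f \<and> bounded (f ` topspace X)"
    "\<And>P. P \<in> prob_measures X \<Longrightarrow> (\<And>f. f \<in> F \<Longrightarrow> \<bar>(\<integral>x. f x \<partial>P) - (\<integral>x. f x \<partial>Q)\<bar> < e) \<Longrightarrow> P \<in> W"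
proof -
  define good where "good W \<longleftrightarrow> (\<exists>F e. finite F \<and> e > 0 \<and> (\<forall>f\<in>F. continuous_map X euclideanreal f \<and> bounded (f ` topspace X)) \<and>
    (\<forall>P\<in>prob_measures X. (\<forall>f\<in>F. \<bar>(\<integral>x. f x \<partial>P) - (\<integral>x. f x \<partial>Q)\<bar> < e) \<longrightarrow> P \<in> W))" for W
  have "generate_topology_on {{P \<in> prob_measures X. (\<integral>x. f x \<partial>P) \<in> U} | f (U :: real set).
     continuous_map X euclideanreal f \<and> bounded (f ` topspace X) \<and> open U} W"
    using assms(1) unfolding weak_topology_def by (rule openin_topology_generated_by)
  then have "Q \<in> W \<longrightarrow> good W"
  proof induction
    case (Int a b)
    show ?case
    proof
      assume "Q \<in> a \<inter> b"
      then have "good a" "good b" using Int.IH by auto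
      then obtain F e G d where "finite F" "e > 0" "finite G" "d > 0"
        "\<forall>f\<in>F. continuous_map X euclideanreal f \<and> bounded (f ` topspace X)"
        "\<forall>f\<in>G. continuous_map X euclideanreal f \<and> bounded (f ` topspace X)"
        "\<forall>P\<in>prob_measures X. (\<forall>f\<in>F. \<bar>(\<integral>x. f x \<partial>P) - (\<integral>x. f x \<partial>Q)\<bar> < e) \<longrightarrow> P \<in> a"
        "\<forall>P\<in>prob_measures X. (\<forall>f\<in>G. \<bar>(\<integral>x. f x \<partial>P) - (\<integral>x. f x \<partial>Q)\<bar> < d) \<longrightarrow> P \<in> b"
        unfolding good_def by blast
      then show "good (a \<inter> b)" unfolding good_def
        by (intro exI[of _ "F \<union> G"] exI[of _ "min e d"]) auto
    qed
  next
    case (UN K)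
    show ?case
    proof
      assume "Q \<in> \<Union>K"
      then obtain k where k: "k \<in> K" "good k" using UN.IH by blast
      then show "good (\<Union>K)" unfolding good_def by (meson UnionI)
    qed
  next
    case (Basis s)
    then obtain f U where s: "s = {P \<in> prob_measures X. (\<integral>x. f x \<partial>P) \<in> U}" and f: "continuous_map X euclideanreal f"
      "bounded (f ` topspace X)" "open U" by blast
    show ?case
    proof
      assume "Q \<in> s"
      then obtain e where "e > 0" "\<And>y. dist y (\<integral>x. f x \<partial>Q) < e \<Longrightarrow> y \<in> U"
        using f(3) s by (auto simp: open_dist)
      then show "good s" unfolding good_def s using f
        by (intro exI[of _ "{f}"] exI[of _ e]) (auto simp: dist_real_def)
    qed
  qed simp
  then have "good W" using assms(2) by simp
  then show thesis unfolding good_def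
  proof (elim exE conjE)
    fix F e
    assume "finite F" "e > 0" and F: "\<forall>f\<in>F. continuous_map X euclideanreal f \<and> bounded (f ` topspace X)"
      and P: "\<forall>P\<in>prob_measures X. (\<forall>f\<in>F. \<bar>(\<integral>x. f x \<partial>P) - (\<integral>x. f x \<partial>Q)\<bar> < e) \<longrightarrow> P \<in> W"
    then show thesis by (intro that[of F e]) simp_all
  qed
qed

context tab_process
begin

lemma time_average_tail:
  fixes f :: "(real \<Rightarrow> real ^ 'd) \<Rightarrow> real"
  assumes f: "continuous_map XD euclideanreal f" and B: "\<And>\<gamma>. \<gamma> \<in> topspace XD \<Longrightarrow> \<bar>f \<gamma>\<bar> \<le> B"
    and e: "e > 0" and \<eta>: "\<eta> > 0"
  obtains S0 where "S0 > 0" "\<And>S P. S \<ge> S0 \<Longrightarrow> loop_path_law S P \<Longrightarrow>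
     emeasure P {\<gamma> \<in> topspace XD. e \<le> \<bar>time_average S f \<gamma> - (\<integral>\<gamma>. f \<gamma> \<partial>Q)\<bar>} \<le> ennreal \<eta>"
proof -
  have f': "continuous_map XD euclideanreal (\<lambda>x. - f x)" using f by (rule continuous_map_minus)
  have B': "\<bar>- f \<gamma>\<bar> \<le> B" if "\<gamma> \<in> topspace XD" for \<gamma> using B[OF that] by simp
  obtain S1 where S1: "S1 > 0" "\<And>S P. S \<ge> S1 \<Longrightarrow> loop_path_law S P \<Longrightarrow>
     emeasure P {\<gamma> \<in> topspace XD. (\<integral>\<gamma>. f \<gamma> \<partial>Q) + e \<le> time_average S f \<gamma>} \<le> ennreal (\<eta> / 2)"
    by (rule time_average_upper_tail[OF f B e, of "\<eta> / 2"]) (use \<eta> in auto)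
  obtain S2 where S2: "S2 > 0" "\<And>S P. S \<ge> S2 \<Longrightarrow> loop_path_law S P \<Longrightarrow>
     emeasure P {\<gamma> \<in> topspace XD. (\<integral>\<gamma>. - f \<gamma> \<partial>Q) + e \<le> time_average S (\<lambda>x. - f x) \<gamma>} \<le> ennreal (\<eta> / 2)"
    by (rule time_average_upper_tail[OF f' B' e, of "\<eta> / 2"]) (use \<eta> in auto)
  show thesis
  proof (rule that[of "max S1 S2"])
    fix S P assume S: "S \<ge> max S1 S2" and P: "loop_path_law S P"
    have Sp: "S > 0" using S S1 by simp
    have sP: "sets P = sets (borel_of XD)" using P by (auto simp: loop_path_law_def)
    have spP: "space P = topspace XD" using sets_eq_imp_space_eq[OF sP] by simp
    have m: "time_average S g \<in> borel_measurable P" if "continuous_map XD euclideanreal g" for g :: "(real \<Rightarrow> real ^ 'd) \<Rightarrow> real"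
      unfolding measurable_cong_sets[OF sP refl] by (rule measurable_time_average[OF Sp continuous_map_borel_measurable[OF that]])
    let ?A = "{\<gamma> \<in> space P. (\<integral>\<gamma>. f \<gamma> \<partial>Q) + e \<le> time_average S f \<gamma>}"
    let ?B = "{\<gamma> \<in> space P. (\<integral>\<gamma>. - f \<gamma> \<partial>Q) + e \<le> time_average S (\<lambda>x. - f x) \<gamma>}"
    have AB: "?A \<in> sets P" "?B \<in> sets P" using m[OF f] m[OF f'] by measurable
    have "{\<gamma> \<in> topspace XD. e \<le> \<bar>time_average S f \<gamma> - (\<integral>\<gamma>. f \<gamma> \<partial>Q)\<bar>} \<subseteq> ?A \<union> ?B"
      by (auto simp: spP time_average_def)
    then have "emeasure P {\<gamma> \<in> topspace XD. e \<le> \<bar>time_average S f \<gamma> - (\<integral>\<gamma>. f \<gamma> \<partial>Q)\<bar>} \<le> emeasure P (?A \<union> ?B)"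
      by (rule emeasure_mono) (use AB in auto)
    also have "\<dots> \<le> emeasure P ?A + emeasure P ?B" by (rule emeasure_subadditive) (use AB in auto)
    also have "\<dots> \<le> ennreal (\<eta> / 2) + ennreal (\<eta> / 2)"
      using S1(2)[OF _ P] S2(2)[OF _ P] S unfolding spP by (intro add_mono) auto
    also have "\<dots> = ennreal \<eta>" using \<eta> by (simp add: ennreal_plus[symmetric] del: ennreal_plus)
    finally show "emeasure P {\<gamma> \<in> topspace XD. e \<le> \<bar>time_average S f \<gamma> - (\<integral>\<gamma>. f \<gamma> \<partial>Q)\<bar>} \<le> ennreal \<eta>" .
  qed (use S1 in auto)
qed

text \<open>A union bound by induction; each new functional takes half of the allowance, and
  therefore \<eta> is generalized.\<close>

lemma time_averages_tail:
  fixes F :: "((real \<Rightarrow> real ^ 'd) \<Rightarrow> real) set"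
  assumes "finite F" "\<And>f. f \<in> F \<Longrightarrow> continuous_map XD euclideanreal f \<and> bounded (f ` topspace XD)"
    and e: "e > 0" and \<eta>: "\<eta> > 0"
  shows "\<exists>S0>0. \<forall>S\<ge>S0. \<forall>P. loop_path_law S P \<longrightarrow>
     emeasure P {\<gamma> \<in> topspace XD. \<exists>f\<in>F. e \<le> \<bar>time_average S f \<gamma> - (\<integral>\<gamma>. f \<gamma> \<partial>Q)\<bar>} \<le> ennreal \<eta>"
  using assms(1,2) \<eta>
proof (induction F arbitrary: \<eta>)
  case empty
  then show ?case by (intro exI[of _ 1]) auto
next
  case (insert f F)
  obtain S1 where S1: "S1 > 0" "\<And>S P. S \<ge> S1 \<Longrightarrow> loop_path_law S P \<Longrightarrow>
     emeasure P {\<gamma> \<in> topspace XD. \<exists>f\<in>F. e \<le> \<bar>time_average S f \<gamma> - (\<integral>\<gamma>. f \<gamma> \<partial>Q)\<bar>} \<le> ennreal (\<eta> / 2)"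
    using insert.IH[of "\<eta> / 2"] insert.prems by auto
  have f: "continuous_map XD euclideanreal f" "bounded (f ` topspace XD)" using insert.prems by auto
  obtain B where B: "\<And>\<gamma>. \<gamma> \<in> topspace XD \<Longrightarrow> \<bar>f \<gamma>\<bar> \<le> B" by (rule continuous_map_bounded_XD[OF f(2)]) blast
  obtain S2 where S2: "S2 > 0" "\<And>S P. S \<ge> S2 \<Longrightarrow> loop_path_law S P \<Longrightarrow>
     emeasure P {\<gamma> \<in> topspace XD. e \<le> \<bar>time_average S f \<gamma> - (\<integral>\<gamma>. f \<gamma> \<partial>Q)\<bar>} \<le> ennreal (\<eta> / 2)"
    by (rule time_average_tail[OF f(1) B e, of "\<eta> / 2"]) (use insert.prems in auto)
  show ?case
  proof (intro exI[of _ "max S1 S2"] conjI allI impI)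
    fix S P assume S: "max S1 S2 \<le> S" and P: "loop_path_law S P"
    have Sp: "S > 0" using S S1 by simp
    have sP: "sets P = sets (borel_of XD)" using P by (auto simp: loop_path_law_def)
    have spP: "space P = topspace XD" using sets_eq_imp_space_eq[OF sP] by simp
    have m: "{\<gamma> \<in> topspace XD. e \<le> \<bar>time_average S g \<gamma> - (\<integral>\<gamma>. g \<gamma> \<partial>Q)\<bar>} \<in> sets P" if "continuous_map XD euclideanreal g" for g :: "(real \<Rightarrow> real ^ 'd) \<Rightarrow> real"
    proof -
      have [measurable]: "time_average S g \<in> borel_measurable P"
        unfolding measurable_cong_sets[OF sP refl] by (rule measurable_time_average[OF Sp continuous_map_borel_measurable[OF that]])
      have "{\<gamma> \<in> space P. e \<le> \<bar>time_average S g \<gamma> - (\<integral>\<gamma>. g \<gamma> \<partial>Q)\<bar>} \<in> sets P" by measurable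
      then show ?thesis unfolding spP .
    qed
    let ?A = "\<lambda>g. {\<gamma> \<in> topspace XD. e \<le> \<bar>time_average S g \<gamma> - (\<integral>\<gamma>. g \<gamma> \<partial>Q)\<bar>}"
    have "{\<gamma> \<in> topspace XD. \<exists>f\<in>F. e \<le> \<bar>time_average S f \<gamma> - (\<integral>\<gamma>. f \<gamma> \<partial>Q)\<bar>} = (\<Union>f\<in>F. ?A f)" by auto
    then have mF: "{\<gamma> \<in> topspace XD. \<exists>f\<in>F. e \<le> \<bar>time_average S f \<gamma> - (\<integral>\<gamma>. f \<gamma> \<partial>Q)\<bar>} \<in> sets P"
      using insert.hyps(1) insert.prems(1) m by (auto intro!: sets.finite_UN)
    have eq: "{\<gamma> \<in> topspace XD. \<exists>f\<in>insert f F. e \<le> \<bar>time_average S f \<gamma> - (\<integral>\<gamma>. f \<gamma> \<partial>Q)\<bar>} =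
      ?A f \<union> {\<gamma> \<in> topspace XD. \<exists>f\<in>F. e \<le> \<bar>time_average S f \<gamma> - (\<integral>\<gamma>. f \<gamma> \<partial>Q)\<bar>}" by auto
    have "emeasure P {\<gamma> \<in> topspace XD. \<exists>f\<in>insert f F. e \<le> \<bar>time_average S f \<gamma> - (\<integral>\<gamma>. f \<gamma> \<partial>Q)\<bar>} \<le> emeasure P (?A f) + emeasure P {\<gamma> \<in> topspace XD. \<exists>f\<in>F. e \<le> \<bar>time_average S f \<gamma> - (\<integral>\<gamma>. f \<gamma> \<partial>Q)\<bar>}"
      unfolding eq by (rule emeasure_subadditive[OF m[OF f(1)] mF])
    also have "\<dots> \<le> ennreal (\<eta> / 2) + ennreal (\<eta> / 2)"
      by (intro add_mono S1(2)[OF _ P] S2(2)[OF _ P]) (use S in simp_all)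
    also have "\<dots> = ennreal \<eta>" using insert.prems by (simp add: ennreal_plus[symmetric] del: ennreal_plus)
    finally show "emeasure P {\<gamma> \<in> topspace XD. \<exists>f\<in>insert f F. e \<le> \<bar>time_average S f \<gamma> - (\<integral>\<gamma>. f \<gamma> \<partial>Q)\<bar>} \<le> ennreal \<eta>" .
  qed (use S1 in auto)
qed

lemma Q_MD: "Q \<in> topspace MD"
  using prob_Q sets_Q by (simp add: MD_def topspace_weak_topology prob_measures_def)

lemma occupation_MD: "S > 0 \<Longrightarrow> \<gamma> \<in> topspace XD \<Longrightarrow> occupation S \<gamma> \<in> topspace MD"
  using occupation_prob by (simp add: MD_def topspace_weak_topology)

text \<open>Outside the event A the values of \<Phi> differ by less than \<epsilon> / 2, on A by at
  most 2 C. The event A forces one of finitely many time averages to deviate, so its probability is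
  small for large S.\<close>

lemma occupation_limit:
  fixes \<Phi> :: "(real \<Rightarrow> real ^ 'd) measure \<Rightarrow> real"
  assumes \<Phi>: "continuous_map MD euclideanreal \<Phi>" "bounded (\<Phi> ` topspace MD)" and \<epsilon>: "\<epsilon> > 0"
  obtains S0 where "S0 > 0" "\<And>S P. S \<ge> S0 \<Longrightarrow> loop_path_law S P \<Longrightarrow> \<bar>(\<integral>\<gamma>. \<Phi> (occupation S \<gamma>) \<partial>P) - \<Phi> Q\<bar> \<le> \<epsilon>"
proof -
  obtain C where C: "\<And>m. m \<in> topspace MD \<Longrightarrow> \<bar>\<Phi> m\<bar> \<le> C" using \<Phi>(2) unfolding bounded_iff by auto
  have C0: "C \<ge> 0" using C[OF Q_MD] by linarith
  define W where "W = {m \<in> topspace MD. \<Phi> m \<in> ball (\<Phi> Q) (\<epsilon> / 2)}"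
  have W: "openin MD W" unfolding W_def
    by (rule openin_continuous_map_preimage[OF \<Phi>(1)]) simp
  have QW: "Q \<in> W" using Q_MD \<epsilon> by (simp add: W_def)
  obtain F e where F: "finite F" "e > 0" "\<And>f. f \<in> F \<Longrightarrow> continuous_map XD euclideanreal f \<and> bounded (f ` topspace XD)"
    "\<And>P. P \<in> prob_measures XD \<Longrightarrow> (\<And>f. f \<in> F \<Longrightarrow> \<bar>(\<integral>x. f x \<partial>P) - (\<integral>x. f x \<partial>Q)\<bar> < e) \<Longrightarrow> P \<in> W"
    by (rule weak_topology_nbhd[OF W[unfolded MD_def] QW]) blast
  \<comment> \<open>With this bound on the probability of A its contribution 2 C \<eta> is at most
    \<epsilon> / 2; C + 1 avoids a zero denominator.\<close>
  define \<eta> where "\<eta> = \<epsilon> / (4 * (C + 1))"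
  have \<eta>: "\<eta> > 0" using \<epsilon> C0 by (simp add: \<eta>_def)
  obtain S0 where S0: "S0 > 0" "\<And>S P. S \<ge> S0 \<Longrightarrow> loop_path_law S P \<Longrightarrow>
     emeasure P {\<gamma> \<in> topspace XD. \<exists>f\<in>F. e \<le> \<bar>time_average S f \<gamma> - (\<integral>\<gamma>. f \<gamma> \<partial>Q)\<bar>} \<le> ennreal \<eta>"
    using time_averages_tail[OF F(1,3,2) \<eta>] by blast
  show thesis
  proof (rule that[OF S0(1)])
    fix S P assume S: "S \<ge> S0" and P: "loop_path_law S P"
    have Sp: "S > 0" using S S0 by simp
    have pP: "prob_space P" and sP: "sets P = sets (borel_of XD)" using P by (auto simp: loop_path_law_def)
    interpret P: prob_space P by (rule pP)
    have spP: "space P = topspace XD" using sets_eq_imp_space_eq[OF sP] by simp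
    have om: "(\<lambda>\<gamma>. \<Phi> (occupation S \<gamma>)) \<in> borel_measurable P"
      unfolding measurable_cong_sets[OF sP refl]
      by (rule measurable_compose[OF continuous_map_borel_of[OF continuous_map_occupation[OF Sp]] continuous_map_borel_measurable[OF \<Phi>(1)]])
    have bound: "\<bar>\<Phi> (occupation S \<gamma>)\<bar> \<le> C" if "\<gamma> \<in> topspace XD" for \<gamma>
      by (rule C[OF occupation_MD[OF Sp that]])
    have oi: "integrable P (\<lambda>\<gamma>. \<Phi> (occupation S \<gamma>))"
      by (rule P.integrable_const_bound[of _ C]) (auto intro!: AE_I2 bound om simp: spP)
    define A where "A = {\<gamma> \<in> space P. \<epsilon> / 2 \<le> \<bar>\<Phi> (occupation S \<gamma>) - \<Phi> Q\<bar>}"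
    have A: "A \<in> sets P" unfolding A_def using om by measurable
    have "A \<subseteq> {\<gamma> \<in> topspace XD. \<exists>f\<in>F. e \<le> \<bar>time_average S f \<gamma> - (\<integral>\<gamma>. f \<gamma> \<partial>Q)\<bar>}"
    proof
      fix \<gamma> assume "\<gamma> \<in> A"
      then have g: "\<gamma> \<in> topspace XD" and far: "\<epsilon> / 2 \<le> \<bar>\<Phi> (occupation S \<gamma>) - \<Phi> Q\<bar>" by (auto simp: A_def spP)
      have "occupation S \<gamma> \<notin> W" using far by (auto simp: W_def dist_real_def abs_minus_commute)
      then obtain f where f: "f \<in> F" "e \<le> \<bar>(\<integral>x. f x \<partial>occupation S \<gamma>) - (\<integral>x. f x \<partial>Q)\<bar>"
        using F(4)[OF occupation_prob[OF Sp g]] by (meson not_le)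
      then show "\<gamma> \<in> {\<gamma> \<in> topspace XD. \<exists>f\<in>F. e \<le> \<bar>time_average S f \<gamma> - (\<integral>\<gamma>. f \<gamma> \<partial>Q)\<bar>}"
        using g F(3) integral_occupation[OF Sp g continuous_map_borel_measurable] by auto
    qed
    moreover have "{\<gamma> \<in> topspace XD. \<exists>f\<in>F. e \<le> \<bar>time_average S f \<gamma> - (\<integral>\<gamma>. f \<gamma> \<partial>Q)\<bar>} \<in> sets P"
    proof -
      have "{\<gamma> \<in> space P. e \<le> \<bar>time_average S g \<gamma> - (\<integral>\<gamma>. g \<gamma> \<partial>Q)\<bar>} \<in> sets P" if "g \<in> F" for g
      proof -
        have [measurable]: "time_average S g \<in> borel_measurable P"
          unfolding measurable_cong_sets[OF sP refl] using F(3)[OF that] by (intro measurable_time_average[OF Sp continuous_map_borel_measurable]) auto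
        show ?thesis by measurable
      qed
      then have "(\<Union>g\<in>F. {\<gamma> \<in> space P. e \<le> \<bar>time_average S g \<gamma> - (\<integral>\<gamma>. g \<gamma> \<partial>Q)\<bar>}) \<in> sets P"
        by (rule sets.finite_UN[OF F(1)])
      moreover have "(\<Union>g\<in>F. {\<gamma> \<in> space P. e \<le> \<bar>time_average S g \<gamma> - (\<integral>\<gamma>. g \<gamma> \<partial>Q)\<bar>}) =
        {\<gamma> \<in> topspace XD. \<exists>f\<in>F. e \<le> \<bar>time_average S f \<gamma> - (\<integral>\<gamma>. f \<gamma> \<partial>Q)\<bar>}" by (auto simp: spP)
      ultimately show ?thesis by simp
    qed
    ultimately have "emeasure P A \<le> ennreal \<eta>" using S0(2)[OF S P] emeasure_mono order_trans by blast
    then have PA: "measure P A \<le> \<eta>" using \<eta> by (simp add: P.emeasure_eq_measure)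
    have Ai: "integrable P (\<lambda>\<gamma>. \<epsilon> / 2 + 2 * C * indicator A \<gamma>)"
      by (intro Bochner_Integration.integrable_add integrable_mult_right integrable_real_indicator A P.integrable_const)
        (simp add: P.emeasure_eq_measure)
    have "\<bar>(\<integral>\<gamma>. \<Phi> (occupation S \<gamma>) \<partial>P) - \<Phi> Q\<bar> = \<bar>\<integral>\<gamma>. \<Phi> (occupation S \<gamma>) - \<Phi> Q \<partial>P\<bar>"
      using oi by (simp add: P.prob_space)
    also have "\<dots> \<le> (\<integral>\<gamma>. \<bar>\<Phi> (occupation S \<gamma>) - \<Phi> Q\<bar> \<partial>P)" by (rule integral_abs_bound)
    also have "\<dots> \<le> (\<integral>\<gamma>. \<epsilon> / 2 + 2 * C * indicator A \<gamma> \<partial>P)"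
    proof (rule integral_mono[OF _ Ai])
      show "integrable P (\<lambda>\<gamma>. \<bar>\<Phi> (occupation S \<gamma>) - \<Phi> Q\<bar>)" using oi by simp
      fix \<gamma> assume g: "\<gamma> \<in> space P"
      show "\<bar>\<Phi> (occupation S \<gamma>) - \<Phi> Q\<bar> \<le> \<epsilon> / 2 + 2 * C * indicator A \<gamma>"
      proof (cases "\<gamma> \<in> A")
        case True
        then show ?thesis using bound[of \<gamma>] C[OF Q_MD] g \<epsilon> by (simp add: spP)
      qed (use g in \<open>simp add: A_def\<close>)
    qed
    also have "\<dots> = \<epsilon> / 2 + 2 * C * measure P A"
      using A by (subst Bochner_Integration.integral_add) (auto simp: P.prob_space P.emeasure_eq_measure)
    also have "\<dots> \<le> \<epsilon> / 2 + 2 * C * \<eta>" using PA C0 by (intro add_left_mono mult_left_mono) auto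
    also have "\<dots> \<le> \<epsilon>" using C0 \<epsilon> by (simp add: \<eta>_def field_simps)
    finally show "\<bar>(\<integral>\<gamma>. \<Phi> (occupation S \<gamma>) \<partial>P) - \<Phi> Q\<bar> \<le> \<epsilon>" .
  qed
qed

end

text \<open>Moves the integral from measures to paths, where \<open>occupation_limit\<close> applies
  with the law of the rescaled loop.\<close>

lemma (in cube_loop) integral_mark_law:
  fixes \<Phi> :: "(real \<Rightarrow> real ^ 'd) measure \<Rightarrow> real"
  assumes \<Phi>: "continuous_map MD euclideanreal \<Phi>"
  shows "(\<integral>m. \<Phi> m \<partial>mark_law q B L T) = (\<integral>\<gamma>. \<Phi> (occupation S \<gamma>) \<partial>path_law)"
proof -
  have om: "occupation S \<in> borel_of XD \<rightarrow>\<^sub>M borel_of (MD :: (real \<Rightarrow> real ^ 'd) measure topology)"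
    by (rule continuous_map_borel_of[OF continuous_map_occupation[OF S_pos]])
  have \<Phi>m: "\<Phi> \<in> borel_measurable (borel_of MD)" by (rule continuous_map_borel_measurable[OF \<Phi>])
  have mark: "mark L T = (\<lambda>\<omega>. occupation S (rescaled_loop L T \<omega>))"
    by (rule ext) (simp add: mark_eq_occupation S_def)
  have "(\<integral>m. \<Phi> m \<partial>mark_law q B L T) = (\<integral>\<omega>. \<Phi> (occupation S (rescaled_loop L T \<omega>)) \<partial>loop)"
    unfolding mark_law_def mark
    by (rule integral_distr[OF measurable_compose[OF measurable_rescaled_loop' om] \<Phi>m])
  also have "\<dots> = (\<integral>\<gamma>. \<Phi> (occupation S \<gamma>) \<partial>path_law)"
    unfolding path_law_def by (rule integral_distr[symmetric, OF measurable_rescaled_loop' measurable_compose[OF om \<Phi>m]])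
  finally show ?thesis .
qed

theorem proposition4p3:
  fixes \<beta> \<delta> R :: real
    and q :: "real \<Rightarrow> real \<Rightarrow> real ^ 'd \<Rightarrow> real ^ 'd \<Rightarrow> real"
    and p :: "real \<Rightarrow> real ^ 'd \<Rightarrow> real ^ 'd \<Rightarrow> real"
    and bridge :: "real \<Rightarrow> nat \<Rightarrow> real ^ 'd \<Rightarrow> (real \<Rightarrow> real ^ 'd) measure"
    and Qtab :: "(real \<Rightarrow> real ^ 'd) measure"
    and \<Phi> :: "(real \<Rightarrow> real ^ 'd) measure \<Rightarrow> real"
  assumes "CARD('d) > 2" and "\<beta> > 0"
    and "\<And>L. L > 0 \<Longrightarrow> dirichlet_heat_kernel (cube L) (q L)"
    and "\<And>L j a. L > 0 \<Longrightarrow> j > 0 \<Longrightarrow> a \<in> cube L \<Longrightarrow>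
           killed_bridge_law (cube L) (q L) (\<beta> * real j) a (bridge L j a)"
    and "dirichlet_heat_kernel (cube 1) p"
    and "tab_two_sided_law p Qtab"
    and "0 < \<delta>" and "\<delta> < R"
    and "continuous_map MD euclideanreal \<Phi>" and "bounded (\<Phi> ` topspace MD)"
  shows "((\<lambda>L. SUP j\<in>{j::nat. \<delta> \<le> real j / L ^ CARD('d) \<and> real j / L ^ CARD('d) \<le> R}.
             \<bar>(\<integral>m. \<Phi> m \<partial>mark_law (q L) (bridge L j) L (\<beta> * real j)) - \<Phi> Qtab\<bar>)
           \<longlongrightarrow> 0) at_top"
proof -
  let ?J = "\<lambda>L. {j::nat. \<delta> \<le> real j / L ^ CARD('d) \<and> real j / L ^ CARD('d) \<le> R}"
  let ?E = "\<lambda>L j. \<bar>(\<integral>m. \<Phi> m \<partial>mark_law (q L) (bridge L j) L (\<beta> * real j)) - \<Phi> Qtab\<bar>"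
  interpret tab_process p Qtab by unfold_locales fact+
  have pow: "L \<le> L ^ k" if "L \<ge> 1" "k > 0" for L :: real and k :: nat
    using power_increasing[of 1 k L] that by simp
  show ?thesis
  proof (rule tendstoI)
    fix r :: real assume r: "r > 0"
    obtain S0 where S0: "S0 > 0" "\<And>S P. S \<ge> S0 \<Longrightarrow> loop_path_law S P \<Longrightarrow> \<bar>(\<integral>\<gamma>. \<Phi> (occupation S \<gamma>) \<partial>P) - \<Phi> Qtab\<bar> \<le> r / 2"
      by (rule occupation_limit[OF assms(9,10), of "r / 2"]) (use r in auto)
    show "\<forall>\<^sub>F L in at_top. dist (SUP j\<in>?J L. ?E L j) 0 < r"
      using eventually_ge_at_top[of "1::real"] eventually_ge_at_top[of "S0 / (\<beta> * \<delta>)"] eventually_ge_at_top[of "1 / (R - \<delta>)"]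
    proof eventually_elim
      case (elim L)
      have L: "L > 0" using elim by simp
      have LV: "L \<le> L ^ CARD('d)" by (rule pow) (use elim in auto)
      have V: "L ^ CARD('d) > 0" using L by simp
      have E: "?E L j \<le> r / 2" if j: "j \<in> ?J L" for j
      proof -
        have jV: "\<delta> * L ^ CARD('d) \<le> real j" using j V by (simp add: pos_le_divide_eq)
        have j0: "real j > 0" using jV assms(7) V by (smt (verit) mult_pos_pos)
        interpret cube_loop p Qtab L "\<beta> * real j" "q L" "bridge L j"
          by unfold_locales (use L assms(2,3,4) j0 in auto)
        \<comment> \<open>For d > 2 and L \<ge> 1 the power L^(d-2) is at least L, so a threshold on
          L alone puts S above S0 for every admissible j.\<close>
        have "S0 \<le> \<beta> * \<delta> * L" using elim(2) assms(2,7) by (simp add: field_simps)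
        also have "\<dots> \<le> \<beta> * \<delta> * L ^ (CARD('d) - 2)"
          using pow[of L "CARD('d) - 2"] elim(1) assms(1,2,7) by (intro mult_left_mono) auto
        also have "L ^ (CARD('d) - 2) = L ^ CARD('d) / L\<^sup>2"
          using L assms(1) by (simp add: power_diff)
        also have "\<beta> * \<delta> * (L ^ CARD('d) / L\<^sup>2) = \<beta> * (\<delta> * L ^ CARD('d)) / L\<^sup>2" by simp
        also have "\<dots> \<le> S"
          unfolding S_def using jV assms(2) by (intro divide_right_mono mult_left_mono) auto
        finally have "S0 \<le> S" .
        from S0(2)[OF this loop_path_law_path_law] show ?thesis
          unfolding integral_mark_law[OF assms(9)] .
      qed
      \<comment> \<open>A real supremum over an empty index set has no known value, so an admissible
        j is exhibited: once L \<ge> 1 / (R - \<delta>), the interval from \<delta> L^d to R L^d has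
        length at least 1 and contains the rounded-up left end.\<close>
      define j where "j = nat \<lceil>\<delta> * L ^ CARD('d)\<rceil>"
      have "real j \<ge> \<delta> * L ^ CARD('d)" "real j \<le> \<delta> * L ^ CARD('d) + 1"
        using assms(7) V by (auto simp: j_def intro: less_imp_le)
      moreover have "1 \<le> (R - \<delta>) * L ^ CARD('d)"
      proof -
        have "1 \<le> (R - \<delta>) * L" using elim(3) assms(8) by (simp add: field_simps)
        also have "\<dots> \<le> (R - \<delta>) * L ^ CARD('d)" using LV assms(8) by (intro mult_left_mono) auto
        finally show ?thesis .
      qed
      ultimately have j: "j \<in> ?J L" using V by (simp add: pos_le_divide_eq pos_divide_le_eq left_diff_distrib)
      have le: "(SUP j\<in>?J L. ?E L j) \<le> r / 2" by (rule cSUP_least) (use j E in auto)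
      have "0 \<le> ?E L j" by simp
      also have "\<dots> \<le> (SUP j\<in>?J L. ?E L j)"
        by (rule cSUP_upper[OF j]) (rule bdd_aboveI2[of _ _ "r / 2"], rule E)
      finally show ?case using le r by (simp add: dist_real_def)
    qed
  qed
qed

end
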